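(* Let $A$ and $B$ be rings and let ${}_B\Sigma_A$ be a $(B,A)$-bimodule such that ${}_B\Sigma$ is faithful and $\Sigma_A$ is finitely generated and projective. Let $S=\mathrm{End}(\Sigma_A)$, with $B\subset S$ via the canonical injective ring map. Then: (1) The map $$\widehat{(-)}:\mathrm{End}_{A\text{-}cor}(\Sigma^*\otimes_B\Sigma)\longrightarrow\mathrm{End}_{S\text{-}cor}(S\otimes_BS),\qquad g\longmapsto\widehat{g}=(\xi\otimes_B\xi)\circ(\Sigma\otimes_Ag\otimes_A\Sigma^* )\circ(\xi^{-1}\otimes_B\xi^{-1})$$ is an injective homomorphism of monoids, and $\widehat{(-)}\circ\Gamma^l=\overline{\Gamma}^l$ as maps $\mathbf{I}_B^l(S)\to\mathrm{End}_{S\text{-}cor}(S\otimes_BS)$, where for $I\in\mathbf{I}_B^l(S)$ with $\mathbf{m}^{-1}(1)=\sum_ks_k\otimes_Bx_k\in S\otimes_BI$, $$\Gamma^l(I):\ \Sigma^*\otimes_B\Sigma\to\Sigma^*\otimes_B\Sigma,\quad u^*\otimes_Bu\mapsto\sum_ku^*s_k\otimes_Bx_ku,$$ $$\overline{\Gamma}^l(I):\ S\otimes_BS\to S\otimes_BS,\quad s\otimes_Bs'\mapsto\sum_kss_k\otimes_Bx_ks'.$$ (2) For every $g\in\mathrm{End}_{A\text{-}cor}(\Sigma^*\otimes_B\Sigma)$ we have, as subsets of $S$, $$\mathrm{Hom}_{\Sigma^*\otimes_B\Sigma}(\Sigma_g,\Sigma)=\mathrm{Hom}_{S\otimes_BS}(S_{\widehat{g}},S)=\{s\in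 S\mid\widehat{g}(s\otimes_B1)=1\otimes_Bs\}.$$
   Context: All rings are unital algebras over a commutative ring $K$, modules are unital, and bimodules are central over $K$. An identity map is denoted by its object. An $A$-coring is an $A$-bimodule $\mathfrak{C}$ with $A$-bilinear maps $\Delta:\mathfrak{C}\to\mathfrak{C}\otimes_A\mathfrak{C}$, $\varepsilon:\mathfrak{C}\to A$ satisfying coassociativity and the counit axioms; morphisms of $A$-corings are $A$-bilinear maps commuting with $\Delta$ and $\varepsilon$. $\mathrm{End}_{A\text{-}cor}(\mathfrak{C})$ is the monoid of $A$-coring endomorphisms under composition. A right $\mathfrak{C}$-comodule is a right $A$-module $M$ with a right $A$-linear coassociative and counital coaction $\rho_M:M\to M\otimes_A\mathfrak{C}$; $\mathrm{Hom}_{\mathfrak{C}}(-,-)$ denotes colinear maps. For $g\in\mathrm{End}_{A\text{-}cor}(\mathfrak{C})$ and a right $\mathfrak{C}$-comodule $X$, $X_g$ denotes $X$ with coaction $(X\otimes_Ag)\circ\rho_X$. $\Sigma^*=\mathrm{Hom}(\Sigma_A,A_A)$ is an $(A,B)$-bimodule and $\{(e_i,e_i^* )\}_i\subset\Sigma\times\Sigma^*$ is a finite dual basis of $\Sigma_A$. The comatrix $A$-coring $\Sigma^*\otimes_B\Sigma$ has $\Delta(u^*\otimes_Bu)=\sum_iu^*\otimes_Be_i\otimes_Ae_i^*\otimes_Bu$ and $\varepsilon(u^*\otimes_Bu)=u^*(u)$. $\Sigma$ is a right comodule over it with coaction $\rho_\Sigma(u)=\sum_ie_i\otimes_Ae_i^*\otimes_Bu$.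 $S=\mathrm{End}(\Sigma_A)$ (composition) acts on the left of $\Sigma$ and on the right of $\Sigma^*$ by $u^*s=u^*\circ s$. $\xi:\Sigma\otimes_A\Sigma^*\to S$, $u\otimes_Av^*\mapsto[x\mapsto u\,v^*(x)]$, is an isomorphism of $S$-bimodules with inverse $s\mapsto\sum_ise_i\otimes_Ae_i^*$. The Sweedler $S$-coring $S\otimes_BS$ has comultiplication $s\otimes_Bs'\mapsto(s\otimes_B1)\otimes_S(1\otimes_Bs')$ and counit given by multiplication. $S$ is a right $S\otimes_BS$-comodule with coaction $s\mapsto1\otimes_Bs\in S\otimes_BS\cong S\otimes_S(S\otimes_BS)$. $\mathrm{Hom}_{S\otimes_BS}(S_{\widehat g},S)$ is regarded as a subset of $S$ by identifying a right $S$-linear map $f:S\to S$ with $f(1)$ (so $s\in S$ corresponds to left multiplication by $s$). $\mathrm{Hom}_{\Sigma^*\otimes_B\Sigma}(\Sigma_g,\Sigma)$ is a subset of $S$ since its elements are right $A$-linear endomorphisms of $\Sigma$. $\mathbf{I}_B^l(S)$ is the monoid (under the product of sub-bimodules $IJ$, with unit $B$) of all $B$-sub-bimodules $I\subseteq S$ such that the multiplication map $\mathbf{m}:S\otimes_BI\to S$, $s\otimes_Bx\mapsto sx$, is an isomorphism. *)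

theory Defs
  imports "HOL-Algebra.Free_Abelian_Groups" "HOL-Algebra.AbelCoset" "HOL-Algebra.Module"
begin

section \<open>Bimodules over noncommutative rings\<close>

text \<open>Following the record \<^type>\<open>module\<close> of the library, a bimodule extends the ring record;
  only its additive part is used, the fields \<^const>\<open>monoid.mult\<close> and \<^const>\<open>monoid.one\<close> are irrelevant.\<close>

record ('r, 's, 'm) bimod = "'m ring" +
  lact :: "'r \<Rightarrow> 'm \<Rightarrow> 'm"  (infixr "\<triangleright>\<index>" 75)
  ract :: "'m \<Rightarrow> 's \<Rightarrow> 'm"  (infixl "\<triangleleft>\<index>" 75)

locale bimodule = R: ring R + S: ring S + M: abelian_group M
  for R :: "('r, 'x) ring_scheme" (structure) and S :: "('s, 'y) ring_scheme" (structure)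
    and M :: "('r, 's, 'm, 'z) bimod_scheme" (structure) +
  assumes lact_closed: "\<lbrakk>r \<in> carrier R; x \<in> carrier M\<rbrakk> \<Longrightarrow> r \<triangleright>\<^bsub>M\<^esub> x \<in> carrier M"
    and ract_closed: "\<lbrakk>x \<in> carrier M; s \<in> carrier S\<rbrakk> \<Longrightarrow> x \<triangleleft>\<^bsub>M\<^esub> s \<in> carrier M"
    and lact_add: "\<lbrakk>r \<in> carrier R; x \<in> carrier M; y \<in> carrier M\<rbrakk>
      \<Longrightarrow> r \<triangleright>\<^bsub>M\<^esub> (x \<oplus>\<^bsub>M\<^esub> y) = r \<triangleright>\<^bsub>M\<^esub> x \<oplus>\<^bsub>M\<^esub> r \<triangleright>\<^bsub>M\<^esub> y"
    and lact_ring_add: "\<lbrakk>r \<in> carrier R; r' \<in> carrier R; x \<in> carrier M\<rbrakk>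
      \<Longrightarrow> (r \<oplus>\<^bsub>R\<^esub> r') \<triangleright>\<^bsub>M\<^esub> x = r \<triangleright>\<^bsub>M\<^esub> x \<oplus>\<^bsub>M\<^esub> r' \<triangleright>\<^bsub>M\<^esub> x"
    and lact_mult: "\<lbrakk>r \<in> carrier R; r' \<in> carrier R; x \<in> carrier M\<rbrakk>
      \<Longrightarrow> (r \<otimes>\<^bsub>R\<^esub> r') \<triangleright>\<^bsub>M\<^esub> x = r \<triangleright>\<^bsub>M\<^esub> (r' \<triangleright>\<^bsub>M\<^esub> x)"
    and lact_one: "x \<in> carrier M \<Longrightarrow> \<one>\<^bsub>R\<^esub> \<triangleright>\<^bsub>M\<^esub> x = x"
    and ract_add: "\<lbrakk>x \<in> carrier M; y \<in> carrier M; s \<in> carrier S\<rbrakk>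
      \<Longrightarrow> (x \<oplus>\<^bsub>M\<^esub> y) \<triangleleft>\<^bsub>M\<^esub> s = x \<triangleleft>\<^bsub>M\<^esub> s \<oplus>\<^bsub>M\<^esub> y \<triangleleft>\<^bsub>M\<^esub> s"
    and ract_ring_add: "\<lbrakk>x \<in> carrier M; s \<in> carrier S; s' \<in> carrier S\<rbrakk>
      \<Longrightarrow> x \<triangleleft>\<^bsub>M\<^esub> (s \<oplus>\<^bsub>S\<^esub> s') = x \<triangleleft>\<^bsub>M\<^esub> s \<oplus>\<^bsub>M\<^esub> x \<triangleleft>\<^bsub>M\<^esub> s'"
    and ract_mult: "\<lbrakk>x \<in> carrier M; s \<in> carrier S; s' \<in> carrier S\<rbrakk>
      \<Longrightarrow> x \<triangleleft>\<^bsub>M\<^esub> (s \<otimes>\<^bsub>S\<^esub> s') = (x \<triangleleft>\<^bsub>M\<^esub> s) \<triangleleft>\<^bsub>M\<^esub> s'"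
    and ract_one: "x \<in> carrier M \<Longrightarrow> x \<triangleleft>\<^bsub>M\<^esub> \<one>\<^bsub>S\<^esub> = x"
    and lact_ract_assoc: "\<lbrakk>r \<in> carrier R; x \<in> carrier M; s \<in> carrier S\<rbrakk>
      \<Longrightarrow> (r \<triangleright>\<^bsub>M\<^esub> x) \<triangleleft>\<^bsub>M\<^esub> s = r \<triangleright>\<^bsub>M\<^esub> (x \<triangleleft>\<^bsub>M\<^esub> s)"

definition k_algebra :: "('k, 'x) ring_scheme \<Rightarrow> ('k \<Rightarrow> 'a) \<Rightarrow> ('a, 'y) ring_scheme \<Rightarrow> bool"
  where "k_algebra K \<eta> R \<longleftrightarrow> cring K \<and> ring R \<and> \<eta> \<in> ring_hom K R \<and>
    (\<forall>k\<in>carrier K. \<forall>r\<in>carrier R. \<eta> k \<otimes>\<^bsub>R\<^esub> r = r \<otimes>\<^bsub>R\<^esub> \<eta> k)"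

text \<open>\<open>K\<close>-centrality of a bimodule over two \<open>K\<close>-algebras with structure maps \<open>\<eta>\<close> and \<open>\<theta>\<close>.\<close>

definition central_over ::
  "('k, 'x) ring_scheme \<Rightarrow> ('k \<Rightarrow> 'r) \<Rightarrow> ('k \<Rightarrow> 's) \<Rightarrow> ('r, 's, 'm, 'z) bimod_scheme \<Rightarrow> bool"
  where "central_over K \<eta> \<theta> M \<longleftrightarrow>
    (\<forall>k\<in>carrier K. \<forall>x\<in>carrier M. \<eta> k \<triangleright>\<^bsub>M\<^esub> x = x \<triangleleft>\<^bsub>M\<^esub> \<theta> k)"

definition left_faithful :: "('r, 'x) ring_scheme \<Rightarrow> ('r, 's, 'm, 'z) bimod_scheme \<Rightarrow> bool"
  where "left_faithful R M \<longleftrightarrow>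
    (\<forall>r\<in>carrier R. (\<forall>x\<in>carrier M. r \<triangleright>\<^bsub>M\<^esub> x = \<zero>\<^bsub>M\<^esub>) \<longrightarrow> r = \<zero>\<^bsub>R\<^esub>)"

text \<open>A ring \<open>R\<close> as a bimodule along two ring homomorphisms \<open>\<phi>\<close> (left) and \<open>\<psi>\<close> (right) into \<open>R\<close>.\<close>

definition ring_bimod ::
  "('a, 'x) ring_scheme \<Rightarrow> ('r \<Rightarrow> 'a) \<Rightarrow> ('s \<Rightarrow> 'a) \<Rightarrow> ('r, 's, 'a) bimod"
  where "ring_bimod R \<phi> \<psi> =
    \<lparr>carrier = carrier R, monoid.mult = monoid.mult R, one = \<one>\<^bsub>R\<^esub>, ring.zero = \<zero>\<^bsub>R\<^esub>, ring.add = ring.add R,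
     lact = (\<lambda>r x. \<phi> r \<otimes>\<^bsub>R\<^esub> x), ract = (\<lambda>x s. x \<otimes>\<^bsub>R\<^esub> \<psi> s)\<rparr>"

abbreviation regular :: "('a, 'x) ring_scheme \<Rightarrow> ('a, 'a, 'a) bimod"
  where "regular R \<equiv> ring_bimod R (\<lambda>x. x) (\<lambda>x. x)"

text \<open>All maps are extensional (\<^const>\<open>undefined\<close> off the carrier), so that equality of maps is
  equality of functions on the carrier.\<close>

definition right_hom ::
  "('s, 'x) ring_scheme \<Rightarrow> ('r, 's, 'm, 'y) bimod_scheme \<Rightarrow> ('q, 's, 'n, 'z) bimod_scheme
    \<Rightarrow> ('m \<Rightarrow> 'n) set"
  where "right_hom S M N = {f \<in> carrier M \<rightarrow>\<^sub>E carrier N.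
    (\<forall>x\<in>carrier M. \<forall>y\<in>carrier M. f (x \<oplus>\<^bsub>M\<^esub> y) = f x \<oplus>\<^bsub>N\<^esub> f y) \<and>
    (\<forall>x\<in>carrier M. \<forall>s\<in>carrier S. f (x \<triangleleft>\<^bsub>M\<^esub> s) = f x \<triangleleft>\<^bsub>N\<^esub> s)}"

definition bimod_hom ::
  "('r, 'w) ring_scheme \<Rightarrow> ('s, 'x) ring_scheme \<Rightarrow> ('r, 's, 'm, 'y) bimod_scheme
    \<Rightarrow> ('r, 's, 'n, 'z) bimod_scheme \<Rightarrow> ('m \<Rightarrow> 'n) set"
  where "bimod_hom R S M N = {f \<in> right_hom S M N.
    \<forall>r\<in>carrier R. \<forall>x\<in>carrier M. f (r \<triangleright>\<^bsub>M\<^esub> x) = r \<triangleright>\<^bsub>N\<^esub> f x}"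

definition bimod_iso ::
  "('r, 'w) ring_scheme \<Rightarrow> ('s, 'x) ring_scheme \<Rightarrow> ('r, 's, 'm, 'y) bimod_scheme
    \<Rightarrow> ('r, 's, 'n, 'z) bimod_scheme \<Rightarrow> ('m \<Rightarrow> 'n) set"
  where "bimod_iso R S M N = {f \<in> bimod_hom R S M N. bij_betw f (carrier M) (carrier N)}"


section \<open>Finitely generated projective right modules\<close>

definition finitely_generated :: "('s, 'x) ring_scheme \<Rightarrow> ('r, 's, 'm, 'z) bimod_scheme \<Rightarrow> bool"
  where "finitely_generated S M \<longleftrightarrow> (\<exists>G. finite G \<and> G \<subseteq> carrier M \<and>
    (\<forall>x\<in>carrier M. \<exists>c\<in>G \<rightarrow> carrier S. x = (\<Oplus>\<^bsub>M\<^esub>g\<in>G. g \<triangleleft>\<^bsub>M\<^esub> c g)))"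

definition free_mod :: "('s, 'x) ring_scheme \<Rightarrow> 'i set \<Rightarrow> ('s, 's, 'i \<Rightarrow> 's) bimod"
  where "free_mod S X =
    \<lparr>carrier = {v \<in> X \<rightarrow>\<^sub>E carrier S. finite {i \<in> X. v i \<noteq> \<zero>\<^bsub>S\<^esub>}},
     monoid.mult = undefined, one = undefined,
     ring.zero = (\<lambda>i\<in>X. \<zero>\<^bsub>S\<^esub>), ring.add = (\<lambda>v w. \<lambda>i\<in>X. v i \<oplus>\<^bsub>S\<^esub> w i),
     lact = (\<lambda>s v. \<lambda>i\<in>X. s \<otimes>\<^bsub>S\<^esub> v i), ract = (\<lambda>v s. \<lambda>i\<in>X. v i \<otimes>\<^bsub>S\<^esub> s)\<rparr>"

text \<open>Direct summands of free modules.  Index sets in the type of the module itself suffice,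
  because the free module on the underlying set maps onto the module.\<close>

definition projective :: "('s, 'x) ring_scheme \<Rightarrow> ('r, 's, 'm, 'z) bimod_scheme \<Rightarrow> bool"
  where "projective S M \<longleftrightarrow> (\<exists>X :: 'm set.
    \<exists>i \<in> right_hom S M (free_mod S X). \<exists>p \<in> right_hom S (free_mod S X) M.
      \<forall>x\<in>carrier M. p (i x) = x)"

definition dual :: "('a, 'x) ring_scheme \<Rightarrow> ('b, 'a, 'm, 'z) bimod_scheme \<Rightarrow> ('a, 'b, 'm \<Rightarrow> 'a) bimod"
  where "dual A M =
    \<lparr>carrier = right_hom A M (regular A), monoid.mult = undefined, one = undefined,
     ring.zero = (\<lambda>x\<in>carrier M. \<zero>\<^bsub>A\<^esub>), ring.add = (\<lambda>u v. \<lambda>x\<in>carrier M. u x \<oplus>\<^bsub>A\<^esub> v x),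
     lact = (\<lambda>a u. \<lambda>x\<in>carrier M. a \<otimes>\<^bsub>A\<^esub> u x), ract = (\<lambda>u b. \<lambda>x\<in>carrier M. u (b \<triangleright>\<^bsub>M\<^esub> x))\<rparr>"

definition dual_basis ::
  "('a, 'x) ring_scheme \<Rightarrow> ('b, 'a, 'm, 'z) bimod_scheme \<Rightarrow> 'i set \<Rightarrow> ('i \<Rightarrow> 'm) \<Rightarrow> ('i \<Rightarrow> 'm \<Rightarrow> 'a) \<Rightarrow> bool"
  where "dual_basis A M J e e' \<longleftrightarrow> finite J \<and> e \<in> J \<rightarrow> carrier M \<and> e' \<in> J \<rightarrow> carrier (dual A M) \<and>
    (\<forall>x\<in>carrier M. x = (\<Oplus>\<^bsub>M\<^esub>i\<in>J. e i \<triangleleft>\<^bsub>M\<^esub> e' i x))"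

definition end_ring :: "('a, 'x) ring_scheme \<Rightarrow> ('b, 'a, 'm, 'z) bimod_scheme \<Rightarrow> ('m \<Rightarrow> 'm) ring"
  where "end_ring A M =
    \<lparr>carrier = right_hom A M M, monoid.mult = compose (carrier M), one = (\<lambda>x\<in>carrier M. x),
     ring.zero = (\<lambda>x\<in>carrier M. \<zero>\<^bsub>M\<^esub>), ring.add = (\<lambda>f g. \<lambda>x\<in>carrier M. f x \<oplus>\<^bsub>M\<^esub> g x)\<rparr>"

text \<open>The canonical ring map into the endomorphism ring; it is injective on faithful modules.\<close>

definition left_mult :: "('b, 'a, 'm, 'z) bimod_scheme \<Rightarrow> 'b \<Rightarrow> ('m \<Rightarrow> 'm)"
  where "left_mult M b = (\<lambda>x\<in>carrier M. b \<triangleright>\<^bsub>M\<^esub> x)"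


section \<open>Tensor products\<close>

text \<open>\<open>M \<otimes>\<^sub>R N\<close> is the quotient of the free abelian group on \<open>M \<times> N\<close> by the usual relations; its
  elements are cosets.\<close>

definition tensor_rels ::
  "('r, 'x) ring_scheme \<Rightarrow> ('l, 'r, 'm, 'y) bimod_scheme \<Rightarrow> ('r, 's, 'n, 'z) bimod_scheme
    \<Rightarrow> (('m \<times> 'n) \<Rightarrow>\<^sub>0 int) set"
  where "tensor_rels R M N =
    {frag_of (x \<oplus>\<^bsub>M\<^esub> x', y) - frag_of (x, y) - frag_of (x', y) | x x' y.
       x \<in> carrier M \<and> x' \<in> carrier M \<and> y \<in> carrier N} \<union>
    {frag_of (x, y \<oplus>\<^bsub>N\<^esub> y') - frag_of (x, y) - frag_of (x, y') | x y y'.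
       x \<in> carrier M \<and> y \<in> carrier N \<and> y' \<in> carrier N} \<union>
    {frag_of (x \<triangleleft>\<^bsub>M\<^esub> r, y) - frag_of (x, r \<triangleright>\<^bsub>N\<^esub> y) | x r y.
       x \<in> carrier M \<and> r \<in> carrier R \<and> y \<in> carrier N}"

definition tensor_sub ::
  "('r, 'x) ring_scheme \<Rightarrow> ('l, 'r, 'm, 'y) bimod_scheme \<Rightarrow> ('r, 's, 'n, 'z) bimod_scheme
    \<Rightarrow> (('m \<times> 'n) \<Rightarrow>\<^sub>0 int) set"
  where "tensor_sub R M N =
    generate (free_Abelian_group (carrier M \<times> carrier N)) (tensor_rels R M N)"

definition tensor_group ::
  "('r, 'x) ring_scheme \<Rightarrow> ('l, 'r, 'm, 'y) bimod_scheme \<Rightarrow> ('r, 's, 'n, 'z) bimod_scheme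
    \<Rightarrow> (('m \<times> 'n) \<Rightarrow>\<^sub>0 int) set ring"
  where "tensor_group R M N =
    (let Q = free_Abelian_group (carrier M \<times> carrier N) Mod tensor_sub R M N
     in \<lparr>carrier = carrier Q, monoid.mult = undefined, one = undefined, ring.zero = \<one>\<^bsub>Q\<^esub>, ring.add = monoid.mult Q\<rparr>)"

text \<open>The elementary tensor \<open>x \<otimes>\<^sub>R y\<close>.\<close>

definition tens ::
  "('r, 'x) ring_scheme \<Rightarrow> ('l, 'r, 'm, 'y) bimod_scheme \<Rightarrow> ('r, 's, 'n, 'z) bimod_scheme
    \<Rightarrow> 'm \<Rightarrow> 'n \<Rightarrow> (('m \<times> 'n) \<Rightarrow>\<^sub>0 int) set"
  where "tens R M N x y =
    tensor_sub R M N #>\<^bsub>free_Abelian_group (carrier M \<times> carrier N)\<^esub> frag_of (x, y)"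

text \<open>The additive map \<open>T \<rightarrow> P\<close> with \<open>x \<otimes> y \<mapsto> f x y\<close>, for \<open>T\<close> a tensor product and \<open>f\<close> balanced: an
  element \<open>\<Sum>\<^sub>k n\<^sub>k (x\<^sub>k \<otimes> y\<^sub>k)\<close>, \<open>n\<^sub>k\<close> integers, is sent to \<open>\<Sum>\<^sub>k n\<^sub>k f x\<^sub>k y\<^sub>k\<close>.  The value does not depend on
  the chosen representative since \<open>f\<close> is balanced.\<close>

definition tlift ::
  "((('m \<times> 'n) \<Rightarrow>\<^sub>0 int) set, 'x) ring_scheme \<Rightarrow> ('p, 'y) ring_scheme \<Rightarrow> ('m \<Rightarrow> 'n \<Rightarrow> 'p)
    \<Rightarrow> (('m \<times> 'n) \<Rightarrow>\<^sub>0 int) set \<Rightarrow> 'p"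
  where "tlift T P f = (\<lambda>t\<in>carrier T.
    (let c = (SOME c. c \<in> t)
     in \<Oplus>\<^bsub>P\<^esub>p\<in>Poly_Mapping.keys c. [Poly_Mapping.lookup c p] \<cdot>\<^bsub>P\<^esub> f (fst p) (snd p)))"

definition tensor ::
  "('r, 'x) ring_scheme \<Rightarrow> ('l, 'r, 'm, 'y) bimod_scheme \<Rightarrow> ('r, 's, 'n, 'z) bimod_scheme
    \<Rightarrow> ('l, 's, (('m \<times> 'n) \<Rightarrow>\<^sub>0 int) set) bimod"
  where "tensor R M N =
    (let T = tensor_group R M N
     in \<lparr>carrier = carrier T, monoid.mult = undefined, one = undefined, ring.zero = \<zero>\<^bsub>T\<^esub>, ring.add = ring.add T,
         lact = (\<lambda>l. tlift T T (\<lambda>x y. tens R M N (l \<triangleright>\<^bsub>M\<^esub> x) y)),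
         ract = (\<lambda>t s. tlift T T (\<lambda>x y. tens R M N x (y \<triangleleft>\<^bsub>N\<^esub> s)) t)\<rparr>)"

text \<open>\<open>f \<otimes>\<^sub>R g : M \<otimes>\<^sub>R N \<rightarrow> M' \<otimes>\<^sub>R N'\<close>\<close>

definition tmap ::
  "('r, 'x) ring_scheme \<Rightarrow> ('l, 'r, 'm, 'y) bimod_scheme \<Rightarrow> ('r, 's, 'n, 'z) bimod_scheme
    \<Rightarrow> ('l2, 'r, 'm2, 'y2) bimod_scheme \<Rightarrow> ('r, 's2, 'n2, 'z2) bimod_scheme
    \<Rightarrow> ('m \<Rightarrow> 'm2) \<Rightarrow> ('n \<Rightarrow> 'n2) \<Rightarrow> (('m \<times> 'n) \<Rightarrow>\<^sub>0 int) set \<Rightarrow> (('m2 \<times> 'n2) \<Rightarrow>\<^sub>0 int) set"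
  where "tmap R M N M' N' f g =
    tlift (tensor R M N) (tensor R M' N') (\<lambda>x y. tens R M' N' (f x) (g y))"


section \<open>Corings and comodules\<close>

record ('a, 'c) coring = "('a, 'a, 'c) bimod" +
  comult :: "'c \<Rightarrow> (('c \<times> 'c) \<Rightarrow>\<^sub>0 int) set"
  counit :: "'c \<Rightarrow> 'a"

definition coring_endos :: "('a, 'x) ring_scheme \<Rightarrow> ('a, 'c, 'z) coring_scheme \<Rightarrow> ('c \<Rightarrow> 'c) set"
  where "coring_endos A C = {g \<in> bimod_hom A A C C.
    \<forall>c\<in>carrier C. comult C (g c) = tmap A C C C C g g (comult C c) \<and> counit C (g c) = counit C c}"

definition coring_End :: "('a, 'x) ring_scheme \<Rightarrow> ('a, 'c, 'z) coring_scheme \<Rightarrow> ('c \<Rightarrow> 'c) monoid"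
  where "coring_End A C =
    \<lparr>carrier = coring_endos A C, monoid.mult = compose (carrier C), one = (\<lambda>c\<in>carrier C. c)\<rparr>"

definition monoid_homs :: "('a, 'x) monoid_scheme \<Rightarrow> ('b, 'y) monoid_scheme \<Rightarrow> ('a \<Rightarrow> 'b) set"
  where "monoid_homs M N =
    {h. Group.monoid M \<and> Group.monoid N \<and> h \<in> hom M N \<and> h \<one>\<^bsub>M\<^esub> = \<one>\<^bsub>N\<^esub>}"

text \<open>Colinear maps between right comodules \<open>(M, \<rho>)\<close> and \<open>(N, \<sigma>)\<close>.\<close>

definition colinear ::
  "('a, 'x) ring_scheme \<Rightarrow> ('a, 'c, 'w) coring_scheme
    \<Rightarrow> ('l, 'a, 'm, 'y) bimod_scheme \<Rightarrow> ('m \<Rightarrow> (('m \<times> 'c) \<Rightarrow>\<^sub>0 int) set)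
    \<Rightarrow> ('l2, 'a, 'n, 'z) bimod_scheme \<Rightarrow> ('n \<Rightarrow> (('n \<times> 'c) \<Rightarrow>\<^sub>0 int) set)
    \<Rightarrow> ('m \<Rightarrow> 'n) set"
  where "colinear A C M \<rho> N \<sigma> = {f \<in> right_hom A M N.
    \<forall>x\<in>carrier M. \<sigma> (f x) = tmap A M C N C f (\<lambda>c. c) (\<rho> x)}"

text \<open>The coaction of \<open>X\<^sub>g\<close>.\<close>

definition twist ::
  "('a, 'x) ring_scheme \<Rightarrow> ('a, 'c, 'w) coring_scheme \<Rightarrow> ('l, 'a, 'm, 'y) bimod_scheme
    \<Rightarrow> ('c \<Rightarrow> 'c) \<Rightarrow> ('m \<Rightarrow> (('m \<times> 'c) \<Rightarrow>\<^sub>0 int) set) \<Rightarrow> 'm \<Rightarrow> (('m \<times> 'c) \<Rightarrow>\<^sub>0 int) set"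
  where "twist A C X g \<rho> = (\<lambda>x\<in>carrier X. tmap A X C X C (\<lambda>x. x) g (\<rho> x))"


section \<open>The comatrix coring\<close>

definition comatrix ::
  "('a, 'x) ring_scheme \<Rightarrow> ('b, 'y) ring_scheme \<Rightarrow> ('b, 'a, 'm, 'z) bimod_scheme
    \<Rightarrow> 'i set \<Rightarrow> ('i \<Rightarrow> 'm) \<Rightarrow> ('i \<Rightarrow> 'm \<Rightarrow> 'a)
    \<Rightarrow> ('a, ((('m \<Rightarrow> 'a) \<times> 'm) \<Rightarrow>\<^sub>0 int) set) coring"
  where "comatrix A B M J e e' =
    (let D = dual A M; C = tensor B D M; CC = tensor A C C
     in \<lparr>carrier = carrier C, monoid.mult = undefined, one = undefined, ring.zero = \<zero>\<^bsub>C\<^esub>, ring.add = ring.add C,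
         lact = lact C, ract = ract C,
         comult = tlift C CC (\<lambda>u' u. \<Oplus>\<^bsub>CC\<^esub>i\<in>J. tens A C C (tens B D M u' (e i)) (tens B D M (e' i) u)),
         counit = tlift C A (\<lambda>u' u. u' u)\<rparr>)"

definition comatrix_coaction ::
  "('a, 'x) ring_scheme \<Rightarrow> ('b, 'y) ring_scheme \<Rightarrow> ('b, 'a, 'm, 'z) bimod_scheme
    \<Rightarrow> 'i set \<Rightarrow> ('i \<Rightarrow> 'm) \<Rightarrow> ('i \<Rightarrow> 'm \<Rightarrow> 'a)
    \<Rightarrow> 'm \<Rightarrow> (('m \<times> ((('m \<Rightarrow> 'a) \<times> 'm) \<Rightarrow>\<^sub>0 int) set) \<Rightarrow>\<^sub>0 int) set"
  where "comatrix_coaction A B M J e e' =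
    (let D = dual A M; C = tensor B D M; MC = tensor A M C
     in (\<lambda>u\<in>carrier M. \<Oplus>\<^bsub>MC\<^esub>i\<in>J. tens A M C (e i) (tens B D M (e' i) u)))"


section \<open>The Sweedler coring of a ring extension\<close>

text \<open>The extension is given by a ring homomorphism \<open>\<phi> : B \<rightarrow> S\<close>.  Here \<open>S \<otimes>\<^sub>B S\<close> is formed from \<open>S\<close> as
  an \<open>(S, B)\<close>-bimodule and \<open>S\<close> as a \<open>(B, S)\<close>-bimodule.\<close>

abbreviation (input) SB :: "('s, 'x) ring_scheme \<Rightarrow> ('b \<Rightarrow> 's) \<Rightarrow> ('s, 'b, 's) bimod"
  where "SB S \<phi> \<equiv> ring_bimod S (\<lambda>x. x) \<phi>"

abbreviation (input) BS :: "('s, 'x) ring_scheme \<Rightarrow> ('b \<Rightarrow> 's) \<Rightarrow> ('b, 's, 's) bimod"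
  where "BS S \<phi> \<equiv> ring_bimod S \<phi> (\<lambda>x. x)"

definition sweedler ::
  "('b, 'x) ring_scheme \<Rightarrow> ('s, 'y) ring_scheme \<Rightarrow> ('b \<Rightarrow> 's)
    \<Rightarrow> ('s, (('s \<times> 's) \<Rightarrow>\<^sub>0 int) set) coring"
  where "sweedler B S \<phi> =
    (let C = tensor B (SB S \<phi>) (BS S \<phi>); t = tens B (SB S \<phi>) (BS S \<phi>)
     in \<lparr>carrier = carrier C, monoid.mult = undefined, one = undefined, ring.zero = \<zero>\<^bsub>C\<^esub>, ring.add = ring.add C,
         lact = lact C, ract = ract C,
         comult = tlift C (tensor S C C) (\<lambda>s s'. tens S C C (t s \<one>\<^bsub>S\<^esub>) (t \<one>\<^bsub>S\<^esub> s')),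
         counit = tlift C S (\<lambda>s s'. s \<otimes>\<^bsub>S\<^esub> s')\<rparr>)"

text \<open>\<open>s \<mapsto> 1 \<otimes>\<^sub>B s\<close>, read in \<open>S \<otimes>\<^sub>S (S \<otimes>\<^sub>B S)\<close>.\<close>

definition sweedler_coaction ::
  "('b, 'x) ring_scheme \<Rightarrow> ('s, 'y) ring_scheme \<Rightarrow> ('b \<Rightarrow> 's)
    \<Rightarrow> 's \<Rightarrow> (('s \<times> (('s \<times> 's) \<Rightarrow>\<^sub>0 int) set) \<Rightarrow>\<^sub>0 int) set"
  where "sweedler_coaction B S \<phi> =
    (\<lambda>s\<in>carrier S. tens S (regular S) (sweedler B S \<phi>) \<one>\<^bsub>S\<^esub>
      (tens B (SB S \<phi>) (BS S \<phi>) \<one>\<^bsub>S\<^esub> s))"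

text \<open>The set underlying the monoid \<open>I\<^sub>B\<^sup>l(S)\<close>.\<close>

definition sub_bimod :: "('b \<Rightarrow> 's) \<Rightarrow> ('s, 'y) ring_scheme \<Rightarrow> 's set \<Rightarrow> ('b, 'b, 's) bimod"
  where "sub_bimod \<phi> S I = (ring_bimod S \<phi> \<phi>)\<lparr>carrier := I\<rparr>"

definition mult_map ::
  "('b, 'x) ring_scheme \<Rightarrow> ('s, 'y) ring_scheme \<Rightarrow> ('b \<Rightarrow> 's) \<Rightarrow> 's set \<Rightarrow> (('s \<times> 's) \<Rightarrow>\<^sub>0 int) set \<Rightarrow> 's"
  where "mult_map B S \<phi> I = tlift (tensor B (SB S \<phi>) (sub_bimod \<phi> S I)) S (\<lambda>s x. s \<otimes>\<^bsub>S\<^esub> x)"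

definition inv_left :: "('b, 'x) ring_scheme \<Rightarrow> ('s, 'y) ring_scheme \<Rightarrow> ('b \<Rightarrow> 's) \<Rightarrow> 's set set"
  where "inv_left B S \<phi> = {I. I \<subseteq> carrier S \<and> additive_subgroup I S \<and>
    (\<forall>b\<in>carrier B. \<forall>x\<in>I. \<phi> b \<otimes>\<^bsub>S\<^esub> x \<in> I \<and> x \<otimes>\<^bsub>S\<^esub> \<phi> b \<in> I) \<and>
    mult_map B S \<phi> I
      \<in> bimod_iso S B (tensor B (SB S \<phi>) (sub_bimod \<phi> S I)) (SB S \<phi>)}"

text \<open>For \<open>m\<^sup>-\<^sup>1(1) = \<Sum>\<^sub>k s\<^sub>k \<otimes>\<^sub>B x\<^sub>k\<close>, the sum \<open>\<Sum>\<^sub>k f s\<^sub>k x\<^sub>k\<close> in \<open>P\<close> is the image of \<open>m\<^sup>-\<^sup>1(1)\<close> under the map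
  induced by \<open>f\<close>.\<close>

definition sum_unit ::
  "('b, 'x) ring_scheme \<Rightarrow> ('s, 'y) ring_scheme \<Rightarrow> ('b \<Rightarrow> 's) \<Rightarrow> 's set
    \<Rightarrow> ('p, 'z) ring_scheme \<Rightarrow> ('s \<Rightarrow> 's \<Rightarrow> 'p) \<Rightarrow> 'p"
  where "sum_unit B S \<phi> I P f =
    (let T = tensor B (SB S \<phi>) (sub_bimod \<phi> S I)
     in tlift T P f (inv_into (carrier T) (mult_map B S \<phi> I) \<one>\<^bsub>S\<^esub>))"

definition Gamma_bar ::
  "('b, 'x) ring_scheme \<Rightarrow> ('s, 'y) ring_scheme \<Rightarrow> ('b \<Rightarrow> 's) \<Rightarrow> 's set
    \<Rightarrow> (('s \<times> 's) \<Rightarrow>\<^sub>0 int) set \<Rightarrow> (('s \<times> 's) \<Rightarrow>\<^sub>0 int) set"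
  where "Gamma_bar B S \<phi> I =
    (let C = tensor B (SB S \<phi>) (BS S \<phi>); t = tens B (SB S \<phi>) (BS S \<phi>)
     in tlift C C (\<lambda>s s'. sum_unit B S \<phi> I C (\<lambda>v x. t (s \<otimes>\<^bsub>S\<^esub> v) (x \<otimes>\<^bsub>S\<^esub> s'))))"

definition Gamma ::
  "('a, 'x) ring_scheme \<Rightarrow> ('b, 'y) ring_scheme \<Rightarrow> ('b, 'a, 'm, 'z) bimod_scheme \<Rightarrow> ('m \<Rightarrow> 'm) set
    \<Rightarrow> ((('m \<Rightarrow> 'a) \<times> 'm) \<Rightarrow>\<^sub>0 int) set \<Rightarrow> ((('m \<Rightarrow> 'a) \<times> 'm) \<Rightarrow>\<^sub>0 int) set"
  where "Gamma A B M I =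
    (let D = dual A M; C = tensor B D M
     in tlift C C (\<lambda>u' u. sum_unit B (end_ring A M) (left_mult M) I C
          (\<lambda>v x. tens B D M (compose (carrier M) u' v) (x u))))"


section \<open>The comparison of endomorphism monoids\<close>

definition xi ::
  "('a, 'x) ring_scheme \<Rightarrow> ('b, 'a, 'm, 'z) bimod_scheme
    \<Rightarrow> (('m \<times> ('m \<Rightarrow> 'a)) \<Rightarrow>\<^sub>0 int) set \<Rightarrow> ('m \<Rightarrow> 'm)"
  where "xi A M = tlift (tensor A M (dual A M)) (end_ring A M)
    (\<lambda>u v'. \<lambda>x\<in>carrier M. u \<triangleleft>\<^bsub>M\<^esub> v' x)"

text \<open>The canonical isomorphism \<open>(M \<otimes>\<^sub>A D) \<otimes>\<^sub>B (M \<otimes>\<^sub>A D) \<rightarrow> (M \<otimes>\<^sub>A (D \<otimes>\<^sub>B M)) \<otimes>\<^sub>A D\<close> and its inverse.\<close>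

definition rebracket ::
  "('a, 'x) ring_scheme \<Rightarrow> ('b, 'y) ring_scheme \<Rightarrow> ('b, 'a, 'm, 'z) bimod_scheme
    \<Rightarrow> ('a, 'b, 'd, 'w) bimod_scheme
    \<Rightarrow> ((((('m \<times> 'd) \<Rightarrow>\<^sub>0 int) set) \<times> ((('m \<times> 'd) \<Rightarrow>\<^sub>0 int) set)) \<Rightarrow>\<^sub>0 int) set
    \<Rightarrow> ((((('m \<times> ((('d \<times> 'm) \<Rightarrow>\<^sub>0 int) set)) \<Rightarrow>\<^sub>0 int) set) \<times> 'd) \<Rightarrow>\<^sub>0 int) set"
  where "rebracket A B M D =
    (let E = tensor A M D; C = tensor B D M; MC = tensor A M C; Y = tensor A MC D
     in tlift (tensor B E E) Y (\<lambda>p q. tlift E Y (\<lambda>u u'. tlift E Y (\<lambda>v v'.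
          tens A MC D (tens A M C u (tens B D M u' v)) v') q) p))"

definition unbracket ::
  "('a, 'x) ring_scheme \<Rightarrow> ('b, 'y) ring_scheme \<Rightarrow> ('b, 'a, 'm, 'z) bimod_scheme
    \<Rightarrow> ('a, 'b, 'd, 'w) bimod_scheme
    \<Rightarrow> ((((('m \<times> ((('d \<times> 'm) \<Rightarrow>\<^sub>0 int) set)) \<Rightarrow>\<^sub>0 int) set) \<times> 'd) \<Rightarrow>\<^sub>0 int) set
    \<Rightarrow> ((((('m \<times> 'd) \<Rightarrow>\<^sub>0 int) set) \<times> ((('m \<times> 'd) \<Rightarrow>\<^sub>0 int) set)) \<Rightarrow>\<^sub>0 int) set"
  where "unbracket A B M D =
    (let E = tensor A M D; C = tensor B D M; MC = tensor A M C; X = tensor B E E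
     in tlift (tensor A MC D) X (\<lambda>p v'. tlift MC X (\<lambda>u c. tlift C X (\<lambda>u' v.
          tens B E E (tens A M D u u') (tens A M D v v')) c) p))"

text \<open>\<open>(\<xi> \<otimes>\<^sub>B \<xi>) \<circ> (M \<otimes>\<^sub>A g \<otimes>\<^sub>A D) \<circ> (\<xi>\<^sup>-\<^sup>1 \<otimes>\<^sub>B \<xi>\<^sup>-\<^sup>1)\<close> with \<open>D\<close> the dual of \<open>M\<close>.\<close>

definition hat ::
  "('a, 'x) ring_scheme \<Rightarrow> ('b, 'y) ring_scheme \<Rightarrow> ('b, 'a, 'm, 'z) bimod_scheme
    \<Rightarrow> (((('m \<Rightarrow> 'a) \<times> 'm) \<Rightarrow>\<^sub>0 int) set \<Rightarrow> ((('m \<Rightarrow> 'a) \<times> 'm) \<Rightarrow>\<^sub>0 int) set)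
    \<Rightarrow> ((('m \<Rightarrow> 'm) \<times> ('m \<Rightarrow> 'm)) \<Rightarrow>\<^sub>0 int) set \<Rightarrow> ((('m \<Rightarrow> 'm) \<times> ('m \<Rightarrow> 'm)) \<Rightarrow>\<^sub>0 int) set"
  where "hat A B M g =
    (let D = dual A M; S = end_ring A M; \<phi> = left_mult M;
         E = tensor A M D; C = tensor B D M; MC = tensor A M C;
         xi_inv = inv_into (carrier E) (xi A M)
     in (\<lambda>t\<in>carrier (tensor B (SB S \<phi>) (BS S \<phi>)).
          tmap B E E (SB S \<phi>) (BS S \<phi>) (xi A M) (xi A M)
           (unbracket A B M D
             (tmap A MC D MC D (tmap A M C M C (\<lambda>u. u) g) (\<lambda>u'. u')
               (rebracket A B M D
                 (tmap B (SB S \<phi>) (BS S \<phi>) E E xi_inv xi_inv t))))))"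

end

theory Submission
  imports Defs
begin

text \<open>
  The endomorphism ring \<open>S\<close> is spanned by the maps \<open>[u u'] : x \<mapsto> u u'(x)\<close>, so \<open>S \<otimes>\<^sub>B S\<close> is spanned by the
  elements \<open>[u u'] \<otimes> [v v']\<close>, the images of \<open>u' \<otimes> v\<close> under additive maps
  \<open>\<Psi>\<^sub>u\<^sub>,\<^sub>v\<^sub>' : \<Sigma>\<^sup>* \<otimes>\<^sub>B \<Sigma> \<rightarrow> S \<otimes>\<^sub>B S\<close>.  The map \<open>\<Psi>\<close> intertwines an endomorphism \<open>g\<close> with \<open>hat g\<close>, and it transports
  counits, comultiplications and \<open>\<Gamma>\<close> as well; this yields the homomorphism property and
  the comparison of \<open>\<Gamma>\<close> with \<open>\<Gamma>_bar\<close>.  In the other direction \<open>\<Phi>\<^sub>w\<^sub>,\<^sub>x : s \<otimes> s' \<mapsto> w s \<otimes> s' x\<close> also intertwines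
  \<open>hat g\<close> with \<open>g\<close>, and \<open>\<Phi>\<^sub>w\<^sub>,\<^sub>x (1 \<otimes> 1) = w \<otimes> x\<close>, so that \<open>g\<close> is determined by \<open>hat g (1 \<otimes> 1)\<close>.  Part (2) compares
  both notions of colinearity with the equation \<open>hat g (s \<otimes> 1) = 1 \<otimes> s\<close> along \<open>\<Psi>\<close> and \<open>\<Phi>\<close>.
\<close>

section \<open>Tensor products\<close>

text \<open>The sum of the tensors \<open>e i \<otimes> e' i\<close> in
  \<open>M \<otimes>\<^sub>A D\<close> is the preimage of \<open>1\<close> under
  \<open>\<xi>\<close>. Since \<open>\<xi>\<close> is injective and \<open>S\<close>-linear on both
  sides, this element commutes with \<open>S\<close>, in particular with \<open>B\<close>. The
  comatrix comultiplication inserts this element and the Sweedler comultiplication inserts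
  \<open>1\<close>, so \<open>\<xi>\<close> makes them one operation. The same commutation makes the
  former well defined and moves factors through the coaction on \<open>M\<close>.

  The obstacle is that the two corings live over different rings. With
  \<open>W = S \<otimes>\<^sub>B S\<close>, the groups \<open>C \<otimes>\<^sub>A C\<close> and
  \<open>W \<otimes>\<^sub>S W\<close> cannot be matched by \<open>Psi\<close> in each factor,
  because the pairing \<open>D \<otimes>\<^sub>S M \<rightarrow> A\<close> need not be invertible.
  The map \<open>Theta\<close> goes through
  \<open>W \<otimes>\<^sub>S W = W \<otimes>\<^sub>B S\<close> instead.

  Moreover \<open>tlift\<close> evaluates at an arbitrarily chosen representative. A map out of a
  tensor product can be computed only after the underlying function is shown to be balanced;
  equations then follow from additivity and the elementary tensors.\<close>

definition additive_map :: "('a, 'x) ring_scheme \<Rightarrow> ('b, 'y) ring_scheme \<Rightarrow> ('a \<Rightarrow> 'b) \<Rightarrow> bool"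
  where "additive_map G H f \<longleftrightarrow> f \<in> carrier G \<rightarrow> carrier H \<and>
    (\<forall>x\<in>carrier G. \<forall>y\<in>carrier G. f (x \<oplus>\<^bsub>G\<^esub> y) = f x \<oplus>\<^bsub>H\<^esub> f y)"

lemma additive_mapI:
  assumes "\<And>x. x \<in> carrier G \<Longrightarrow> f x \<in> carrier H"
    and "\<And>x y. \<lbrakk>x \<in> carrier G; y \<in> carrier G\<rbrakk> \<Longrightarrow> f (x \<oplus>\<^bsub>G\<^esub> y) = f x \<oplus>\<^bsub>H\<^esub> f y"
  shows "additive_map G H f"
  using assms by (auto simp: additive_map_def)

lemma additive_map_closed: "\<lbrakk>additive_map G H f; x \<in> carrier G\<rbrakk> \<Longrightarrow> f x \<in> carrier H"
  by (auto simp: additive_map_def)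

lemma additive_map_add:
  "\<lbrakk>additive_map G H f; x \<in> carrier G; y \<in> carrier G\<rbrakk> \<Longrightarrow> f (x \<oplus>\<^bsub>G\<^esub> y) = f x \<oplus>\<^bsub>H\<^esub> f y"
  by (auto simp: additive_map_def)

lemma additive_map_group_hom:
  assumes "abelian_group G" "abelian_group H" "additive_map G H f"
  shows "abelian_group_hom G H f"
proof -
  have "f \<in> hom (add_monoid G) (add_monoid H)"
    using assms(3) by (auto simp: additive_map_def hom_def)
  then show ?thesis
    using assms(1,2) abelian_group_homI[of G H f]
    by (auto simp: abelian_group_def abelian_group_axioms_def comm_group_def group_hom_def group_hom_axioms_def)
qed

lemma additive_map_zero:
  assumes "abelian_group G" "abelian_group H" "additive_map G H f"
  shows "f \<zero>\<^bsub>G\<^esub> = \<zero>\<^bsub>H\<^esub>"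
  using abelian_group_hom.hom_zero[OF additive_map_group_hom[OF assms]] .

lemma additive_map_finsum:
  assumes G: "abelian_group G" and H: "abelian_group H" and f: "additive_map G H f"
    and h: "h \<in> J \<rightarrow> carrier G"
  shows "f (\<Oplus>\<^bsub>G\<^esub>i\<in>J. h i) = (\<Oplus>\<^bsub>H\<^esub>i\<in>J. f (h i))"
proof -
  interpret G: abelian_group G by fact
  interpret H: abelian_group H by fact
  have fc: "f x \<in> carrier H" if "x \<in> carrier G" for x
    using f that by (rule additive_map_closed)
  show ?thesis
  proof (cases "finite J")
    case True
    then show ?thesis using h
      by (induction rule: finite_induct)
        (auto simp: fc additive_map_zero[OF G H f] additive_map_add[OF f] Pi_iff)
  next
    case False
    \<comment> \<open>For infinite \<open>J\<close> both sums have the default value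
      \<open>\<zero>\<close> of \<open>finsum\<close>, which \<open>f\<close> preserves.\<close>
    then show ?thesis by (simp add: G.finsum_infinite H.finsum_infinite additive_map_zero[OF G H f])
  qed
qed

section \<open>Balanced maps and the evaluation of formal sums\<close>

definition balanced ::
  "('r, 'x) ring_scheme \<Rightarrow> ('l, 'r, 'm, 'y) bimod_scheme \<Rightarrow> ('r, 's, 'n, 'z) bimod_scheme
    \<Rightarrow> ('p, 'w) ring_scheme \<Rightarrow> ('m \<Rightarrow> 'n \<Rightarrow> 'p) \<Rightarrow> bool"
  where "balanced R M N P f \<longleftrightarrow>
    (\<forall>x\<in>carrier M. \<forall>y\<in>carrier N. f x y \<in> carrier P) \<and>
    (\<forall>x\<in>carrier M. \<forall>x'\<in>carrier M. \<forall>y\<in>carrier N. f (x \<oplus>\<^bsub>M\<^esub> x') y = f x y \<oplus>\<^bsub>P\<^esub> f x' y) \<and>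
    (\<forall>x\<in>carrier M. \<forall>y\<in>carrier N. \<forall>y'\<in>carrier N. f x (y \<oplus>\<^bsub>N\<^esub> y') = f x y \<oplus>\<^bsub>P\<^esub> f x y') \<and>
    (\<forall>x\<in>carrier M. \<forall>r\<in>carrier R. \<forall>y\<in>carrier N. f (x \<triangleleft>\<^bsub>M\<^esub> r) y = f x (r \<triangleright>\<^bsub>N\<^esub> y))"

lemma balancedI:
  assumes "\<And>x y. \<lbrakk>x \<in> carrier M; y \<in> carrier N\<rbrakk> \<Longrightarrow> f x y \<in> carrier P"
    and "\<And>x x' y. \<lbrakk>x \<in> carrier M; x' \<in> carrier M; y \<in> carrier N\<rbrakk>
      \<Longrightarrow> f (x \<oplus>\<^bsub>M\<^esub> x') y = f x y \<oplus>\<^bsub>P\<^esub> f x' y"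
    and "\<And>x y y'. \<lbrakk>x \<in> carrier M; y \<in> carrier N; y' \<in> carrier N\<rbrakk>
      \<Longrightarrow> f x (y \<oplus>\<^bsub>N\<^esub> y') = f x y \<oplus>\<^bsub>P\<^esub> f x y'"
    and "\<And>x r y. \<lbrakk>x \<in> carrier M; r \<in> carrier R; y \<in> carrier N\<rbrakk>
      \<Longrightarrow> f (x \<triangleleft>\<^bsub>M\<^esub> r) y = f x (r \<triangleright>\<^bsub>N\<^esub> y)"
  shows "balanced R M N P f"
  using assms by (auto simp: balanced_def)

text \<open>This is the value that \<open>tlift\<close> assigns to one representative. Split off in
  this way, independence of the representative becomes the vanishing of \<open>free_eval\<close> on
  the relations.\<close>

definition free_eval :: "('p, 'y) ring_scheme \<Rightarrow> ('m \<Rightarrow> 'n \<Rightarrow> 'p) \<Rightarrow> (('m \<times> 'n) \<Rightarrow>\<^sub>0 int) \<Rightarrow> 'p"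
  where "free_eval P f c =
    (\<Oplus>\<^bsub>P\<^esub>p\<in>Poly_Mapping.keys c. [Poly_Mapping.lookup c p] \<cdot>\<^bsub>P\<^esub> f (fst p) (snd p))"

text \<open>Cancellation can make the keys of \<open>c + d\<close> fewer than those of
  \<open>c\<close> and \<open>d\<close> together; over a common larger index set the sums can be
  added term by term.\<close>

lemma free_eval_superset:
  assumes "abelian_group P" "finite K" "Poly_Mapping.keys c \<subseteq> K"
    and "\<And>p. p \<in> K \<Longrightarrow> f (fst p) (snd p) \<in> carrier P"
  shows "free_eval P f c = (\<Oplus>\<^bsub>P\<^esub>p\<in>K. [Poly_Mapping.lookup c p] \<cdot>\<^bsub>P\<^esub> f (fst p) (snd p))"
proof -
  interpret P: abelian_group P by fact
  have "[(0 :: int)] \<cdot>\<^bsub>P\<^esub> x = \<zero>\<^bsub>P\<^esub>" for x by (simp add: add_pow_def)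
  then show ?thesis unfolding free_eval_def
    using assms(2-)
    by (intro P.add.finprod_mono_neutral_cong_left) (auto simp: in_keys_iff)
qed

lemma free_eval_add:
  assumes "abelian_group P"
    and f: "\<And>p. p \<in> Poly_Mapping.keys c \<union> Poly_Mapping.keys d \<Longrightarrow> f (fst p) (snd p) \<in> carrier P"
  shows "free_eval P f (c + d) = free_eval P f c \<oplus>\<^bsub>P\<^esub> free_eval P f d"
proof -
  interpret P: abelian_group P by fact
  let ?K = "Poly_Mapping.keys c \<union> Poly_Mapping.keys d"
  let ?s = "\<lambda>c. \<Oplus>\<^bsub>P\<^esub>p\<in>?K. [Poly_Mapping.lookup c p] \<cdot>\<^bsub>P\<^esub> f (fst p) (snd p)"
  have "free_eval P f (c + d) = ?s (c + d)"
    using keys_add[of c d] f by (intro free_eval_superset assms) auto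
  also have "\<dots> = (\<Oplus>\<^bsub>P\<^esub>p\<in>?K. [Poly_Mapping.lookup c p] \<cdot>\<^bsub>P\<^esub> f (fst p) (snd p)
      \<oplus>\<^bsub>P\<^esub> [Poly_Mapping.lookup d p] \<cdot>\<^bsub>P\<^esub> f (fst p) (snd p))"
    using f by (intro P.finsum_cong') (auto simp: lookup_add P.add.int_pow_mult)
  also have "\<dots> = ?s c \<oplus>\<^bsub>P\<^esub> ?s d"
    using f by (intro P.finsum_addf) auto
  also have "?s c = free_eval P f c"
    using f by (intro free_eval_superset[symmetric] assms) auto
  also have "?s d = free_eval P f d"
    using f by (intro free_eval_superset[symmetric] assms) auto
  finally show ?thesis .
qed

lemma free_eval_frag_of:
  assumes "abelian_group P" "f x y \<in> carrier P"
  shows "free_eval P f (frag_of (x, y)) = f x y"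
proof -
  interpret P: abelian_group P by fact
  show ?thesis using assms(2) by (simp add: free_eval_def)
qed

lemma free_eval_zero: "abelian_group P \<Longrightarrow> free_eval P f 0 = \<zero>\<^bsub>P\<^esub>"
  by (simp add: free_eval_def abelian_group_def abelian_monoid.finsum_empty)

lemma free_eval_closed:
  assumes "abelian_group P"
    and "\<And>p. p \<in> Poly_Mapping.keys c \<Longrightarrow> f (fst p) (snd p) \<in> carrier P"
  shows "free_eval P f c \<in> carrier P"
proof -
  interpret P: abelian_group P by fact
  show ?thesis unfolding free_eval_def using assms(2) by (intro P.finsum_closed) auto
qed

lemma free_eval_minus:
  assumes "abelian_group P"
    and f: "\<And>p. p \<in> Poly_Mapping.keys c \<Longrightarrow> f (fst p) (snd p) \<in> carrier P"
  shows "free_eval P f (- c) = \<ominus>\<^bsub>P\<^esub> free_eval P f c"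
proof -
  interpret P: abelian_group P by fact
  have "free_eval P f (- c) \<oplus>\<^bsub>P\<^esub> free_eval P f c = \<zero>\<^bsub>P\<^esub>"
    using free_eval_add[of P "- c" c f] f by (simp add: assms free_eval_zero)
  then show ?thesis
    using f by (intro P.minus_equality[symmetric]) (auto intro!: free_eval_closed assms)
qed

section \<open>The tensor product of two bimodules and its universal property\<close>

locale tensor_pair = M: bimodule L R M + N: bimodule R Q N
  for L :: "('l, 'a) ring_scheme" and R :: "('r, 'b) ring_scheme" and Q :: "('q, 'c) ring_scheme"
    and M :: "('l, 'r, 'm, 'd) bimod_scheme" and N :: "('r, 'q, 'n, 'e) bimod_scheme"
begin

abbreviation "FA \<equiv> free_Abelian_group (carrier M \<times> carrier N)"
abbreviation "H \<equiv> tensor_sub R M N"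
abbreviation "T \<equiv> tensor R M N"
abbreviation "coset c \<equiv> H #>\<^bsub>FA\<^esub> c"
abbreviation "tt \<equiv> tens R M N"

lemma rels_subset: "tensor_rels R M N \<subseteq> carrier FA"
proof -
  have *: "frag_of (p::'m \<times> 'n) - frag_of q - frag_of r \<in> carrier FA"
    if "p \<in> carrier M \<times> carrier N" "q \<in> carrier M \<times> carrier N" "r \<in> carrier M \<times> carrier N" for p q r
    using that keys_diff[of "frag_of p - frag_of q" "frag_of r"] keys_diff[of "frag_of p" "frag_of q"]
    by (auto simp: keys_frag_of)
  have **: "frag_of (p::'m \<times> 'n) - frag_of q \<in> carrier FA"
    if "p \<in> carrier M \<times> carrier N" "q \<in> carrier M \<times> carrier N" for p q
    using that keys_diff[of "frag_of p" "frag_of q"]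
    by (auto simp: keys_frag_of)
  show ?thesis
    unfolding tensor_rels_def
    by (intro Un_least subsetI; elim CollectE exE conjE; hypsubst)
      (rule * **; simp add: M.ract_closed N.lact_closed)+
qed

lemma FA_group: "comm_group FA"
  by (rule abelian_free_Abelian_group)

sublocale FA: comm_group FA
  by (rule FA_group)

lemma sub_subgroup: "subgroup H FA"
  unfolding tensor_sub_def by (rule FA.generate_is_subgroup[OF rels_subset])

lemma sub_normal: "H \<lhd> FA"
  using sub_subgroup FA.normal_iff_subgroup by blast

lemma quotient_group: "comm_group (FA Mod H)"
  by (rule FA.abelian_FactGroup[OF sub_subgroup])

lemma carrier_T: "carrier T = coset ` carrier FA"
  by (simp add: tensor_def tensor_group_def Let_def carrier_FactGroup)

lemma coset_add:
  assumes "a \<in> carrier FA" "b \<in> carrier FA"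
  shows "coset a \<oplus>\<^bsub>T\<^esub> coset b = coset (a + b)"
  using normal.rcos_sum[OF sub_normal, of a b] assms
  by (simp add: tensor_def tensor_group_def Let_def)

lemma coset_zero: "\<zero>\<^bsub>T\<^esub> = coset 0"
  using FA.coset_mult_one[of H] sub_subgroup[THEN subgroup.subset]
  by (simp add: tensor_def tensor_group_def Let_def)

lemma coset_eqI:
  assumes "a \<in> carrier FA" "b \<in> carrier FA" "a - b \<in> H"
  shows "coset a = coset b"
proof -
  have "a \<in> coset b"
    using assms by (auto simp: r_coset_def intro!: bexI[of _ "a - b"])
  then show ?thesis
    using assms FA.repr_independence[OF _ _ sub_subgroup] by metis
qed

lemma coset_memD:
  assumes "b \<in> carrier FA" "a \<in> coset b"
  shows "\<exists>h\<in>H. a = h + b"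
  using assms by (auto simp: r_coset_def)

sublocale T: abelian_group T
proof -
  interpret C: comm_group "FA Mod H" by (rule quotient_group)
  have eqs: "carrier T = carrier (FA Mod H)" "ring.add T = monoid.mult (FA Mod H)" "\<zero>\<^bsub>T\<^esub> = \<one>\<^bsub>FA Mod H\<^esub>"
    by (simp_all add: tensor_def tensor_group_def Let_def)
  show "abelian_group T"
  proof (rule abelian_groupI, unfold eqs)
    fix x assume "x \<in> carrier (FA Mod H)"
    then show "\<exists>y\<in>carrier (FA Mod H). y \<otimes>\<^bsub>FA Mod H\<^esub> x = \<one>\<^bsub>FA Mod H\<^esub>"
      using C.l_inv_ex by blast
  qed (rule C.m_closed C.one_closed C.m_assoc C.m_comm C.l_one; assumption)+
qed

lemma tens_closed [simp]: "\<lbrakk>x \<in> carrier M; y \<in> carrier N\<rbrakk> \<Longrightarrow> tt x y \<in> carrier T"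
  by (auto simp: carrier_T tens_def keys_frag_of)

lemma rel_mem: "c \<in> tensor_rels R M N \<Longrightarrow> c \<in> H"
  unfolding tensor_sub_def by (rule generate.incl)

lemma frag_of_carrier: "\<lbrakk>x \<in> carrier M; y \<in> carrier N\<rbrakk> \<Longrightarrow> frag_of (x, y) \<in> carrier FA"
  by (auto simp: keys_frag_of)

lemma frag_add_carrier: "\<lbrakk>a \<in> carrier FA; b \<in> carrier FA\<rbrakk> \<Longrightarrow> a + b \<in> carrier FA"
  using FA.m_closed by simp

lemma tens_add_left [simp]:
  assumes "x \<in> carrier M" "x' \<in> carrier M" "y \<in> carrier N"
  shows "tt (x \<oplus>\<^bsub>M\<^esub> x') y = tt x y \<oplus>\<^bsub>T\<^esub> tt x' y"
proof -
  have "coset (frag_of (x \<oplus>\<^bsub>M\<^esub> x', y)) = coset (frag_of (x, y) + frag_of (x', y))"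
  proof (rule coset_eqI)
    show "frag_of (x \<oplus>\<^bsub>M\<^esub> x', y) - (frag_of (x, y) + frag_of (x', y)) \<in> H"
      by (rule rel_mem) (use assms in \<open>auto simp: tensor_rels_def diff_diff_add\<close>)
  qed (intro frag_add_carrier frag_of_carrier M.M.a_closed assms)+
  also have "\<dots> = tt x y \<oplus>\<^bsub>T\<^esub> tt x' y"
    unfolding tens_def by (intro coset_add[symmetric] frag_of_carrier assms)
  finally show ?thesis by (simp only: tens_def)
qed

lemma tens_add_right [simp]:
  assumes "x \<in> carrier M" "y \<in> carrier N" "y' \<in> carrier N"
  shows "tt x (y \<oplus>\<^bsub>N\<^esub> y') = tt x y \<oplus>\<^bsub>T\<^esub> tt x y'"
proof -
  have "coset (frag_of (x, y \<oplus>\<^bsub>N\<^esub> y')) = coset (frag_of (x, y) + frag_of (x, y'))"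
  proof (rule coset_eqI)
    show "frag_of (x, y \<oplus>\<^bsub>N\<^esub> y') - (frag_of (x, y) + frag_of (x, y')) \<in> H"
      by (rule rel_mem) (use assms in \<open>auto simp: tensor_rels_def diff_diff_add\<close>)
  qed (intro frag_add_carrier frag_of_carrier N.M.a_closed assms)+
  also have "\<dots> = tt x y \<oplus>\<^bsub>T\<^esub> tt x y'"
    unfolding tens_def by (intro coset_add[symmetric] frag_of_carrier assms)
  finally show ?thesis by (simp only: tens_def)
qed

lemma tens_balanced:
  assumes "x \<in> carrier M" "r \<in> carrier R" "y \<in> carrier N"
  shows "tt (x \<triangleleft>\<^bsub>M\<^esub> r) y = tt x (r \<triangleright>\<^bsub>N\<^esub> y)"
  unfolding tens_def
proof (rule coset_eqI)
  show "frag_of (x \<triangleleft>\<^bsub>M\<^esub> r, y) - frag_of (x, r \<triangleright>\<^bsub>N\<^esub> y) \<in> H"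
    by (rule rel_mem) (use assms in \<open>auto simp: tensor_rels_def\<close>)
qed (intro frag_of_carrier M.ract_closed N.lact_closed assms)+

lemma tens_zero_left: "y \<in> carrier N \<Longrightarrow> tt \<zero>\<^bsub>M\<^esub> y = \<zero>\<^bsub>T\<^esub>"
  by (rule additive_map_zero[OF M.M.abelian_group_axioms T.abelian_group_axioms, of "\<lambda>x. tt x y"])
    (simp add: additive_mapI)

lemma tens_minus_left:
  assumes "x \<in> carrier M" "y \<in> carrier N"
  shows "tt (\<ominus>\<^bsub>M\<^esub> x) y = \<ominus>\<^bsub>T\<^esub> tt x y"
proof -
  have "tt (\<ominus>\<^bsub>M\<^esub> x) y \<oplus>\<^bsub>T\<^esub> tt x y = \<zero>\<^bsub>T\<^esub>"
    using assms tens_add_left[of "\<ominus>\<^bsub>M\<^esub> x" x y] by (simp add: M.M.l_neg tens_zero_left)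
  then show ?thesis using assms by (intro T.minus_equality[symmetric]) auto
qed

text \<open>Formal sums have integer coefficients, yet sums of elementary tensors suffice:
  \<open>\<zero>\<close> and \<open>- (x \<otimes> y) = (- x) \<otimes> y\<close> are elementary
  themselves.\<close>

lemma induct [consumes 1, case_names tens add]:
  assumes z: "z \<in> carrier T"
    and tens: "\<And>x y. \<lbrakk>x \<in> carrier M; y \<in> carrier N\<rbrakk> \<Longrightarrow> P (tt x y)"
    and add: "\<And>z z'. \<lbrakk>z \<in> carrier T; z' \<in> carrier T; P z; P z'\<rbrakk> \<Longrightarrow> P (z \<oplus>\<^bsub>T\<^esub> z')"
  shows "P z"
proof -
  obtain c where c: "c \<in> carrier FA" "z = coset c" using z by (auto simp: carrier_T)
  have zero: "P (coset 0)"
    using tens[of "\<zero>\<^bsub>M\<^esub>" "\<zero>\<^bsub>N\<^esub>"] by (simp add: tens_zero_left coset_zero)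
  have neg_coset: "coset (- a) = \<ominus>\<^bsub>T\<^esub> coset a" if "a \<in> carrier FA" for a
  proof -
    have "- a \<in> carrier FA" using that by simp
    then have "coset (- a) \<oplus>\<^bsub>T\<^esub> coset a = \<zero>\<^bsub>T\<^esub>" using that by (simp only: coset_add) (simp add: coset_zero)
    then show ?thesis using that \<open>- a \<in> carrier FA\<close>
      by (intro T.minus_equality[symmetric]) (auto simp: carrier_T)
  qed
  from c(1) have "Poly_Mapping.keys c \<subseteq> carrier M \<times> carrier N" by simp
  \<comment> \<open>\<open>frag_induction\<close> has a difference step whereas \<open>P\<close> is
    closed under sums, so the claim is carried for \<open>c\<close> and \<open>- c\<close> at
    once.\<close>
  then have "c \<in> carrier FA \<and> P (coset c) \<and> P (coset (- c))"
  proof (induction rule: frag_induction)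
    case zero
    show ?case using \<open>P (coset 0)\<close> by simp
  next
    case (one p)
    then obtain x y where p: "p = (x, y)" "x \<in> carrier M" "y \<in> carrier N" by auto
    have "coset (- frag_of p) = tt (\<ominus>\<^bsub>M\<^esub> x) y"
      using p frag_of_carrier[of x y] by (simp only: neg_coset tens_minus_left) (simp add: tens_def)
    then show ?case using p tens[of x y] tens[of "\<ominus>\<^bsub>M\<^esub> x" y] frag_of_carrier[of x y]
      by (simp add: tens_def)
  next
    case (diff a b)
    have cl: "a \<in> carrier FA" "- a \<in> carrier FA" "b \<in> carrier FA" "- b \<in> carrier FA" using diff by simp_all
    have "coset a \<oplus>\<^bsub>T\<^esub> coset (- b) = coset (a - b)" "coset (- a) \<oplus>\<^bsub>T\<^esub> coset b = coset (- (a - b))"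
      using coset_add[OF cl(1,4)] coset_add[OF cl(2,3)] by simp_all
    moreover have "P (coset a \<oplus>\<^bsub>T\<^esub> coset (- b))" "P (coset (- a) \<oplus>\<^bsub>T\<^esub> coset b)"
      using diff cl by (auto intro!: add simp: carrier_T)
    moreover have "a - b \<in> carrier FA"
      using frag_add_carrier[OF cl(1,4)] by simp
    ultimately show ?case by simp
  qed
  then show ?thesis using c by simp
qed

context
  fixes P :: "('p, 'f) ring_scheme" and f :: "'m \<Rightarrow> 'n \<Rightarrow> 'p"
  assumes P: "abelian_group P" and f: "balanced R M N P f"
begin

interpretation P: abelian_group P by (rule P)

lemma free_eval_closed': "c \<in> carrier FA \<Longrightarrow> free_eval P f c \<in> carrier P"
  using f by (intro free_eval_closed P) (auto simp: balanced_def)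

lemma free_eval_add':
  "\<lbrakk>c \<in> carrier FA; d \<in> carrier FA\<rbrakk> \<Longrightarrow> free_eval P f (c + d) = free_eval P f c \<oplus>\<^bsub>P\<^esub> free_eval P f d"
  using f by (intro free_eval_add P) (auto simp: balanced_def)

lemma free_eval_minus': "c \<in> carrier FA \<Longrightarrow> free_eval P f (- c) = \<ominus>\<^bsub>P\<^esub> free_eval P f c"
  using f by (intro free_eval_minus P) (auto simp: balanced_def)

lemma free_eval_diff:
  "\<lbrakk>c \<in> carrier FA; d \<in> carrier FA\<rbrakk> \<Longrightarrow> free_eval P f (c - d) = free_eval P f c \<ominus>\<^bsub>P\<^esub> free_eval P f d"
  using free_eval_add'[of c "- d"] by (simp add: free_eval_minus' a_minus_def)

lemma free_eval_frag:
  "\<lbrakk>x \<in> carrier M; y \<in> carrier N\<rbrakk> \<Longrightarrow> free_eval P f (frag_of (x, y)) = f x y"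
  using f by (intro free_eval_frag_of P) (auto simp: balanced_def)

text \<open>Each of the three kinds of relations vanishes by one clause of
  \<open>balanced\<close>.\<close>

lemma free_eval_rel:
  assumes "c \<in> tensor_rels R M N"
  shows "free_eval P f c = \<zero>\<^bsub>P\<^esub>"
proof -
  have fc: "f x y \<in> carrier P" if "x \<in> carrier M" "y \<in> carrier N" for x y
    using f that by (auto simp: balanced_def)
  have dc: "c - d \<in> carrier FA" if "c \<in> carrier FA" "d \<in> carrier FA" for c d
    using frag_add_carrier[of c "- d"] that by simp
  have minus: "(a \<oplus>\<^bsub>P\<^esub> b) \<ominus>\<^bsub>P\<^esub> a \<ominus>\<^bsub>P\<^esub> b = \<zero>\<^bsub>P\<^esub>" if "a \<in> carrier P" "b \<in> carrier P" for a b
    using that P.r_neg[of "a \<oplus>\<^bsub>P\<^esub> b"] by (simp add: a_minus_def P.minus_add P.a_assoc)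
  show ?thesis
    using assms unfolding tensor_rels_def
  proof (elim UnE CollectE exE conjE)
    fix x x' y assume *: "x \<in> carrier M" "x' \<in> carrier M" "y \<in> carrier N"
      and c: "c = frag_of (x \<oplus>\<^bsub>M\<^esub> x', y) - frag_of (x, y) - frag_of (x', y)"
    have "free_eval P f c = f (x \<oplus>\<^bsub>M\<^esub> x') y \<ominus>\<^bsub>P\<^esub> f x y \<ominus>\<^bsub>P\<^esub> f x' y"
      unfolding c using * dc
      by (simp only: free_eval_diff frag_of_carrier M.M.a_closed free_eval_frag)
    then show ?thesis using f * minus fc by (simp add: balanced_def)
  next
    fix x y y' assume *: "x \<in> carrier M" "y \<in> carrier N" "y' \<in> carrier N"
      and c: "c = frag_of (x, y \<oplus>\<^bsub>N\<^esub> y') - frag_of (x, y) - frag_of (x, y')"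
    have "free_eval P f c = f x (y \<oplus>\<^bsub>N\<^esub> y') \<ominus>\<^bsub>P\<^esub> f x y \<ominus>\<^bsub>P\<^esub> f x y'"
      unfolding c using * dc
      by (simp only: free_eval_diff frag_of_carrier N.M.a_closed free_eval_frag)
    then show ?thesis using f * minus fc by (simp add: balanced_def)
  next
    fix x r y assume *: "x \<in> carrier M" "r \<in> carrier R" "y \<in> carrier N"
      and c: "c = frag_of (x \<triangleleft>\<^bsub>M\<^esub> r, y) - frag_of (x, r \<triangleright>\<^bsub>N\<^esub> y)"
    have "free_eval P f c = f (x \<triangleleft>\<^bsub>M\<^esub> r) y \<ominus>\<^bsub>P\<^esub> f x (r \<triangleright>\<^bsub>N\<^esub> y)"
      unfolding c using * 
      by (simp only: free_eval_diff frag_of_carrier M.ract_closed N.lact_closed free_eval_frag)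
    then show ?thesis using f * fc[of x "r \<triangleright>\<^bsub>N\<^esub> y"] by (simp add: balanced_def a_minus_def P.r_neg N.lact_closed)
  qed
qed

lemma free_eval_sub: "c \<in> H \<Longrightarrow> free_eval P f c = \<zero>\<^bsub>P\<^esub>"
  unfolding tensor_sub_def
proof (induction rule: generate.induct)
  case one
  show ?case by (simp add: free_eval_zero P)
next
  case (incl h)
  then show ?case by (rule free_eval_rel)
next
  case (inv h)
  then have "h \<in> carrier FA" by (rule subsetD[OF rels_subset])
  then have "inv\<^bsub>FA\<^esub> h = - h" by simp
  then show ?case using free_eval_minus'[OF \<open>h \<in> carrier FA\<close>] free_eval_rel[OF inv] by simp
next
  case (eng a b)
  then have "a \<in> carrier FA" "b \<in> carrier FA"
    using FA.generate_in_carrier[OF rels_subset] by blast+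
  then show ?case using eng free_eval_add' by simp
qed

text \<open>Two representatives differ by an element of \<open>H\<close>, which
  \<open>free_eval\<close> sends to \<open>\<zero>\<close>, so the choice made inside
  \<open>tlift\<close> is invisible. The structure \<open>X\<close> is free apart from its carrier
  because \<open>tlift\<close> reads nothing else of its first argument.\<close>

lemma tlift_coset:
  assumes X: "carrier X = carrier T" and c: "c \<in> carrier FA"
  shows "tlift X P f (coset c) = free_eval P f c"
proof -
  have "coset c \<in> carrier X" using X c by (auto simp: carrier_T)
  moreover define d where "d = (SOME d. d \<in> coset c)"
  have "c \<in> coset c" using FA.rcos_self[OF c sub_subgroup] .
  then have "d \<in> coset c" unfolding d_def by (rule someI)
  then obtain h where h: "h \<in> H" "d = h + c" using coset_memD[OF c] by blast
  have "h \<in> carrier FA" using subgroup.subset[OF sub_subgroup] h by blast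
  then have "free_eval P f d = free_eval P f c"
    using h c free_eval_add'[of h c] free_eval_sub[of h] free_eval_closed'[of c] by simp
  ultimately show ?thesis
    by (simp add: tlift_def Let_def d_def free_eval_def)
qed

lemma tlift_additive: "additive_map T P (tlift T P f)"
proof (rule additive_mapI)
  fix x assume "x \<in> carrier T"
  then show "tlift T P f x \<in> carrier P"
    using tlift_coset[OF refl] free_eval_closed' by (auto simp: carrier_T)
next
  fix x y assume "x \<in> carrier T" "y \<in> carrier T"
  then obtain c d where "c \<in> carrier FA" "x = coset c" "d \<in> carrier FA" "y = coset d"
    by (auto simp: carrier_T)
  then show "tlift T P f (x \<oplus>\<^bsub>T\<^esub> y) = tlift T P f x \<oplus>\<^bsub>P\<^esub> tlift T P f y"
    using tlift_coset[OF refl] free_eval_add' frag_add_carrier by (simp only: coset_add)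
qed

lemma tlift_tens_gen:
  assumes "carrier X = carrier T" "x \<in> carrier M" "y \<in> carrier N"
  shows "tlift X P f (tt x y) = f x y"
  using assms tlift_coset[OF assms(1) frag_of_carrier[of x y]] free_eval_frag by (simp add: tens_def)

lemma tlift_tens: "\<lbrakk>x \<in> carrier M; y \<in> carrier N\<rbrakk> \<Longrightarrow> tlift T P f (tt x y) = f x y"
  by (rule tlift_tens_gen[OF refl])

lemmas tlift_closed = additive_map_closed[OF tlift_additive]
lemmas tlift_add = additive_map_add[OF tlift_additive]

end

end

section \<open>Structures with equal fields, and one-sided linear maps\<close>

lemma abelian_group_cong:
  assumes "abelian_group G" "carrier H = carrier G" "ring.add H = ring.add G" "\<zero>\<^bsub>H\<^esub> = \<zero>\<^bsub>G\<^esub>"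
  shows "abelian_group H"
proof -
  interpret G: abelian_group G by fact
  show ?thesis
  proof (rule abelian_groupI, unfold assms(2-))
    fix x assume "x \<in> carrier G"
    then show "\<exists>y\<in>carrier G. y \<oplus>\<^bsub>G\<^esub> x = \<zero>\<^bsub>G\<^esub>" by (intro bexI[of _ "\<ominus>\<^bsub>G\<^esub> x"]) (auto simp: G.l_neg)
  qed (rule G.a_closed G.zero_closed G.a_assoc G.a_comm G.l_zero; assumption)+
qed

lemma bimodule_cong:
  assumes "bimodule R S M" "carrier N = carrier M" "ring.add N = ring.add M" "\<zero>\<^bsub>N\<^esub> = \<zero>\<^bsub>M\<^esub>"
    and "lact N = lact M" "ract N = ract M"
  shows "bimodule R S N"
proof -
  interpret bimodule R S M by fact
  interpret N: abelian_group N by (rule abelian_group_cong[OF M.abelian_group_axioms assms(2-4)])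
  show ?thesis
    by (unfold_locales, unfold assms(2-))
      (rule lact_closed ract_closed lact_add lact_ring_add lact_mult lact_one ract_add ract_ring_add
        ract_mult ract_one lact_ract_assoc; assumption)+
qed

text \<open>In contrast to \<open>right_hom\<close> there is no extensionality here, so that plain
  identities such as \<open>\<lambda>u. u\<close>, which occur as tensor factors in
  \<open>hat\<close>, \<open>twist\<close> and \<open>colinear\<close>, qualify.\<close>

definition right_linear ::
  "('s, 'x) ring_scheme \<Rightarrow> ('r, 's, 'm, 'y) bimod_scheme \<Rightarrow> ('q, 's, 'n, 'z) bimod_scheme
    \<Rightarrow> ('m \<Rightarrow> 'n) \<Rightarrow> bool"
  where "right_linear S M N f \<longleftrightarrow> additive_map M N f \<and>
    (\<forall>x\<in>carrier M. \<forall>s\<in>carrier S. f (x \<triangleleft>\<^bsub>M\<^esub> s) = f x \<triangleleft>\<^bsub>N\<^esub> s)"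

definition left_linear ::
  "('r, 'x) ring_scheme \<Rightarrow> ('r, 's, 'm, 'y) bimod_scheme \<Rightarrow> ('r, 'q, 'n, 'z) bimod_scheme
    \<Rightarrow> ('m \<Rightarrow> 'n) \<Rightarrow> bool"
  where "left_linear R M N f \<longleftrightarrow> additive_map M N f \<and>
    (\<forall>r\<in>carrier R. \<forall>x\<in>carrier M. f (r \<triangleright>\<^bsub>M\<^esub> x) = r \<triangleright>\<^bsub>N\<^esub> f x)"

lemma right_linearI:
  assumes "\<And>x. x \<in> carrier M \<Longrightarrow> f x \<in> carrier N"
    and "\<And>x y. \<lbrakk>x \<in> carrier M; y \<in> carrier M\<rbrakk> \<Longrightarrow> f (x \<oplus>\<^bsub>M\<^esub> y) = f x \<oplus>\<^bsub>N\<^esub> f y"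
    and "\<And>x s. \<lbrakk>x \<in> carrier M; s \<in> carrier S\<rbrakk> \<Longrightarrow> f (x \<triangleleft>\<^bsub>M\<^esub> s) = f x \<triangleleft>\<^bsub>N\<^esub> s"
  shows "right_linear S M N f"
  using assms by (auto simp: right_linear_def additive_map_def)

lemma left_linearI:
  assumes "\<And>x. x \<in> carrier M \<Longrightarrow> f x \<in> carrier N"
    and "\<And>x y. \<lbrakk>x \<in> carrier M; y \<in> carrier M\<rbrakk> \<Longrightarrow> f (x \<oplus>\<^bsub>M\<^esub> y) = f x \<oplus>\<^bsub>N\<^esub> f y"
    and "\<And>r x. \<lbrakk>r \<in> carrier R; x \<in> carrier M\<rbrakk> \<Longrightarrow> f (r \<triangleright>\<^bsub>M\<^esub> x) = r \<triangleright>\<^bsub>N\<^esub> f x"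
  shows "left_linear R M N f"
  using assms by (auto simp: left_linear_def additive_map_def)

lemma right_linearD:
  assumes "right_linear S M N f"
  shows "x \<in> carrier M \<Longrightarrow> f x \<in> carrier N"
    and "\<lbrakk>x \<in> carrier M; y \<in> carrier M\<rbrakk> \<Longrightarrow> f (x \<oplus>\<^bsub>M\<^esub> y) = f x \<oplus>\<^bsub>N\<^esub> f y"
    and "\<lbrakk>x \<in> carrier M; s \<in> carrier S\<rbrakk> \<Longrightarrow> f (x \<triangleleft>\<^bsub>M\<^esub> s) = f x \<triangleleft>\<^bsub>N\<^esub> s"
  using assms by (auto simp: right_linear_def additive_map_def)

lemma left_linearD:
  assumes "left_linear R M N f"
  shows "x \<in> carrier M \<Longrightarrow> f x \<in> carrier N"
    and "\<lbrakk>x \<in> carrier M; y \<in> carrier M\<rbrakk> \<Longrightarrow> f (x \<oplus>\<^bsub>M\<^esub> y) = f x \<oplus>\<^bsub>N\<^esub> f y"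
    and "\<lbrakk>r \<in> carrier R; x \<in> carrier M\<rbrakk> \<Longrightarrow> f (r \<triangleright>\<^bsub>M\<^esub> x) = r \<triangleright>\<^bsub>N\<^esub> f x"
  using assms by (auto simp: left_linear_def additive_map_def)

lemma right_hom_iff:
  "f \<in> right_hom S M N \<longleftrightarrow> f \<in> extensional (carrier M) \<and> right_linear S M N f"
  by (auto simp: right_hom_def right_linear_def additive_map_def PiE_def)

lemma bimod_hom_iff:
  "f \<in> bimod_hom R S M N \<longleftrightarrow>
    f \<in> extensional (carrier M) \<and> left_linear R M N f \<and> right_linear S M N f"
  by (auto simp: bimod_hom_def right_hom_iff left_linear_def right_linear_def)

section \<open>The bimodule structure on a tensor product\<close>

context tensor_pair
begin

lemma tlift_cong_carrier: "carrier X = carrier Y \<Longrightarrow> tlift X P f = tlift Y P f"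
  by (simp add: tlift_def)

lemma tensor_group_fields:
  "carrier (tensor_group R M N) = carrier T" "ring.add (tensor_group R M N) = ring.add T"
  "\<zero>\<^bsub>tensor_group R M N\<^esub> = \<zero>\<^bsub>T\<^esub>"
  by (simp_all add: tensor_def Let_def)

lemma tensor_group_abelian: "abelian_group (tensor_group R M N)"
  by (rule abelian_group_cong[OF T.abelian_group_axioms tensor_group_fields])

text \<open>The actions of \<open>tensor\<close> are lifts into the bare group
  \<open>tensor_group\<close>, since the full record is still under construction at that point. They
  are transferred here to \<open>T\<close>, which has the same additive structure.\<close>

lemma tlift_self:
  assumes "balanced R M N T f"
  defines "h \<equiv> tlift (tensor_group R M N) (tensor_group R M N) f"
  shows "x \<in> carrier T \<Longrightarrow> h x \<in> carrier T"
    and "\<lbrakk>x \<in> carrier T; y \<in> carrier T\<rbrakk> \<Longrightarrow> h (x \<oplus>\<^bsub>T\<^esub> y) = h x \<oplus>\<^bsub>T\<^esub> h y"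
    and "\<lbrakk>a \<in> carrier M; b \<in> carrier N\<rbrakk> \<Longrightarrow> h (tt a b) = f a b"
proof -
  have bal: "balanced R M N (tensor_group R M N) f"
    using assms by (simp add: balanced_def tensor_group_fields)
  have h: "h = tlift T (tensor_group R M N) f"
    unfolding h_def by (rule tlift_cong_carrier) (rule tensor_group_fields)
  show "x \<in> carrier T \<Longrightarrow> h x \<in> carrier T"
    and "\<lbrakk>x \<in> carrier T; y \<in> carrier T\<rbrakk> \<Longrightarrow> h (x \<oplus>\<^bsub>T\<^esub> y) = h x \<oplus>\<^bsub>T\<^esub> h y"
    and "\<lbrakk>a \<in> carrier M; b \<in> carrier N\<rbrakk> \<Longrightarrow> h (tt a b) = f a b"
    unfolding h
    using tlift_closed[OF tensor_group_abelian bal, of x] tlift_add[OF tensor_group_abelian bal, of x y]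
      tlift_tens[OF tensor_group_abelian bal, of a b]
    by (simp_all add: tensor_group_fields)
qed

lemma balanced_lact: "l \<in> carrier L \<Longrightarrow> balanced R M N T (\<lambda>x y. tt (l \<triangleright>\<^bsub>M\<^esub> x) y)"
  by (rule balancedI)
    (simp_all add: M.lact_closed M.lact_add tens_balanced M.lact_ract_assoc[symmetric])

lemma balanced_ract: "q \<in> carrier Q \<Longrightarrow> balanced R M N T (\<lambda>x y. tt x (y \<triangleleft>\<^bsub>N\<^esub> q))"
  by (rule balancedI)
    (simp_all add: N.ract_closed N.ract_add tens_balanced N.lact_ract_assoc)

lemma T_lact: "l \<triangleright>\<^bsub>T\<^esub> z = tlift (tensor_group R M N) (tensor_group R M N) (\<lambda>x y. tt (l \<triangleright>\<^bsub>M\<^esub> x) y) z"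
  by (simp add: tensor_def Let_def)

lemma T_ract: "z \<triangleleft>\<^bsub>T\<^esub> q = tlift (tensor_group R M N) (tensor_group R M N) (\<lambda>x y. tt x (y \<triangleleft>\<^bsub>N\<^esub> q)) z"
  by (simp add: tensor_def Let_def)

lemma lact_tens [simp]:
  "\<lbrakk>l \<in> carrier L; x \<in> carrier M; y \<in> carrier N\<rbrakk> \<Longrightarrow> l \<triangleright>\<^bsub>T\<^esub> tt x y = tt (l \<triangleright>\<^bsub>M\<^esub> x) y"
  unfolding T_lact by (rule tlift_self(3)[OF balanced_lact])

lemma ract_tens [simp]:
  "\<lbrakk>q \<in> carrier Q; x \<in> carrier M; y \<in> carrier N\<rbrakk> \<Longrightarrow> tt x y \<triangleleft>\<^bsub>T\<^esub> q = tt x (y \<triangleleft>\<^bsub>N\<^esub> q)"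
  unfolding T_ract by (rule tlift_self(3)[OF balanced_ract])

lemma T_lact_closed [simp]: "\<lbrakk>l \<in> carrier L; z \<in> carrier T\<rbrakk> \<Longrightarrow> l \<triangleright>\<^bsub>T\<^esub> z \<in> carrier T"
  unfolding T_lact by (rule tlift_self(1)[OF balanced_lact])

lemma T_ract_closed [simp]: "\<lbrakk>q \<in> carrier Q; z \<in> carrier T\<rbrakk> \<Longrightarrow> z \<triangleleft>\<^bsub>T\<^esub> q \<in> carrier T"
  unfolding T_ract by (rule tlift_self(1)[OF balanced_ract])

lemma T_lact_add [simp]:
  "\<lbrakk>l \<in> carrier L; z \<in> carrier T; z' \<in> carrier T\<rbrakk> \<Longrightarrow> l \<triangleright>\<^bsub>T\<^esub> (z \<oplus>\<^bsub>T\<^esub> z') = l \<triangleright>\<^bsub>T\<^esub> z \<oplus>\<^bsub>T\<^esub> l \<triangleright>\<^bsub>T\<^esub> z'"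
  unfolding T_lact by (rule tlift_self(2)[OF balanced_lact])

lemma T_ract_add [simp]:
  "\<lbrakk>q \<in> carrier Q; z \<in> carrier T; z' \<in> carrier T\<rbrakk> \<Longrightarrow> (z \<oplus>\<^bsub>T\<^esub> z') \<triangleleft>\<^bsub>T\<^esub> q = z \<triangleleft>\<^bsub>T\<^esub> q \<oplus>\<^bsub>T\<^esub> z' \<triangleleft>\<^bsub>T\<^esub> q"
  unfolding T_ract by (rule tlift_self(2)[OF balanced_ract])

sublocale B: bimodule L Q T
proof unfold_locales
  fix r r' z assume r: "r \<in> carrier L" "r' \<in> carrier L" and z: "z \<in> carrier T"
  show "(r \<oplus>\<^bsub>L\<^esub> r') \<triangleright>\<^bsub>T\<^esub> z = r \<triangleright>\<^bsub>T\<^esub> z \<oplus>\<^bsub>T\<^esub> r' \<triangleright>\<^bsub>T\<^esub> z" using z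
  proof (induction rule: induct)
    case (add z z')
    then show ?case using r by (simp add: T_lact_add T_lact_closed T.a_ac)
  qed (use r in \<open>simp add: M.lact_ring_add M.lact_closed\<close>)
  show "(r \<otimes>\<^bsub>L\<^esub> r') \<triangleright>\<^bsub>T\<^esub> z = r \<triangleright>\<^bsub>T\<^esub> (r' \<triangleright>\<^bsub>T\<^esub> z)" using z
    by (induction rule: induct) (use r in \<open>simp_all add: M.lact_mult M.lact_closed T_lact_add T_lact_closed\<close>)
next
  fix z assume "z \<in> carrier T"
  then show "\<one>\<^bsub>L\<^esub> \<triangleright>\<^bsub>T\<^esub> z = z"
    by (induction rule: induct) (simp_all add: M.lact_one T_lact_add)
next
  fix q q' z assume q: "q \<in> carrier Q" "q' \<in> carrier Q" and z: "z \<in> carrier T"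
  show "z \<triangleleft>\<^bsub>T\<^esub> (q \<oplus>\<^bsub>Q\<^esub> q') = z \<triangleleft>\<^bsub>T\<^esub> q \<oplus>\<^bsub>T\<^esub> z \<triangleleft>\<^bsub>T\<^esub> q'" using z
  proof (induction rule: induct)
    case (add z z')
    then show ?case using q by (simp add: T_ract_add T_ract_closed T.a_ac)
  qed (use q in \<open>simp add: N.ract_ring_add N.ract_closed\<close>)
  show "z \<triangleleft>\<^bsub>T\<^esub> (q \<otimes>\<^bsub>Q\<^esub> q') = (z \<triangleleft>\<^bsub>T\<^esub> q) \<triangleleft>\<^bsub>T\<^esub> q'" using z
    by (induction rule: induct) (use q in \<open>simp_all add: N.ract_mult N.ract_closed T_ract_add T_ract_closed\<close>)
next
  fix z assume "z \<in> carrier T"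
  then show "z \<triangleleft>\<^bsub>T\<^esub> \<one>\<^bsub>Q\<^esub> = z"
    by (induction rule: induct) (simp_all add: N.ract_one T_ract_add)
next
  fix l z q assume q: "q \<in> carrier Q" "l \<in> carrier L" and z: "z \<in> carrier T"
  show "(l \<triangleright>\<^bsub>T\<^esub> z) \<triangleleft>\<^bsub>T\<^esub> q = l \<triangleright>\<^bsub>T\<^esub> (z \<triangleleft>\<^bsub>T\<^esub> q)" using z
    by (induction rule: induct) (use q in \<open>simp_all add: M.lact_closed N.ract_closed T_lact_closed T_ract_closed T_lact_add T_ract_add\<close>)
qed (simp_all add: T_lact_closed T_ract_closed T_lact_add T_ract_add)

lemma bimodule_tensor: "bimodule L Q T" ..

lemma tens_finsum_right:
  assumes "h \<in> J \<rightarrow> carrier N" "x \<in> carrier M"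
  shows "tt x (\<Oplus>\<^bsub>N\<^esub>i\<in>J. h i) = (\<Oplus>\<^bsub>T\<^esub>i\<in>J. tt x (h i))"
  using additive_map_finsum[OF N.M.abelian_group_axioms T.abelian_group_axioms, of "\<lambda>y. tt x y" h J] assms
  by (simp add: additive_mapI)

end

section \<open>Tensor products of linear maps\<close>

locale tensor_map = P: tensor_pair L R Q M N + P': tensor_pair L' R Q' M' N'
  for L :: "('l, 'a) ring_scheme" and R :: "('r, 'b) ring_scheme" and Q :: "('q, 'c) ring_scheme"
    and M :: "('l, 'r, 'm, 'd) bimod_scheme" and N :: "('r, 'q, 'n, 'e) bimod_scheme"
    and L' :: "('l2, 'a2) ring_scheme" and Q' :: "('q2, 'c2) ring_scheme"
    and M' :: "('l2, 'r, 'm2, 'd2) bimod_scheme" and N' :: "('r, 'q2, 'n2, 'e2) bimod_scheme" +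
  fixes f :: "'m \<Rightarrow> 'm2" and g :: "'n \<Rightarrow> 'n2"
  assumes f_linear: "right_linear R M M' f" and g_linear: "left_linear R N N' g"
begin

abbreviation "F \<equiv> tmap R M N M' N' f g"

lemma balanced: "balanced R M N P'.T (\<lambda>x y. P'.tt (f x) (g y))"
  by (rule balancedI) (simp_all add: right_linearD[OF f_linear] left_linearD[OF g_linear] P'.tens_balanced)

lemma tmap_closed [simp]: "z \<in> carrier P.T \<Longrightarrow> F z \<in> carrier P'.T"
  unfolding tmap_def by (rule P.tlift_closed[OF P'.T.abelian_group_axioms balanced])

lemma tmap_add [simp]: "\<lbrakk>z \<in> carrier P.T; z' \<in> carrier P.T\<rbrakk> \<Longrightarrow> F (z \<oplus>\<^bsub>P.T\<^esub> z') = F z \<oplus>\<^bsub>P'.T\<^esub> F z'"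
  unfolding tmap_def by (rule P.tlift_add[OF P'.T.abelian_group_axioms balanced])

lemma tmap_tens [simp]: "\<lbrakk>x \<in> carrier M; y \<in> carrier N\<rbrakk> \<Longrightarrow> F (P.tt x y) = P'.tt (f x) (g y)"
  unfolding tmap_def by (rule P.tlift_tens[OF P'.T.abelian_group_axioms balanced])

lemma tmap_additive: "additive_map P.T P'.T F"
  by (rule additive_mapI) simp_all

end

text \<open>Linearity on the outer side is needed where a tensor product of maps becomes a factor of
  a further one, as in \<open>M \<otimes> g \<otimes> D\<close>.\<close>

lemma tmap_right_linear:
  assumes "tensor_map L R Q M N L' Q M' N' f g" and g: "right_linear Q N N' g"
  shows "right_linear Q (tensor R M N) (tensor R M' N') (tmap R M N M' N' f g)"
proof -
  interpret tensor_map L R Q M N L' Q M' N' f g by fact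
  show ?thesis
  proof (rule right_linearI)
    fix z s assume "z \<in> carrier P.T" and s: "s \<in> carrier Q"
    then show "F (z \<triangleleft>\<^bsub>P.T\<^esub> s) = F z \<triangleleft>\<^bsub>P'.T\<^esub> s"
      by (induction rule: P.induct)
        (simp_all add: right_linearD[OF g] left_linearD(1)[OF g_linear] right_linearD(1)[OF f_linear] P.N.ract_closed P.T_ract_add P'.T_ract_add
          P.T_ract_closed P'.T_ract_closed)
  qed simp_all
qed

section \<open>Endomorphism monoids of corings\<close>

text \<open>Closure under composition is functoriality of \<open>g \<mapsto> g \<otimes> g\<close>,
  checked on elementary tensors; the values of \<open>comult C\<close> must lie in the tensor
  product for this to apply to them.\<close>

lemma coring_End_monoid:
  assumes "bimodule A A C" and \<Delta>: "\<And>c. c \<in> carrier C \<Longrightarrow> comult C c \<in> carrier (tensor A C C)"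
  shows "Group.monoid (coring_End A C)"
proof -
  interpret bimodule A A C by fact
  interpret CC: tensor_pair A A A C C ..
  have hom: "left_linear A C C g" "right_linear A C C g" "g \<in> extensional (carrier C)"
    "\<And>c. c \<in> carrier C \<Longrightarrow> comult C (g c) = tmap A C C C C g g (comult C c)"
    "\<And>c. c \<in> carrier C \<Longrightarrow> counit C (g c) = counit C c"
    "\<And>c. c \<in> carrier C \<Longrightarrow> g c \<in> carrier C"
    if "g \<in> coring_endos A C" for g
    using that by (auto simp: coring_endos_def bimod_hom_iff dest: left_linearD(1))
  have tm: "tensor_map A A A C C A A C C f g" if "right_linear A C C f" "left_linear A C C g" for f g
    using that by unfold_locales auto
  have comp: "compose (carrier C) g h \<in> coring_endos A C"
    if g: "g \<in> coring_endos A C" and h: "h \<in> coring_endos A C" for g h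
  proof -
    let ?k = "compose (carrier C) g h"
    note gh = hom[OF g] hom[OF h]
    have l: "left_linear A C C ?k"
      using gh by (intro left_linearI)
        (simp_all add: compose_def left_linearD[of A C C g] left_linearD[of A C C h] lact_closed)
    have r: "right_linear A C C ?k"
      using gh by (intro right_linearI)
        (simp_all add: compose_def right_linearD[of A C C g] right_linearD[of A C C h] ract_closed)
    interpret G: tensor_map A A A C C A A C C g g using gh by (intro tm)
    interpret H: tensor_map A A A C C A A C C h h using gh by (intro tm)
    interpret K: tensor_map A A A C C A A C C ?k ?k by (intro tm l r)
    have "tmap A C C C C ?k ?k z = tmap A C C C C g g (tmap A C C C C h h z)" if "z \<in> carrier CC.T" for z
      using that by (induction rule: CC.induct) (simp_all add: gh, simp add: compose_def)
    then show ?thesis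
      using l r gh \<Delta> by (simp add: coring_endos_def bimod_hom_iff) (simp add: compose_def)
  qed
  have one: "(\<lambda>c\<in>carrier C. c) \<in> coring_endos A C"
  proof -
    define i where "i = (\<lambda>c\<in>carrier C. c)"
    have i: "i \<in> extensional (carrier C)" "\<And>c. c \<in> carrier C \<Longrightarrow> i c = c" by (simp_all add: i_def)
    have l: "left_linear A C C i" by (intro left_linearI) (simp_all add: i lact_closed)
    have r: "right_linear A C C i" by (intro right_linearI) (simp_all add: i ract_closed)
    interpret tensor_map A A A C C A A C C i i by (intro tm l r)
    have "tmap A C C C C i i z = z" if "z \<in> carrier CC.T" for z
      using that by (induction rule: CC.induct) (simp_all add: i)
    then show ?thesis
      using l r i \<Delta> by (simp add: coring_endos_def bimod_hom_iff flip: i_def)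
  qed
  show ?thesis
  proof (rule monoidI, unfold coring_End_def, simp_all add: comp one)
    fix x y z assume "x \<in> coring_endos A C" "y \<in> coring_endos A C" "z \<in> coring_endos A C"
    then show "compose (carrier C) (compose (carrier C) x y) z = compose (carrier C) x (compose (carrier C) y z)"
      using hom by (auto simp: compose_def fun_eq_iff)
  next
    fix x assume x: "x \<in> coring_endos A C"
    show "compose (carrier C) (\<lambda>c\<in>carrier C. c) x = x" "compose (carrier C) x (\<lambda>c\<in>carrier C. c) = x"
      using hom(3,6)[OF x] by (auto simp: compose_def fun_eq_iff extensional_def)
  qed
qed

text \<open>Tensor products read only the bimodule fields of their arguments. A coring can therefore
  be replaced by its underlying bimodule, and what holds for \<open>tensor_pair\<close> applies to
  it.\<close>

lemma tensor_truncate: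
  "tens R (bimod.truncate M) N = tens R M N" "tens R M (bimod.truncate N) = tens R M N"
  "tensor R (bimod.truncate M) N = tensor R M N" "tensor R M (bimod.truncate N) = tensor R M N"
proof -
  have *: "tensor_sub R (bimod.truncate M) N = tensor_sub R M N" "tensor_sub R M (bimod.truncate N) = tensor_sub R M N"
    by (simp_all add: tensor_sub_def tensor_rels_def bimod.defs)
  then show 1: "tens R (bimod.truncate M) N = tens R M N" "tens R M (bimod.truncate N) = tens R M N"
    by (simp_all add: tens_def fun_eq_iff) (simp_all add: bimod.defs)
  have "tensor_group R (bimod.truncate M) N = tensor_group R M N"
    "tensor_group R M (bimod.truncate N) = tensor_group R M N"
    by (simp_all add: tensor_group_def *) (simp_all add: bimod.defs)
  then show "tensor R (bimod.truncate M) N = tensor R M N" "tensor R M (bimod.truncate N) = tensor R M N"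
    by (simp_all add: tensor_def 1) (simp_all add: bimod.defs)
qed

section \<open>Rings and their sub-bimodules as bimodules\<close>

lemma ring_bimod_fields [simp]:
  "carrier (ring_bimod R \<phi> \<psi>) = carrier R" "ring.add (ring_bimod R \<phi> \<psi>) = ring.add R"
  "\<zero>\<^bsub>ring_bimod R \<phi> \<psi>\<^esub> = \<zero>\<^bsub>R\<^esub>"
  "p \<triangleright>\<^bsub>ring_bimod R \<phi> \<psi>\<^esub> x = \<phi> p \<otimes>\<^bsub>R\<^esub> x" "x \<triangleleft>\<^bsub>ring_bimod R \<phi> \<psi>\<^esub> q = x \<otimes>\<^bsub>R\<^esub> \<psi> q"
  by (simp_all add: ring_bimod_def)

lemma bimodule_ring_bimod:
  assumes "ring P" "ring Q" "ring R" "\<phi> \<in> ring_hom P R" "\<psi> \<in> ring_hom Q R"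
  shows "bimodule P Q (ring_bimod R \<phi> \<psi>)"
proof -
  interpret P: ring P by fact
  interpret Q: ring Q by fact
  interpret R: ring R by fact
  interpret M: abelian_group "ring_bimod R \<phi> \<psi>"
    by (rule abelian_group_cong[OF R.abelian_group_axioms]) simp_all
  note h = ring_hom_closed[OF assms(4)] ring_hom_closed[OF assms(5)]
    ring_hom_add[OF assms(4)] ring_hom_add[OF assms(5)] ring_hom_mult[OF assms(4)] ring_hom_mult[OF assms(5)]
    ring_hom_one[OF assms(4)] ring_hom_one[OF assms(5)]
  show ?thesis
    by unfold_locales (simp_all add: h R.m_assoc R.l_distr R.r_distr)
qed

lemma ring_hom_id: "ring R \<Longrightarrow> (\<lambda>x. x) \<in> ring_hom R R"
  by (simp add: ring_hom_def)

lemma bimodule_sub_bimod: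
  assumes "ring B" "ring S" "\<phi> \<in> ring_hom B S" and I: "I \<subseteq> carrier S" "additive_subgroup I S"
    and cl: "\<And>b x. \<lbrakk>b \<in> carrier B; x \<in> I\<rbrakk> \<Longrightarrow> \<phi> b \<otimes>\<^bsub>S\<^esub> x \<in> I"
      "\<And>b x. \<lbrakk>b \<in> carrier B; x \<in> I\<rbrakk> \<Longrightarrow> x \<otimes>\<^bsub>S\<^esub> \<phi> b \<in> I"
  shows "bimodule B B (sub_bimod \<phi> S I)"
proof -
  interpret B: ring B by fact
  interpret S: ring S by fact
  interpret bimodule B B "ring_bimod S \<phi> \<phi>" by (intro bimodule_ring_bimod assms)
  interpret I: additive_subgroup I S by fact
  note [simp] = subsetD[OF I(1)]
  have fields: "carrier (sub_bimod \<phi> S I) = I" "ring.add (sub_bimod \<phi> S I) = ring.add S"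
    "\<zero>\<^bsub>sub_bimod \<phi> S I\<^esub> = \<zero>\<^bsub>S\<^esub>" "lact (sub_bimod \<phi> S I) = lact (ring_bimod S \<phi> \<phi>)"
    "ract (sub_bimod \<phi> S I) = ract (ring_bimod S \<phi> \<phi>)"
    by (simp_all add: sub_bimod_def ring_bimod_def)
  interpret N: abelian_group "sub_bimod \<phi> S I"
  proof (rule abelian_groupI, unfold fields)
    fix x assume "x \<in> I"
    then show "\<exists>y\<in>I. y \<oplus>\<^bsub>S\<^esub> x = \<zero>\<^bsub>S\<^esub>"
      by (intro bexI[of _ "\<ominus>\<^bsub>S\<^esub> x"]) (auto simp: S.l_neg)
  qed (simp_all add: S.a_ac)
  show ?thesis
  proof (unfold_locales, unfold fields)
    fix r x y assume "r \<in> carrier B" "x \<in> I" "y \<in> I"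
    then show "r \<triangleright>\<^bsub>ring_bimod S \<phi> \<phi>\<^esub> (x \<oplus>\<^bsub>S\<^esub> y) = r \<triangleright>\<^bsub>ring_bimod S \<phi> \<phi>\<^esub> x \<oplus>\<^bsub>S\<^esub> r \<triangleright>\<^bsub>ring_bimod S \<phi> \<phi>\<^esub> y"
      "(x \<oplus>\<^bsub>S\<^esub> y) \<triangleleft>\<^bsub>ring_bimod S \<phi> \<phi>\<^esub> r = x \<triangleleft>\<^bsub>ring_bimod S \<phi> \<phi>\<^esub> r \<oplus>\<^bsub>S\<^esub> y \<triangleleft>\<^bsub>ring_bimod S \<phi> \<phi>\<^esub> r"
      using lact_add[of r x y] ract_add[of x y r] by simp_all
  next
    fix r r' x assume *: "r \<in> carrier B" "r' \<in> carrier B" "x \<in> I"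
    then show "(r \<oplus>\<^bsub>B\<^esub> r') \<triangleright>\<^bsub>ring_bimod S \<phi> \<phi>\<^esub> x = r \<triangleright>\<^bsub>ring_bimod S \<phi> \<phi>\<^esub> x \<oplus>\<^bsub>S\<^esub> r' \<triangleright>\<^bsub>ring_bimod S \<phi> \<phi>\<^esub> x"
      "x \<triangleleft>\<^bsub>ring_bimod S \<phi> \<phi>\<^esub> (r \<oplus>\<^bsub>B\<^esub> r') = x \<triangleleft>\<^bsub>ring_bimod S \<phi> \<phi>\<^esub> r \<oplus>\<^bsub>S\<^esub> x \<triangleleft>\<^bsub>ring_bimod S \<phi> \<phi>\<^esub> r'"
      "(r \<otimes>\<^bsub>B\<^esub> r') \<triangleright>\<^bsub>ring_bimod S \<phi> \<phi>\<^esub> x = r \<triangleright>\<^bsub>ring_bimod S \<phi> \<phi>\<^esub> r' \<triangleright>\<^bsub>ring_bimod S \<phi> \<phi>\<^esub> x"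
      "x \<triangleleft>\<^bsub>ring_bimod S \<phi> \<phi>\<^esub> (r \<otimes>\<^bsub>B\<^esub> r') = x \<triangleleft>\<^bsub>ring_bimod S \<phi> \<phi>\<^esub> r \<triangleleft>\<^bsub>ring_bimod S \<phi> \<phi>\<^esub> r'"
      "(r \<triangleright>\<^bsub>ring_bimod S \<phi> \<phi>\<^esub> x) \<triangleleft>\<^bsub>ring_bimod S \<phi> \<phi>\<^esub> r' = r \<triangleright>\<^bsub>ring_bimod S \<phi> \<phi>\<^esub> (x \<triangleleft>\<^bsub>ring_bimod S \<phi> \<phi>\<^esub> r')"
      using lact_ring_add[of r r' x] ract_ring_add[of x r r'] lact_mult[of r r' x] ract_mult[of x r r']
        lact_ract_assoc[of r x r'] by simp_all
  qed (use cl lact_one ract_one in simp_all)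
qed

lemma sub_bimod_fields [simp]:
  "carrier (sub_bimod \<phi> S I) = I" "ring.add (sub_bimod \<phi> S I) = ring.add S"
  "\<zero>\<^bsub>sub_bimod \<phi> S I\<^esub> = \<zero>\<^bsub>S\<^esub>" "b \<triangleright>\<^bsub>sub_bimod \<phi> S I\<^esub> x = \<phi> b \<otimes>\<^bsub>S\<^esub> x"
  "x \<triangleleft>\<^bsub>sub_bimod \<phi> S I\<^esub> b = x \<otimes>\<^bsub>S\<^esub> \<phi> b"
  by (simp_all add: sub_bimod_def ring_bimod_def)

section \<open>The dual module and the endomorphism ring\<close>

locale comatrix_setting = M: bimodule B A M
  for A :: "'a ring" and B :: "'b ring" and M :: "('b, 'a, 'm) bimod" +
  fixes J :: "'i set" and e :: "'i \<Rightarrow> 'm" and e' :: "'i \<Rightarrow> 'm \<Rightarrow> 'a"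
  assumes dual_basis: "dual_basis A M J e e'"
begin

abbreviation "D \<equiv> dual A M"
abbreviation "S \<equiv> end_ring A M"
abbreviation "\<phi> \<equiv> left_mult M"

lemmas M_simps [simp] = M.lact_closed M.ract_closed M.lact_add M.lact_ring_add M.lact_mult M.lact_one
  M.ract_add M.ract_ring_add M.ract_mult M.ract_one M.lact_ract_assoc[symmetric]

lemma D_iff: "u \<in> carrier D \<longleftrightarrow> u \<in> extensional (carrier M) \<and> right_linear A M (regular A) u"
  by (simp add: dual_def right_hom_iff)

lemma S_iff: "s \<in> carrier S \<longleftrightarrow> s \<in> extensional (carrier M) \<and> right_linear A M M s"
  by (simp add: end_ring_def right_hom_iff)

lemma D_app [simp]:
  assumes "u \<in> carrier D"
  shows "x \<in> carrier M \<Longrightarrow> u x \<in> carrier A"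
    and "\<lbrakk>x \<in> carrier M; y \<in> carrier M\<rbrakk> \<Longrightarrow> u (x \<oplus>\<^bsub>M\<^esub> y) = u x \<oplus>\<^bsub>A\<^esub> u y"
    and "\<lbrakk>x \<in> carrier M; a \<in> carrier A\<rbrakk> \<Longrightarrow> u (x \<triangleleft>\<^bsub>M\<^esub> a) = u x \<otimes>\<^bsub>A\<^esub> a"
  using assms right_linearD[of A M "regular A" u] by (simp_all add: D_iff)

lemma S_app [simp]:
  assumes "s \<in> carrier S"
  shows "x \<in> carrier M \<Longrightarrow> s x \<in> carrier M"
    and "\<lbrakk>x \<in> carrier M; y \<in> carrier M\<rbrakk> \<Longrightarrow> s (x \<oplus>\<^bsub>M\<^esub> y) = s x \<oplus>\<^bsub>M\<^esub> s y"
    and "\<lbrakk>x \<in> carrier M; a \<in> carrier A\<rbrakk> \<Longrightarrow> s (x \<triangleleft>\<^bsub>M\<^esub> a) = s x \<triangleleft>\<^bsub>M\<^esub> a"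
  using assms right_linearD[of A M M s] by (simp_all add: S_iff)

lemma D_eqI:
  assumes "u \<in> carrier D" "v \<in> carrier D" "\<And>x. x \<in> carrier M \<Longrightarrow> u x = v x"
  shows "u = v"
  using assms by (auto simp: D_iff intro: extensionalityI)

lemma S_eqI:
  assumes "u \<in> carrier S" "v \<in> carrier S" "\<And>x. x \<in> carrier M \<Longrightarrow> u x = v x"
  shows "u = v"
  using assms by (auto simp: S_iff intro: extensionalityI)

lemma D_memI:
  assumes "u \<in> extensional (carrier M)"
    and "\<And>x. x \<in> carrier M \<Longrightarrow> u x \<in> carrier A"
    and "\<And>x y. \<lbrakk>x \<in> carrier M; y \<in> carrier M\<rbrakk> \<Longrightarrow> u (x \<oplus>\<^bsub>M\<^esub> y) = u x \<oplus>\<^bsub>A\<^esub> u y"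
    and "\<And>x a. \<lbrakk>x \<in> carrier M; a \<in> carrier A\<rbrakk> \<Longrightarrow> u (x \<triangleleft>\<^bsub>M\<^esub> a) = u x \<otimes>\<^bsub>A\<^esub> a"
  shows "u \<in> carrier D"
  using assms by (auto simp: D_iff intro!: right_linearI)

lemma S_memI:
  assumes "u \<in> extensional (carrier M)"
    and "\<And>x. x \<in> carrier M \<Longrightarrow> u x \<in> carrier M"
    and "\<And>x y. \<lbrakk>x \<in> carrier M; y \<in> carrier M\<rbrakk> \<Longrightarrow> u (x \<oplus>\<^bsub>M\<^esub> y) = u x \<oplus>\<^bsub>M\<^esub> u y"
    and "\<And>x a. \<lbrakk>x \<in> carrier M; a \<in> carrier A\<rbrakk> \<Longrightarrow> u (x \<triangleleft>\<^bsub>M\<^esub> a) = u x \<triangleleft>\<^bsub>M\<^esub> a"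
  shows "u \<in> carrier S"
  using assms by (auto simp: S_iff intro!: right_linearI)

lemma D_ops:
  "u \<oplus>\<^bsub>D\<^esub> v = (\<lambda>x\<in>carrier M. u x \<oplus>\<^bsub>A\<^esub> v x)" "\<zero>\<^bsub>D\<^esub> = (\<lambda>x\<in>carrier M. \<zero>\<^bsub>A\<^esub>)"
  "a \<triangleright>\<^bsub>D\<^esub> u = (\<lambda>x\<in>carrier M. a \<otimes>\<^bsub>A\<^esub> u x)" "u \<triangleleft>\<^bsub>D\<^esub> b = (\<lambda>x\<in>carrier M. u (b \<triangleright>\<^bsub>M\<^esub> x))"
  by (simp_all add: dual_def)

lemma S_ops:
  "s \<oplus>\<^bsub>S\<^esub> t = (\<lambda>x\<in>carrier M. s x \<oplus>\<^bsub>M\<^esub> t x)" "\<zero>\<^bsub>S\<^esub> = (\<lambda>x\<in>carrier M. \<zero>\<^bsub>M\<^esub>)"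
  "s \<otimes>\<^bsub>S\<^esub> t = (\<lambda>x\<in>carrier M. s (t x))" "\<one>\<^bsub>S\<^esub> = (\<lambda>x\<in>carrier M. x)"
  by (simp_all add: end_ring_def compose_def)

lemma D_ops_app [simp]:
  assumes "x \<in> carrier M"
  shows "(u \<oplus>\<^bsub>D\<^esub> v) x = u x \<oplus>\<^bsub>A\<^esub> v x" "\<zero>\<^bsub>D\<^esub> x = \<zero>\<^bsub>A\<^esub>"
    "(a \<triangleright>\<^bsub>D\<^esub> u) x = a \<otimes>\<^bsub>A\<^esub> u x" "(u \<triangleleft>\<^bsub>D\<^esub> b) x = u (b \<triangleright>\<^bsub>M\<^esub> x)"
  using assms by (simp_all add: D_ops)

lemma S_ops_app [simp]:
  assumes "x \<in> carrier M"
  shows "(s \<oplus>\<^bsub>S\<^esub> t) x = s x \<oplus>\<^bsub>M\<^esub> t x" "\<zero>\<^bsub>S\<^esub> x = \<zero>\<^bsub>M\<^esub>"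
    "(s \<otimes>\<^bsub>S\<^esub> t) x = s (t x)" "\<one>\<^bsub>S\<^esub> x = x"
  using assms by (simp_all add: S_ops)

lemma D_ops_closed:
  "\<lbrakk>u \<in> carrier D; v \<in> carrier D\<rbrakk> \<Longrightarrow> u \<oplus>\<^bsub>D\<^esub> v \<in> carrier D"
  "\<zero>\<^bsub>D\<^esub> \<in> carrier D"
  "\<lbrakk>a \<in> carrier A; u \<in> carrier D\<rbrakk> \<Longrightarrow> a \<triangleright>\<^bsub>D\<^esub> u \<in> carrier D"
  "\<lbrakk>u \<in> carrier D; b \<in> carrier B\<rbrakk> \<Longrightarrow> u \<triangleleft>\<^bsub>D\<^esub> b \<in> carrier D"
  by (rule D_memI; (simp add: M.S.a_ac M.S.l_distr M.S.r_distr M.S.m_assoc)?; simp add: D_ops)+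

lemma S_ops_closed:
  "\<lbrakk>s \<in> carrier S; t \<in> carrier S\<rbrakk> \<Longrightarrow> s \<oplus>\<^bsub>S\<^esub> t \<in> carrier S"
  "\<zero>\<^bsub>S\<^esub> \<in> carrier S"
  "\<lbrakk>s \<in> carrier S; t \<in> carrier S\<rbrakk> \<Longrightarrow> s \<otimes>\<^bsub>S\<^esub> t \<in> carrier S"
  "\<one>\<^bsub>S\<^esub> \<in> carrier S"
proof -
  have [simp]: "\<zero>\<^bsub>M\<^esub> \<triangleleft>\<^bsub>M\<^esub> a = \<zero>\<^bsub>M\<^esub>" if "a \<in> carrier A" for a
    using that
    by (intro additive_map_zero[OF M.M.abelian_group_axioms M.M.abelian_group_axioms, of "\<lambda>x. x \<triangleleft>\<^bsub>M\<^esub> a"])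
      (simp add: additive_mapI)
  show "\<lbrakk>s \<in> carrier S; t \<in> carrier S\<rbrakk> \<Longrightarrow> s \<oplus>\<^bsub>S\<^esub> t \<in> carrier S"
    "\<zero>\<^bsub>S\<^esub> \<in> carrier S"
    "\<lbrakk>s \<in> carrier S; t \<in> carrier S\<rbrakk> \<Longrightarrow> s \<otimes>\<^bsub>S\<^esub> t \<in> carrier S"
    "\<one>\<^bsub>S\<^esub> \<in> carrier S"
    by (rule S_memI; (simp add: M.M.a_ac)?; simp add: S_ops)+
qed

sublocale S: ring S
proof (intro ringI abelian_groupI monoidI)
  fix x assume x: "x \<in> carrier S"
  define y where "y = (\<lambda>z\<in>carrier M. \<ominus>\<^bsub>M\<^esub> x z)"
  have "(\<ominus>\<^bsub>M\<^esub> z) \<triangleleft>\<^bsub>M\<^esub> a = \<ominus>\<^bsub>M\<^esub> (z \<triangleleft>\<^bsub>M\<^esub> a)" if "a \<in> carrier A" "z \<in> carrier M" for a z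
    using that abelian_group_hom.a_inv_closed[OF additive_map_group_hom[OF M.M.abelian_group_axioms M.M.abelian_group_axioms, of "\<lambda>x. x \<triangleleft>\<^bsub>M\<^esub> a"]]
      abelian_group_hom.hom_a_inv[OF additive_map_group_hom[OF M.M.abelian_group_axioms M.M.abelian_group_axioms, of "\<lambda>x. x \<triangleleft>\<^bsub>M\<^esub> a"]]
    by (simp add: additive_mapI)
  then have y: "y \<in> carrier S"
    using x by (intro S_memI) (simp_all add: y_def M.M.minus_add)
  moreover have "y \<oplus>\<^bsub>S\<^esub> x = \<zero>\<^bsub>S\<^esub>"
    by (rule S_eqI) (use x y in \<open>simp_all add: S_ops_closed\<close>, simp add: y_def M.M.l_neg)
  ultimately show "\<exists>y\<in>carrier S. y \<oplus>\<^bsub>S\<^esub> x = \<zero>\<^bsub>S\<^esub>" by blast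
qed ((rule S_ops_closed; assumption) | (rule S_eqI; simp add: S_ops_closed M.M.a_ac))+

sublocale D: bimodule A B D
proof -
  interpret abelian_group D
  proof (intro abelian_groupI)
    fix x assume x: "x \<in> carrier D"
    define y where "y = (\<lambda>z\<in>carrier M. \<ominus>\<^bsub>A\<^esub> x z)"
    have y: "y \<in> carrier D"
      using x by (intro D_memI) (simp_all add: y_def M.S.minus_add M.S.l_minus)
    moreover have "y \<oplus>\<^bsub>D\<^esub> x = \<zero>\<^bsub>D\<^esub>"
      by (rule D_eqI) (use x y in \<open>simp_all add: D_ops_closed\<close>, simp add: y_def M.S.l_neg)
    ultimately show "\<exists>y\<in>carrier D. y \<oplus>\<^bsub>D\<^esub> x = \<zero>\<^bsub>D\<^esub>" by blast
  qed ((rule D_ops_closed; assumption) | (rule D_eqI; simp add: D_ops_closed M.S.a_ac))+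
  show "bimodule A B D"
    by unfold_locales
      ((rule D_ops_closed; assumption)
        | (rule D_eqI; simp add: D_ops_closed M.S.a_ac M.S.l_distr M.S.r_distr M.S.m_assoc))+
qed

lemma phi_hom: "\<phi> \<in> ring_hom B S"
proof -
  have cl: "\<phi> b \<in> carrier S" if "b \<in> carrier B" for b
    using that by (intro S_memI) (simp_all add: left_mult_def)
  show ?thesis
    by (rule ring_hom_memI; (rule cl, assumption)?; (rule S_eqI; simp add: cl S_ops_closed)?)
      (simp_all add: left_mult_def)
qed

lemma phi_closed [simp]: "b \<in> carrier B \<Longrightarrow> \<phi> b \<in> carrier S"
  by (rule ring_hom_closed[OF phi_hom])

lemma phi_app [simp]: "x \<in> carrier M \<Longrightarrow> \<phi> b x = b \<triangleright>\<^bsub>M\<^esub> x"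
  by (simp add: left_mult_def)

section \<open>Dyads and the right action of the endomorphism ring on the dual\<close>

definition dcomp :: "('m \<Rightarrow> 'a) \<Rightarrow> ('m \<Rightarrow> 'm) \<Rightarrow> 'm \<Rightarrow> 'a"  (infixl "\<star>" 70)
  where "u \<star> s = compose (carrier M) u s"

definition dyad :: "'m \<Rightarrow> ('m \<Rightarrow> 'a) \<Rightarrow> 'm \<Rightarrow> 'm"
  where "dyad u v = (\<lambda>x\<in>carrier M. u \<triangleleft>\<^bsub>M\<^esub> v x)"

lemma dcomp_app [simp]: "x \<in> carrier M \<Longrightarrow> (u \<star> s) x = u (s x)"
  by (simp add: dcomp_def compose_def)

lemma dcomp_closed [simp]: "\<lbrakk>u \<in> carrier D; s \<in> carrier S\<rbrakk> \<Longrightarrow> u \<star> s \<in> carrier D"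
  by (rule D_memI) (simp_all, simp add: dcomp_def)

lemma dyad_app [simp]: "x \<in> carrier M \<Longrightarrow> dyad u v x = u \<triangleleft>\<^bsub>M\<^esub> v x"
  by (simp add: dyad_def)

lemma dyad_closed [simp]: "\<lbrakk>u \<in> carrier M; v \<in> carrier D\<rbrakk> \<Longrightarrow> dyad u v \<in> carrier S"
  by (rule S_memI) (simp_all, simp add: dyad_def)

text \<open>The action \<open>\<star>\<close> restricts along \<open>\<phi>\<close> to the
  \<open>B\<close>-action of \<open>D\<close>. The last rule is the compatibility of the pairings
  \<open>D \<times> M \<rightarrow> A\<close> and \<open>M \<times> D \<rightarrow> S\<close> of a
  Morita context.\<close>

lemma dcomp_simps [simp]:
  assumes "u \<in> carrier D"
  shows "\<lbrakk>s \<in> carrier S; v \<in> carrier D\<rbrakk> \<Longrightarrow> (u \<oplus>\<^bsub>D\<^esub> v) \<star> s = u \<star> s \<oplus>\<^bsub>D\<^esub> v \<star> s"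
    and "\<lbrakk>s \<in> carrier S; t \<in> carrier S\<rbrakk> \<Longrightarrow> u \<star> (s \<oplus>\<^bsub>S\<^esub> t) = u \<star> s \<oplus>\<^bsub>D\<^esub> u \<star> t"
    and "\<lbrakk>s \<in> carrier S; t \<in> carrier S\<rbrakk> \<Longrightarrow> u \<star> (s \<otimes>\<^bsub>S\<^esub> t) = u \<star> s \<star> t"
    and "u \<star> \<one>\<^bsub>S\<^esub> = u"
    and "\<lbrakk>s \<in> carrier S; a \<in> carrier A\<rbrakk> \<Longrightarrow> (a \<triangleright>\<^bsub>D\<^esub> u) \<star> s = a \<triangleright>\<^bsub>D\<^esub> (u \<star> s)"
    and "b \<in> carrier B \<Longrightarrow> u \<star> \<phi> b = u \<triangleleft>\<^bsub>D\<^esub> b"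
    and "\<lbrakk>w \<in> carrier M; v \<in> carrier D\<rbrakk> \<Longrightarrow> u \<star> dyad w v = u w \<triangleright>\<^bsub>D\<^esub> v"
  using assms by (intro D_eqI; simp add: D_ops_closed S_ops_closed)+

text \<open>As dyads are the values of \<open>\<xi>\<close> on elementary tensors, these rules
  express that \<open>\<xi>\<close> is \<open>A\<close>-balanced and linear over \<open>S\<close> on
  both sides.\<close>

lemma dyad_simps [simp]:
  assumes "u \<in> carrier M" "v \<in> carrier D"
  shows "u' \<in> carrier M \<Longrightarrow> dyad (u \<oplus>\<^bsub>M\<^esub> u') v = dyad u v \<oplus>\<^bsub>S\<^esub> dyad u' v"
    and "v' \<in> carrier D \<Longrightarrow> dyad u (v \<oplus>\<^bsub>D\<^esub> v') = dyad u v \<oplus>\<^bsub>S\<^esub> dyad u v'"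
    and "a \<in> carrier A \<Longrightarrow> dyad u (a \<triangleright>\<^bsub>D\<^esub> v) = dyad (u \<triangleleft>\<^bsub>M\<^esub> a) v"
    and "s \<in> carrier S \<Longrightarrow> s \<otimes>\<^bsub>S\<^esub> dyad u v = dyad (s u) v"
    and "s \<in> carrier S \<Longrightarrow> dyad u v \<otimes>\<^bsub>S\<^esub> s = dyad u (v \<star> s)"
  using assms by (intro S_eqI; simp add: D_ops_closed)+

section \<open>Dual basis expansions\<close>

lemma basis:
  shows e_closed [simp]: "i \<in> J \<Longrightarrow> e i \<in> carrier M"
    and e'_closed [simp]: "i \<in> J \<Longrightarrow> e' i \<in> carrier D"
    and basis_expand: "x \<in> carrier M \<Longrightarrow> (\<Oplus>\<^bsub>M\<^esub>i\<in>J. e i \<triangleleft>\<^bsub>M\<^esub> e' i x) = x"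
  using dual_basis by (auto simp: dual_basis_def)

lemma S_finsum_app:
  assumes "h \<in> J \<rightarrow> carrier S" "x \<in> carrier M"
  shows "(\<Oplus>\<^bsub>S\<^esub>i\<in>J. h i) x = (\<Oplus>\<^bsub>M\<^esub>i\<in>J. h i x)"
  using additive_map_finsum[OF S.abelian_group_axioms M.M.abelian_group_axioms _ assms(1), of "\<lambda>s. s x"] assms(2)
  by (simp add: additive_mapI)

lemma D_finsum_app:
  assumes "h \<in> J \<rightarrow> carrier D" "x \<in> carrier M"
  shows "(\<Oplus>\<^bsub>D\<^esub>i\<in>J. h i) x = (\<Oplus>\<^bsub>A\<^esub>i\<in>J. h i x)"
  using additive_map_finsum[OF D.M.abelian_group_axioms M.S.abelian_group_axioms _ assms(1), of "\<lambda>s. s x"] assms(2)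
  by (simp add: additive_mapI)

text \<open>At a point \<open>x\<close>, linearity of \<open>s\<close> reduces this to the dual
  basis identity. It is the source of the formula for the inverse of \<open>\<xi>\<close>, and for
  \<open>s = 1\<close> it writes the unit as a sum of dyads.\<close>

lemma S_expand:
  assumes "s \<in> carrier S"
  shows "(\<Oplus>\<^bsub>S\<^esub>i\<in>J. dyad (s (e i)) (e' i)) = s"
proof (rule S_eqI)
  show "(\<Oplus>\<^bsub>S\<^esub>i\<in>J. dyad (s (e i)) (e' i)) \<in> carrier S"
    using assms by (intro S.finsum_closed) (auto simp: Pi_iff)
  fix x assume x: "x \<in> carrier M"
  have "(\<Oplus>\<^bsub>S\<^esub>i\<in>J. dyad (s (e i)) (e' i)) x = (\<Oplus>\<^bsub>M\<^esub>i\<in>J. s (e i \<triangleleft>\<^bsub>M\<^esub> e' i x))"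
    using assms x by (subst S_finsum_app) (auto intro!: M.M.finsum_cong')
  also have "\<dots> = s (\<Oplus>\<^bsub>M\<^esub>i\<in>J. e i \<triangleleft>\<^bsub>M\<^esub> e' i x)"
    using assms x by (intro additive_map_finsum[symmetric] M.M.abelian_group_axioms) (auto intro: additive_mapI)
  finally show "(\<Oplus>\<^bsub>S\<^esub>i\<in>J. dyad (s (e i)) (e' i)) x = s x"
    using x by (simp add: basis_expand)
qed (rule assms)

text \<open>The functionals \<open>e' i\<close> generate \<open>D\<close> over \<open>A\<close>.
  Together with \<open>S_expand\<close> this gives the two halves of the bijectivity of
  \<open>\<xi>\<close>; later it recombines sums over the dual basis.\<close>

lemma D_expand:
  assumes u: "u \<in> carrier D"
  shows "(\<Oplus>\<^bsub>D\<^esub>i\<in>J. u (e i) \<triangleright>\<^bsub>D\<^esub> e' i) = u"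
proof (rule D_eqI)
  show "(\<Oplus>\<^bsub>D\<^esub>i\<in>J. u (e i) \<triangleright>\<^bsub>D\<^esub> e' i) \<in> carrier D"
    using u by (intro D.M.finsum_closed) (auto simp: Pi_iff D_ops_closed)
  fix x assume x: "x \<in> carrier M"
  have "(\<Oplus>\<^bsub>D\<^esub>i\<in>J. u (e i) \<triangleright>\<^bsub>D\<^esub> e' i) x = (\<Oplus>\<^bsub>A\<^esub>i\<in>J. u (e i \<triangleleft>\<^bsub>M\<^esub> e' i x))"
    using u x by (subst D_finsum_app) (auto simp: D_ops_closed intro!: M.S.finsum_cong')
  also have "\<dots> = u (\<Oplus>\<^bsub>M\<^esub>i\<in>J. e i \<triangleleft>\<^bsub>M\<^esub> e' i x)"
    using u x by (intro additive_map_finsum[symmetric] M.M.abelian_group_axioms M.S.abelian_group_axioms)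
      (auto intro: additive_mapI)
  finally show "(\<Oplus>\<^bsub>D\<^esub>i\<in>J. u (e i) \<triangleright>\<^bsub>D\<^esub> e' i) x = u x"
    using x by (simp add: basis_expand)
qed (rule u)

section \<open>Comparing the comatrix coring with the Sweedler coring\<close>

lemma SB_bimodule: "bimodule S B (SB S \<phi>)"
  by (intro bimodule_ring_bimod S.ring_axioms M.R.ring_axioms ring_hom_id phi_hom)

lemma BS_bimodule: "bimodule B S (BS S \<phi>)"
  by (intro bimodule_ring_bimod S.ring_axioms M.R.ring_axioms ring_hom_id phi_hom)

lemma regular_bimodule: "bimodule S S (regular S)"
  by (intro bimodule_ring_bimod S.ring_axioms ring_hom_id)

sublocale C: tensor_pair A B A D M
  by (rule tensor_pair.intro; rule D.bimodule_axioms M.bimodule_axioms)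

sublocale W: tensor_pair S B S "SB S \<phi>" "BS S \<phi>"
  by (rule tensor_pair.intro; rule SB_bimodule BS_bimodule)

sublocale E: tensor_pair B A B M D
  by (rule tensor_pair.intro; rule D.bimodule_axioms M.bimodule_axioms)

sublocale MC: tensor_pair B A A M C.T
  by (rule tensor_pair.intro; rule C.bimodule_tensor M.bimodule_axioms)

sublocale Y: tensor_pair B A B MC.T D
  by (rule tensor_pair.intro; rule MC.bimodule_tensor D.bimodule_axioms)

sublocale X: tensor_pair B B B E.T E.T
  by (rule tensor_pair.intro; rule E.bimodule_tensor)

sublocale CC: tensor_pair A A A C.T C.T
  by (rule tensor_pair.intro; rule C.bimodule_tensor)

sublocale WW: tensor_pair S S S W.T W.T
  by (rule tensor_pair.intro; rule W.bimodule_tensor)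

sublocale SW: tensor_pair S S S "regular S" W.T
  by (rule tensor_pair.intro; rule W.bimodule_tensor regular_bimodule)

lemmas D_closed [simp] = D.lact_closed D.ract_closed
lemmas [simp] = C.tens_balanced E.tens_balanced MC.tens_balanced X.tens_balanced
  Y.tens_balanced CC.tens_balanced WW.tens_balanced

lemma W_balanced [simp]:
  "\<lbrakk>s \<in> carrier S; b \<in> carrier B; s' \<in> carrier S\<rbrakk> \<Longrightarrow> W.tt (s \<otimes>\<^bsub>S\<^esub> \<phi> b) s' = W.tt s (\<phi> b \<otimes>\<^bsub>S\<^esub> s')"
  using W.tens_balanced[of s b s'] by simp

lemma W_balanced_dyad [simp]:
  assumes "u \<in> carrier M" "v \<in> carrier D" "b \<in> carrier B" "s \<in> carrier S"
  shows "W.tt (dyad u (v \<triangleleft>\<^bsub>D\<^esub> b)) s = W.tt (dyad u v) (\<phi> b \<otimes>\<^bsub>S\<^esub> s)"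
  using W_balanced[of "dyad u v" b s] assms by simp

lemma W_simps [simp]:
  assumes "s \<in> carrier S" "s' \<in> carrier S"
  shows "W.tt s s' \<in> carrier W.T"
    and "t \<in> carrier S \<Longrightarrow> W.tt (s \<oplus>\<^bsub>S\<^esub> t) s' = W.tt s s' \<oplus>\<^bsub>W.T\<^esub> W.tt t s'"
    and "t \<in> carrier S \<Longrightarrow> W.tt s (s' \<oplus>\<^bsub>S\<^esub> t) = W.tt s s' \<oplus>\<^bsub>W.T\<^esub> W.tt s t"
    and "t \<in> carrier S \<Longrightarrow> t \<triangleright>\<^bsub>W.T\<^esub> W.tt s s' = W.tt (t \<otimes>\<^bsub>S\<^esub> s) s'"
    and "t \<in> carrier S \<Longrightarrow> W.tt s s' \<triangleleft>\<^bsub>W.T\<^esub> t = W.tt s (s' \<otimes>\<^bsub>S\<^esub> t)"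
  using assms W.tens_closed[of s s'] W.tens_add_left[of s t s'] W.tens_add_right[of s s' t] 
    W.lact_tens[of t s s'] W.ract_tens[of t s s']
  by simp_all

section \<open>The maps \<open>Psi\<close> and \<open>Phi\<close> between the two corings\<close>

lemma balanced_Psi:
  assumes "u \<in> carrier M" "v' \<in> carrier D"
  shows "balanced B D M W.T (\<lambda>u' v. W.tt (dyad u u') (dyad v v'))"
  by (rule balancedI) (use assms in simp_all)

text \<open>When \<open>u\<close> and \<open>v'\<close> vary as well, this is the isomorphism from
  \<open>M \<otimes>\<^sub>A C \<otimes>\<^sub>A D\<close> to \<open>S \<otimes>\<^sub>B S\<close>.
  Keeping them as parameters avoids elements of iterated tensor products.\<close>

definition Psi where "Psi u c v' = tlift C.T W.T (\<lambda>u' v. W.tt (dyad u u') (dyad v v')) c"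

lemma Psi_simps [simp]:
  assumes u: "u \<in> carrier M" and v': "v' \<in> carrier D"
  shows "c \<in> carrier C.T \<Longrightarrow> Psi u c v' \<in> carrier W.T"
    and "\<lbrakk>c \<in> carrier C.T; d \<in> carrier C.T\<rbrakk> \<Longrightarrow> Psi u (c \<oplus>\<^bsub>C.T\<^esub> d) v' = Psi u c v' \<oplus>\<^bsub>W.T\<^esub> Psi u d v'"
    and "\<lbrakk>u' \<in> carrier D; v \<in> carrier M\<rbrakk> \<Longrightarrow> Psi u (C.tt u' v) v' = W.tt (dyad u u') (dyad v v')"
  unfolding Psi_def
  by (rule C.tlift_closed C.tlift_add C.tlift_tens; (rule W.T.abelian_group_axioms balanced_Psi[OF u v'])?; assumption)+

lemma Psi_add_left [simp]:
  assumes "c \<in> carrier C.T" "u \<in> carrier M" "w \<in> carrier M" "v' \<in> carrier D"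
  shows "Psi (u \<oplus>\<^bsub>M\<^esub> w) c v' = Psi u c v' \<oplus>\<^bsub>W.T\<^esub> Psi w c v'"
  using assms(1) by (induction rule: C.induct) (use assms in \<open>simp_all add: W.T.a_ac\<close>)

lemma Psi_add_right [simp]:
  assumes "c \<in> carrier C.T" "u \<in> carrier M" "w' \<in> carrier D" "v' \<in> carrier D"
  shows "Psi u c (v' \<oplus>\<^bsub>D\<^esub> w') = Psi u c v' \<oplus>\<^bsub>W.T\<^esub> Psi u c w'"
  using assms(1) by (induction rule: C.induct) (use assms in \<open>simp_all add: W.T.a_ac\<close>)

lemma Psi_lact [simp]:
  assumes "c \<in> carrier C.T" "u \<in> carrier M" "v' \<in> carrier D" "a \<in> carrier A"
  shows "Psi u (a \<triangleright>\<^bsub>C.T\<^esub> c) v' = Psi (u \<triangleleft>\<^bsub>M\<^esub> a) c v'"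
  using assms(1) by (induction rule: C.induct) (use assms in simp_all)

lemma Psi_ract [simp]:
  assumes "c \<in> carrier C.T" "u \<in> carrier M" "v' \<in> carrier D" "a \<in> carrier A"
  shows "Psi u (c \<triangleleft>\<^bsub>C.T\<^esub> a) v' = Psi u c (a \<triangleright>\<^bsub>D\<^esub> v')"
  using assms(1) by (induction rule: C.induct) (use assms in simp_all)

text \<open>\<open>S\<close> acts through the outer arguments of \<open>Psi\<close>, an endomorphism
  of \<open>C\<close> through the middle one. This separation makes \<open>hat\<close> linear over
  \<open>S\<close> on both sides.\<close>

lemma Psi_left:
  assumes "c \<in> carrier C.T" "u \<in> carrier M" "v' \<in> carrier D" "s \<in> carrier S"
  shows "Psi (s u) c v' = s \<triangleright>\<^bsub>W.T\<^esub> Psi u c v'"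
  using assms(1) by (induction rule: C.induct) (use assms in simp_all)

lemma Psi_right:
  assumes "c \<in> carrier C.T" "u \<in> carrier M" "v' \<in> carrier D" "s \<in> carrier S"
  shows "Psi u c (v' \<star> s) = Psi u c v' \<triangleleft>\<^bsub>W.T\<^esub> s"
  using assms(1) by (induction rule: C.induct) (use assms in simp_all)

lemma balanced_Phi:
  assumes "w \<in> carrier D" "x \<in> carrier M"
  shows "balanced B (SB S \<phi>) (BS S \<phi>) C.T (\<lambda>s s'. C.tt (w \<star> s) (s' x))"
  by (rule balancedI) (use assms in simp_all)

text \<open>This is the identification of \<open>D \<otimes>\<^sub>S (S \<otimes>\<^sub>B S)
  \<otimes>\<^sub>S M\<close> with \<open>D \<otimes>\<^sub>B M\<close>, the outer factors
  \<open>w\<close> and \<open>x\<close> being held fixed.\<close>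

definition Phi where "Phi w x z = tlift W.T C.T (\<lambda>s s'. C.tt (w \<star> s) (s' x)) z"

lemma Phi_simps [simp]:
  assumes w: "w \<in> carrier D" and x: "x \<in> carrier M"
  shows "z \<in> carrier W.T \<Longrightarrow> Phi w x z \<in> carrier C.T"
    and "\<lbrakk>z \<in> carrier W.T; z' \<in> carrier W.T\<rbrakk> \<Longrightarrow> Phi w x (z \<oplus>\<^bsub>W.T\<^esub> z') = Phi w x z \<oplus>\<^bsub>C.T\<^esub> Phi w x z'"
    and "\<lbrakk>s \<in> carrier S; s' \<in> carrier S\<rbrakk> \<Longrightarrow> Phi w x (W.tt s s') = C.tt (w \<star> s) (s' x)"
  unfolding Phi_def
  by ((rule W.tlift_closed W.tlift_add; (rule C.T.abelian_group_axioms balanced_Phi[OF w x])?; assumption)+,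
    subst W.tlift_tens[OF C.T.abelian_group_axioms balanced_Phi[OF w x]], simp_all)

text \<open>The outer factors meet in the evaluations \<open>w u\<close> and \<open>v' x\<close>,
  both in \<open>A\<close>. What remains around \<open>c\<close> is a scalar action with which every
  \<open>A\<close>-bilinear map commutes.\<close>

lemma Phi_Psi [simp]:
  assumes "c \<in> carrier C.T" "u \<in> carrier M" "v' \<in> carrier D" "w \<in> carrier D" "x \<in> carrier M"
  shows "Phi w x (Psi u c v') = (w u \<triangleright>\<^bsub>C.T\<^esub> c) \<triangleleft>\<^bsub>C.T\<^esub> v' x"
  using assms(1) by (induction rule: C.induct) (use assms in simp_all)

section \<open>The isomorphism \<open>\<xi>\<close>\<close>

lemma balanced_xi: "balanced A M D S dyad"
  by (rule balancedI) simp_all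

lemma xi_eq: "xi A M = tlift E.T S dyad"
  by (simp add: xi_def dyad_def[abs_def])

lemma xi_simps [simp]:
  shows "z \<in> carrier E.T \<Longrightarrow> xi A M z \<in> carrier S"
    and "\<lbrakk>z \<in> carrier E.T; z' \<in> carrier E.T\<rbrakk> \<Longrightarrow> xi A M (z \<oplus>\<^bsub>E.T\<^esub> z') = xi A M z \<oplus>\<^bsub>S\<^esub> xi A M z'"
    and "\<lbrakk>u \<in> carrier M; v \<in> carrier D\<rbrakk> \<Longrightarrow> xi A M (E.tt u v) = dyad u v"
  unfolding xi_eq
  by (rule E.tlift_closed E.tlift_add E.tlift_tens; (rule S.abelian_group_axioms balanced_xi)?; assumption)+

lemma xi_bij: "bij_betw (xi A M) (carrier E.T) (carrier S)"
proof -
  \<comment> \<open>The explicit inverse of \<open>\<xi>\<close>. One composite is the identity by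
    \<open>S_expand\<close>; for the other, the scalar \<open>v (e i)\<close> crosses the tensor
    sign and \<open>D_expand\<close> applies.\<close>
  define zeta where "zeta s = (\<Oplus>\<^bsub>E.T\<^esub>i\<in>J. E.tt (s (e i)) (e' i))" for s
  have zeta_closed: "zeta s \<in> carrier E.T" if "s \<in> carrier S" for s
    unfolding zeta_def using that by (intro E.T.finsum_closed) (simp add: Pi_iff)
  have 1: "xi A M (zeta s) = s" if "s \<in> carrier S" for s
  proof -
    have "xi A M (zeta s) = (\<Oplus>\<^bsub>S\<^esub>i\<in>J. xi A M (E.tt (s (e i)) (e' i)))"
      unfolding zeta_def using that
      by (intro additive_map_finsum E.T.abelian_group_axioms S.abelian_group_axioms)
        (auto intro: additive_mapI)
    also have "\<dots> = (\<Oplus>\<^bsub>S\<^esub>i\<in>J. dyad (s (e i)) (e' i))"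
      using that by (intro S.finsum_cong') auto
    finally show ?thesis using S_expand[OF that] by simp
  qed
  have 2: "zeta (xi A M z) = z" if "z \<in> carrier E.T" for z
    using that
  proof (induction rule: E.induct)
    case (tens u v)
    have "zeta (dyad u v) = (\<Oplus>\<^bsub>E.T\<^esub>i\<in>J. E.tt u (v (e i) \<triangleright>\<^bsub>D\<^esub> e' i))"
      unfolding zeta_def using tens by (intro E.T.finsum_cong') auto
    also have "\<dots> = E.tt u (\<Oplus>\<^bsub>D\<^esub>i\<in>J. v (e i) \<triangleright>\<^bsub>D\<^esub> e' i)"
      using tens by (intro E.tens_finsum_right[symmetric]) auto
    finally show ?case using tens by (simp add: D_expand)
  next
    case (add z z')
    have "zeta (xi A M z \<oplus>\<^bsub>S\<^esub> xi A M z') =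
      (\<Oplus>\<^bsub>E.T\<^esub>i\<in>J. E.tt (xi A M z (e i)) (e' i) \<oplus>\<^bsub>E.T\<^esub> E.tt (xi A M z' (e i)) (e' i))"
      unfolding zeta_def using add by (intro E.T.finsum_cong') auto
    also have "\<dots> = zeta (xi A M z) \<oplus>\<^bsub>E.T\<^esub> zeta (xi A M z')"
      unfolding zeta_def using add by (intro E.T.finsum_addf) auto
    finally show ?case using add by simp
  qed
  show ?thesis
    by (rule bij_betw_byWitness[of _ zeta]) (auto simp: 1 2 zeta_closed)
qed

lemma S_induct [consumes 1, case_names dyad add]:
  assumes "s \<in> carrier S"
    and "\<And>u v. \<lbrakk>u \<in> carrier M; v \<in> carrier D\<rbrakk> \<Longrightarrow> P (dyad u v)"
    and "\<And>s t. \<lbrakk>s \<in> carrier S; t \<in> carrier S; P s; P t\<rbrakk> \<Longrightarrow> P (s \<oplus>\<^bsub>S\<^esub> t)"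
  shows "P s"
proof -
  have "P (xi A M z)" if "z \<in> carrier E.T" for z
    using that by (induction rule: E.induct) (simp_all add: assms(2,3))
  moreover obtain z where "z \<in> carrier E.T" "s = xi A M z"
    using assms(1) xi_bij by (auto simp: bij_betw_def)
  ultimately show ?thesis by simp
qed

text \<open>Dyads span \<open>S\<close>, hence tensors of two dyads span
  \<open>S \<otimes>\<^sub>B S\<close>. The generators are nevertheless taken as
  \<open>Psi u c v\<close> with arbitrary \<open>c\<close>, the form on which \<open>hat\<close>
  acts through \<open>c\<close> alone.\<close>

lemma W_induct [consumes 1, case_names Psi add]:
  assumes "z \<in> carrier W.T"
    and Psi: "\<And>u c v. \<lbrakk>u \<in> carrier M; c \<in> carrier C.T; v \<in> carrier D\<rbrakk> \<Longrightarrow> P (Psi u c v)"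
    and add: "\<And>z z'. \<lbrakk>z \<in> carrier W.T; z' \<in> carrier W.T; P z; P z'\<rbrakk> \<Longrightarrow> P (z \<oplus>\<^bsub>W.T\<^esub> z')"
  shows "P z"
  using assms(1)
proof (induction rule: W.induct)
  case (tens s s')
  then have s: "s \<in> carrier S" and s': "s' \<in> carrier S" by simp_all
  have dyad: "P (W.tt (dyad u u') (dyad v v'))"
    if "u \<in> carrier M" "u' \<in> carrier D" "v \<in> carrier M" "v' \<in> carrier D" for u u' v v'
    using Psi[of u "C.tt u' v" v'] that by simp
  from s show ?case
  proof (induction rule: S_induct)
    case (dyad u u')
    from s' show ?case
      by (induction rule: S_induct) (use dyad in \<open>simp_all add: \<open>\<And>u u' v v'. _ \<Longrightarrow> _ \<Longrightarrow> _ \<Longrightarrow> _ \<Longrightarrow> P (W.tt (dyad u u') (dyad v v'))\<close> add\<close>)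
  qed (use s' in \<open>simp add: add\<close>)
qed (rule add)

abbreviation "xi_inv \<equiv> inv_into (carrier E.T) (xi A M)"

lemma xi_xi_inv [simp]: "s \<in> carrier S \<Longrightarrow> xi A M (xi_inv s) = s"
  using xi_bij by (simp add: bij_betw_def f_inv_into_f)

lemma xi_inv_xi [simp]: "z \<in> carrier E.T \<Longrightarrow> xi_inv (xi A M z) = z"
  using xi_bij by (simp add: bij_betw_def inv_into_f_f)

lemma xi_inv_eqI: "\<lbrakk>z \<in> carrier E.T; s = xi A M z\<rbrakk> \<Longrightarrow> xi_inv s = z"
  by simp

lemma xi_inv_closed [simp]: "s \<in> carrier S \<Longrightarrow> xi_inv s \<in> carrier E.T"
  using xi_bij by (simp add: bij_betw_def inv_into_into)

lemma xi_inv_dyad [simp]: "\<lbrakk>u \<in> carrier M; v \<in> carrier D\<rbrakk> \<Longrightarrow> xi_inv (dyad u v) = E.tt u v"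
  by (rule xi_inv_eqI) simp_all

lemma xi_lact: "\<lbrakk>z \<in> carrier E.T; b \<in> carrier B\<rbrakk> \<Longrightarrow> xi A M (b \<triangleright>\<^bsub>E.T\<^esub> z) = \<phi> b \<otimes>\<^bsub>S\<^esub> xi A M z"
  by (induction rule: E.induct) (simp_all add: S.r_distr)

lemma xi_ract: "\<lbrakk>z \<in> carrier E.T; b \<in> carrier B\<rbrakk> \<Longrightarrow> xi A M (z \<triangleleft>\<^bsub>E.T\<^esub> b) = xi A M z \<otimes>\<^bsub>S\<^esub> \<phi> b"
  by (induction rule: E.induct) (simp_all add: S.l_distr)

lemma xi_linear:
  "left_linear B E.T (BS S \<phi>) (xi A M)" "right_linear B E.T (SB S \<phi>) (xi A M)"
  by (rule left_linearI right_linearI; simp add: xi_lact xi_ract)+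

lemma xi_inv_linear:
  "left_linear B (BS S \<phi>) E.T xi_inv" "right_linear B (SB S \<phi>) E.T xi_inv"
  by (rule left_linearI right_linearI; (simp; fail)?; rule xi_inv_eqI; simp add: xi_lact xi_ract)+

sublocale xi_xi: tensor_map B B B E.T E.T S S "SB S \<phi>" "BS S \<phi>" "xi A M" "xi A M"
  by unfold_locales (rule xi_linear)+

sublocale xi_inv2: tensor_map S B S "SB S \<phi>" "BS S \<phi>" B B E.T E.T xi_inv xi_inv
  by unfold_locales (rule xi_inv_linear)+

lemma xi_inv2_tens [simp]:
  "\<lbrakk>s \<in> carrier S; s' \<in> carrier S\<rbrakk> \<Longrightarrow> xi_inv2.F (W.tt s s') = X.tt (xi_inv s) (xi_inv s')"
  using xi_inv2.tmap_tens[of s s'] by simp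

section \<open>Regrouping of the four tensor factors\<close>

context
  fixes u u' assumes u: "u \<in> carrier M" "u' \<in> carrier D"
begin

text \<open>\<open>rebracket\<close> consists of three nested lifts, so balancedness is established
  from the inside out: in \<open>(v, v')\<close> for fixed \<open>u\<close> and \<open>u'\<close>,
  next in \<open>(u, u')\<close>, last in the pair \<open>(p, q)\<close>. The same pattern serves
  \<open>unbracket\<close>.\<close>

lemma balanced_rebracket1: "balanced A M D Y.T (\<lambda>v v'. Y.tt (MC.tt u (C.tt u' v)) v')"
  by (rule balancedI) (use u in \<open>simp_all flip: Y.tens_balanced\<close>)

lemmas rebracket1_simps [simp] = E.tlift_closed[OF Y.T.abelian_group_axioms balanced_rebracket1]
  E.tlift_add[OF Y.T.abelian_group_axioms balanced_rebracket1]
  E.tlift_tens[OF Y.T.abelian_group_axioms balanced_rebracket1]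

end

abbreviation (input) "rebracket1 u u' q \<equiv> tlift E.T Y.T (\<lambda>v v'. Y.tt (MC.tt u (C.tt u' v)) v') q"

lemma balanced_rebracket2:
  assumes "q \<in> carrier E.T"
  shows "balanced A M D Y.T (\<lambda>u u'. rebracket1 u u' q)"
  by (rule balancedI; use assms in \<open>induction rule: E.induct\<close>)
    (simp_all add: Y.T.a_ac)

lemmas rebracket2_simps [simp] = E.tlift_closed[OF Y.T.abelian_group_axioms balanced_rebracket2]
  E.tlift_add[OF Y.T.abelian_group_axioms balanced_rebracket2]
  E.tlift_tens[OF Y.T.abelian_group_axioms balanced_rebracket2]

abbreviation (input) "rebracket2 p q \<equiv> tlift E.T Y.T (\<lambda>u u'. rebracket1 u u' q) p"

lemma balanced_rebracket: "balanced B E.T E.T Y.T rebracket2"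
proof (rule balancedI)
  fix p q q' assume p: "p \<in> carrier E.T" and q: "q \<in> carrier E.T" "q' \<in> carrier E.T"
  show "rebracket2 p (q \<oplus>\<^bsub>E.T\<^esub> q') = rebracket2 p q \<oplus>\<^bsub>Y.T\<^esub> rebracket2 p q'"
    using p by (induction rule: E.induct) (use q in \<open>simp_all add: Y.T.a_ac\<close>)
next
  fix p b q assume p: "p \<in> carrier E.T" and b: "b \<in> carrier B" and q: "q \<in> carrier E.T"
  from p show "rebracket2 (p \<triangleleft>\<^bsub>E.T\<^esub> b) q = rebracket2 p (b \<triangleright>\<^bsub>E.T\<^esub> q)"
  proof (induction rule: E.induct)
    case (tens u u')
    from q show ?case by (induction rule: E.induct) (use tens b in simp_all)
  qed (use b q in simp_all)
qed simp_all

lemma rebracket_simps [simp]: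
  shows "z \<in> carrier X.T \<Longrightarrow> rebracket A B M D z \<in> carrier Y.T"
    and "\<lbrakk>z \<in> carrier X.T; z' \<in> carrier X.T\<rbrakk> \<Longrightarrow>
      rebracket A B M D (z \<oplus>\<^bsub>X.T\<^esub> z') = rebracket A B M D z \<oplus>\<^bsub>Y.T\<^esub> rebracket A B M D z'"
    and "\<lbrakk>u \<in> carrier M; u' \<in> carrier D; v \<in> carrier M; v' \<in> carrier D\<rbrakk> \<Longrightarrow>
      rebracket A B M D (X.tt (E.tt u u') (E.tt v v')) = Y.tt (MC.tt u (C.tt u' v)) v'"
  unfolding rebracket_def Let_def
  by ((rule X.tlift_closed X.tlift_add; (rule Y.T.abelian_group_axioms balanced_rebracket)?; assumption)+,
    subst X.tlift_tens[OF Y.T.abelian_group_axioms balanced_rebracket], simp_all)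

lemma X_balanced_tens [simp]:
  assumes "u \<in> carrier M" "u' \<in> carrier D" "b \<in> carrier B" "z \<in> carrier E.T"
  shows "X.tt (E.tt u (u' \<triangleleft>\<^bsub>D\<^esub> b)) z = X.tt (E.tt u u') (b \<triangleright>\<^bsub>E.T\<^esub> z)"
  using X.tens_balanced[of "E.tt u u'" b z] assms by simp

context
  fixes u v' assumes u: "u \<in> carrier M" "v' \<in> carrier D"
begin

lemma balanced_unbracket1: "balanced B D M X.T (\<lambda>u' v. X.tt (E.tt u u') (E.tt v v'))"
  by (rule balancedI) (use u in simp_all)

lemmas unbracket1_simps [simp] = C.tlift_closed[OF X.T.abelian_group_axioms balanced_unbracket1]
  C.tlift_add[OF X.T.abelian_group_axioms balanced_unbracket1]
  C.tlift_tens[OF X.T.abelian_group_axioms balanced_unbracket1]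

end

abbreviation (input) "unbracket1 v' u c \<equiv> tlift C.T X.T (\<lambda>u' v. X.tt (E.tt u u') (E.tt v v')) c"

lemma balanced_unbracket2:
  assumes "v' \<in> carrier D"
  shows "balanced A M C.T X.T (unbracket1 v')"
proof (rule balancedI)
  fix u w c assume "u \<in> carrier M" "w \<in> carrier M" "c \<in> carrier C.T"
  from this(3,1,2) show "unbracket1 v' (u \<oplus>\<^bsub>M\<^esub> w) c = unbracket1 v' u c \<oplus>\<^bsub>X.T\<^esub> unbracket1 v' w c"
    by (induction rule: C.induct) (use assms in \<open>simp_all add: X.T.a_ac\<close>)
next
  fix u a c assume "u \<in> carrier M" "a \<in> carrier A" "c \<in> carrier C.T"
  from this(3,1,2) show "unbracket1 v' (u \<triangleleft>\<^bsub>M\<^esub> a) c = unbracket1 v' u (a \<triangleright>\<^bsub>C.T\<^esub> c)"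
    by (induction rule: C.induct) (use assms in simp_all)
qed (use assms in simp_all)

lemmas unbracket2_simps [simp] = MC.tlift_closed[OF X.T.abelian_group_axioms balanced_unbracket2]
  MC.tlift_add[OF X.T.abelian_group_axioms balanced_unbracket2]
  MC.tlift_tens[OF X.T.abelian_group_axioms balanced_unbracket2]

abbreviation (input) "unbracket2 p v' \<equiv> tlift MC.T X.T (unbracket1 v') p"

lemma balanced_unbracket: "balanced A MC.T D X.T unbracket2"
proof (rule balancedI)
  fix p v w assume p: "p \<in> carrier MC.T" and v: "v \<in> carrier D" "w \<in> carrier D"
  from p show "unbracket2 p (v \<oplus>\<^bsub>D\<^esub> w) = unbracket2 p v \<oplus>\<^bsub>X.T\<^esub> unbracket2 p w"
  proof (induction rule: MC.induct)
    case (tens u c)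
    from tens(2) show ?case
      by (induction rule: C.induct) (use tens v in \<open>simp_all add: X.T.a_ac\<close>)
  qed (use v in \<open>simp_all add: X.T.a_ac\<close>)
next
  fix p a v assume p: "p \<in> carrier MC.T" and v: "v \<in> carrier D" "a \<in> carrier A"
  from p show "unbracket2 (p \<triangleleft>\<^bsub>MC.T\<^esub> a) v = unbracket2 p (a \<triangleright>\<^bsub>D\<^esub> v)"
  proof (induction rule: MC.induct)
    case (tens u c)
    from tens(2) show ?case
      by (induction rule: C.induct) (use tens v in \<open>simp_all flip: E.tens_balanced\<close>)
  qed (use v in simp_all)
qed simp_all

lemma unbracket_simps [simp]:
  shows "z \<in> carrier Y.T \<Longrightarrow> unbracket A B M D z \<in> carrier X.T"
    and "\<lbrakk>z \<in> carrier Y.T; z' \<in> carrier Y.T\<rbrakk> \<Longrightarrow>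
      unbracket A B M D (z \<oplus>\<^bsub>Y.T\<^esub> z') = unbracket A B M D z \<oplus>\<^bsub>X.T\<^esub> unbracket A B M D z'"
    and "\<lbrakk>u \<in> carrier M; c \<in> carrier C.T; v' \<in> carrier D\<rbrakk> \<Longrightarrow>
      unbracket A B M D (Y.tt (MC.tt u c) v') = unbracket1 v' u c"
  unfolding unbracket_def Let_def
  by ((rule Y.tlift_closed Y.tlift_add; (rule X.T.abelian_group_axioms balanced_unbracket)?; assumption)+,
    subst Y.tlift_tens[OF X.T.abelian_group_axioms balanced_unbracket], simp_all)

text \<open>This identifies \<open>Psi\<close> with the outgoing half of \<open>hat\<close>,
  regrouping followed by \<open>\<xi> \<otimes> \<xi>\<close>.\<close>

lemma xi_unbracket1:
  assumes "c \<in> carrier C.T" "u \<in> carrier M" "v' \<in> carrier D"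
  shows "xi_xi.F (unbracket1 v' u c) = Psi u c v'"
  using assms(1) by (induction rule: C.induct) (use assms(2,3) in simp_all)

section \<open>The behaviour of \<open>hat\<close> along \<open>Psi\<close> and
  \<open>Phi\<close>\<close>

lemma hat_extensional: "hat A B M g \<in> extensional (carrier W.T)"
  by (simp add: hat_def Let_def)

text \<open>On \<open>dyad u u' \<otimes> dyad v v'\<close> the incoming half of \<open>hat\<close>
  isolates \<open>u' \<otimes> v\<close> as the middle factor, where \<open>g\<close> acts; the
  outgoing half is \<open>Psi\<close> again. Together with extensionality these rules determine
  \<open>hat\<close>, and the regrouping maps do not reappear.\<close>

lemma hat_facts:
  assumes g: "left_linear A C.T C.T g" "right_linear A C.T C.T g"
  shows hat_closed: "z \<in> carrier W.T \<Longrightarrow> hat A B M g z \<in> carrier W.T"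
    and hat_add: "\<lbrakk>z \<in> carrier W.T; z' \<in> carrier W.T\<rbrakk> \<Longrightarrow>
      hat A B M g (z \<oplus>\<^bsub>W.T\<^esub> z') = hat A B M g z \<oplus>\<^bsub>W.T\<^esub> hat A B M g z'"
    and hat_Psi: "\<lbrakk>u \<in> carrier M; c \<in> carrier C.T; v' \<in> carrier D\<rbrakk> \<Longrightarrow>
      hat A B M g (Psi u c v') = Psi u (g c) v'"
proof -
  interpret g1: tensor_map B A A M C.T B A M C.T "\<lambda>u. u" g
    by unfold_locales (auto intro: g right_linearI)
  interpret g2: tensor_map B A B MC.T D B B MC.T D g1.F "\<lambda>u. u"
    by unfold_locales
      (auto intro: left_linearI intro!: tmap_right_linear[OF g1.tensor_map_axioms g(2)])
  have hat: "hat A B M g z = xi_xi.F (unbracket A B M D (g2.F (rebracket A B M D (xi_inv2.F z))))"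
    if "z \<in> carrier W.T" for z
    using that by (simp add: hat_def Let_def)
  show cl: "z \<in> carrier W.T \<Longrightarrow> hat A B M g z \<in> carrier W.T" for z
    by (simp add: hat)
  show add: "\<lbrakk>z \<in> carrier W.T; z' \<in> carrier W.T\<rbrakk> \<Longrightarrow>
      hat A B M g (z \<oplus>\<^bsub>W.T\<^esub> z') = hat A B M g z \<oplus>\<^bsub>W.T\<^esub> hat A B M g z'" for z z'
    by (simp add: hat)
  note gl = left_linearD(1,2)[OF g(1)]
  assume u: "u \<in> carrier M" "v' \<in> carrier D" and c: "c \<in> carrier C.T"
  from c show "hat A B M g (Psi u c v') = Psi u (g c) v'"
    by (induction rule: C.induct) (use u in \<open>simp_all add: add gl\<close>, simp add: hat gl xi_unbracket1)
qed

text \<open>On a generator \<open>Psi u c v'\<close> both sides are \<open>g c\<close> with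
  \<open>w u\<close> acting from the left and \<open>v' x\<close> from the right, by
  \<open>Phi_Psi\<close> and \<open>A\<close>-bilinearity of \<open>g\<close>.\<close>

lemma hat_Phi:
  assumes g: "left_linear A C.T C.T g" "right_linear A C.T C.T g"
    and z: "z \<in> carrier W.T" and w: "w \<in> carrier D" "x \<in> carrier M"
  shows "Phi w x (hat A B M g z) = g (Phi w x z)"
  using z
  by (induction rule: W_induct)
    (use w in \<open>simp_all add: hat_facts[OF g] left_linearD[OF g(1)] right_linearD[OF g(2)]\<close>)

end

section \<open>Sums in abelian groups\<close>

lemma finsum_eqI:
  assumes "abelian_group G" "\<And>i. i \<in> J \<Longrightarrow> g i \<in> carrier G" "\<And>i. i \<in> J \<Longrightarrow> f i = g i"
  shows "(\<Oplus>\<^bsub>G\<^esub>i\<in>J. f i) = (\<Oplus>\<^bsub>G\<^esub>i\<in>J. g i)"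
proof -
  interpret abelian_group G by fact
  show ?thesis using assms(2,3) by (intro finsum_cong') auto
qed

lemma finsum_addI:
  assumes "abelian_group G" "\<And>i. i \<in> J \<Longrightarrow> g i \<in> carrier G" "\<And>i. i \<in> J \<Longrightarrow> h i \<in> carrier G"
    and "\<And>i. i \<in> J \<Longrightarrow> f i = g i \<oplus>\<^bsub>G\<^esub> h i"
  shows "(\<Oplus>\<^bsub>G\<^esub>i\<in>J. f i) = (\<Oplus>\<^bsub>G\<^esub>i\<in>J. g i) \<oplus>\<^bsub>G\<^esub> (\<Oplus>\<^bsub>G\<^esub>i\<in>J. h i)"
proof -
  interpret abelian_group G by fact
  have "(\<Oplus>\<^bsub>G\<^esub>i\<in>J. f i) = (\<Oplus>\<^bsub>G\<^esub>i\<in>J. g i \<oplus>\<^bsub>G\<^esub> h i)"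
    using assms by (intro finsum_eqI) auto
  then show ?thesis using assms(2,3) by (simp add: Pi_iff finsum_addf)
qed

lemma finsum_closedI:
  assumes "abelian_group G" "\<And>i. i \<in> J \<Longrightarrow> g i \<in> carrier G"
  shows "(\<Oplus>\<^bsub>G\<^esub>i\<in>J. g i) \<in> carrier G"
proof -
  interpret abelian_group G by fact
  show ?thesis using assms(2) by (intro finsum_closed) auto
qed

section \<open>The dual basis element and its commutation with \<open>S\<close>\<close>

context comatrix_setting
begin

lemma one_expand: "(\<Oplus>\<^bsub>S\<^esub>i\<in>J. dyad (e i) (e' i)) = \<one>\<^bsub>S\<^esub>"
proof -
  have "(\<Oplus>\<^bsub>S\<^esub>i\<in>J. dyad (e i) (e' i)) = (\<Oplus>\<^bsub>S\<^esub>i\<in>J. dyad (\<one>\<^bsub>S\<^esub> (e i)) (e' i))"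
    by (rule finsum_eqI) (simp_all add: S.abelian_group_axioms)
  then show ?thesis by (simp add: S_expand)
qed

text \<open>Both sides are the image of the same element of \<open>M \<otimes> D\<close>, because \<open>\<xi>\<close> is injective.\<close>

lemma basis_shift:
  assumes P: "abelian_group P" and \<beta>: "balanced A M D P \<beta>" and x: "x \<in> carrier S"
  shows "(\<Oplus>\<^bsub>P\<^esub>i\<in>J. \<beta> (x (e i)) (e' i)) = (\<Oplus>\<^bsub>P\<^esub>i\<in>J. \<beta> (e i) (e' i \<star> x))"
proof -
  have add: "additive_map E.T S (xi A M)" by (rule additive_mapI) simp_all
  let ?l = "\<Oplus>\<^bsub>E.T\<^esub>i\<in>J. E.tt (x (e i)) (e' i)"
  let ?r = "\<Oplus>\<^bsub>E.T\<^esub>i\<in>J. E.tt (e i) (e' i \<star> x)"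
  have \<beta>_closed: "\<beta> m d \<in> carrier P" if "m \<in> carrier M" "d \<in> carrier D" for m d
    using \<beta> that by (simp add: balanced_def)
  have cl: "?l \<in> carrier E.T" "?r \<in> carrier E.T"
    using x by (auto intro!: finsum_closedI E.T.abelian_group_axioms)
  have "xi A M ?l = (\<Oplus>\<^bsub>S\<^esub>i\<in>J. xi A M (E.tt (x (e i)) (e' i)))"
    using x by (intro additive_map_finsum add S.abelian_group_axioms E.T.abelian_group_axioms) auto
  also have "\<dots> = (\<Oplus>\<^bsub>S\<^esub>i\<in>J. dyad (x (e i)) (e' i))"
    using x by (intro finsum_eqI S.abelian_group_axioms) auto
  finally have 1: "xi A M ?l = x" using x by (simp add: S_expand)
  have "xi A M ?r = (\<Oplus>\<^bsub>S\<^esub>i\<in>J. xi A M (E.tt (e i) (e' i \<star> x)))"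
    using x by (intro additive_map_finsum add S.abelian_group_axioms E.T.abelian_group_axioms) auto
  also have "\<dots> = (\<Oplus>\<^bsub>S\<^esub>i\<in>J. dyad (e i) (e' i) \<otimes>\<^bsub>S\<^esub> x)"
    using x by (intro finsum_eqI S.abelian_group_axioms) auto
  also have "\<dots> = (\<Oplus>\<^bsub>S\<^esub>i\<in>J. dyad (e i) (e' i)) \<otimes>\<^bsub>S\<^esub> x"
    using x by (intro additive_map_finsum[symmetric, where f = "\<lambda>y. y \<otimes>\<^bsub>S\<^esub> x"] S.abelian_group_axioms)
      (auto intro!: additive_mapI simp: S.l_distr)
  finally have "xi A M ?r = x" using x by (simp add: one_expand)
  with 1 have "xi A M ?l = xi A M ?r" by simp
  then have "?l = ?r" by (rule inj_onD[OF bij_betw_imp_inj_on[OF xi_bij] _ cl])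
  then have "tlift E.T P \<beta> ?l = tlift E.T P \<beta> ?r" by simp
  moreover have "tlift E.T P \<beta> ?l = (\<Oplus>\<^bsub>P\<^esub>i\<in>J. tlift E.T P \<beta> (E.tt (x (e i)) (e' i)))"
    using x by (intro additive_map_finsum P E.T.abelian_group_axioms E.tlift_additive \<beta>) auto
  moreover have "tlift E.T P \<beta> ?r = (\<Oplus>\<^bsub>P\<^esub>i\<in>J. tlift E.T P \<beta> (E.tt (e i) (e' i \<star> x)))"
    using x by (intro additive_map_finsum P E.T.abelian_group_axioms E.tlift_additive \<beta>) auto
  moreover have "(\<Oplus>\<^bsub>P\<^esub>i\<in>J. tlift E.T P \<beta> (E.tt (x (e i)) (e' i))) = (\<Oplus>\<^bsub>P\<^esub>i\<in>J. \<beta> (x (e i)) (e' i))"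
    using x by (intro finsum_eqI P) (simp_all add: E.tlift_tens[OF P \<beta>] \<beta>_closed)
  moreover have "(\<Oplus>\<^bsub>P\<^esub>i\<in>J. tlift E.T P \<beta> (E.tt (e i) (e' i \<star> x))) = (\<Oplus>\<^bsub>P\<^esub>i\<in>J. \<beta> (e i) (e' i \<star> x))"
    using x by (intro finsum_eqI P) (simp_all add: E.tlift_tens[OF P \<beta>] \<beta>_closed)
  ultimately show ?thesis by simp
qed

section \<open>The two corings as extensions of tensor products\<close>

abbreviation "CO \<equiv> comatrix A B M J e e'"
abbreviation "WO \<equiv> sweedler B S \<phi>"

lemma CO_fields [simp]:
  "carrier CO = carrier C.T" "ring.add CO = ring.add C.T" "\<zero>\<^bsub>CO\<^esub> = \<zero>\<^bsub>C.T\<^esub>" "lact CO = lact C.T"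
  "ract CO = ract C.T"
  by (simp_all add: comatrix_def Let_def)

lemma WO_fields [simp]:
  "carrier WO = carrier W.T" "ring.add WO = ring.add W.T" "\<zero>\<^bsub>WO\<^esub> = \<zero>\<^bsub>W.T\<^esub>" "lact WO = lact W.T"
  "ract WO = ract W.T"
  by (simp_all add: sweedler_def Let_def)

text \<open>An equality of whole records is possible because the irrelevant multiplicative fields
  are \<open>undefined\<close> on both sides.\<close>

lemma truncate_CO: "bimod.truncate CO = C.T"
  by (rule bimod.equality) (simp_all add: bimod.defs, simp_all add: comatrix_def tensor_def Let_def)

lemma truncate_WO: "bimod.truncate WO = W.T"
  by (rule bimod.equality) (simp_all add: bimod.defs, simp_all add: sweedler_def tensor_def Let_def)

lemma tens_CO [simp]:
  "tens R CO N = tens R C.T N" "tens R N' CO = tens R N' C.T"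
  "tensor R CO N = tensor R C.T N" "tensor R N' CO = tensor R N' C.T"
  using tensor_truncate(1,3)[of R CO N] tensor_truncate(2,4)[of R N' CO] by (simp_all add: truncate_CO)

lemma tens_WO [simp]:
  "tens R WO N = tens R W.T N" "tens R N' WO = tens R N' W.T"
  "tensor R WO N = tensor R W.T N" "tensor R N' WO = tensor R N' W.T"
  using tensor_truncate(1,3)[of R WO N] tensor_truncate(2,4)[of R N' WO] by (simp_all add: truncate_WO)

lemma tmap_CO [simp]:
  "tmap A CO CO CO CO = tmap A C.T C.T C.T C.T" "tmap A M CO M CO = tmap A M C.T M C.T"
  by (simp_all add: tmap_def fun_eq_iff)

lemma tmap_WO [simp]:
  "tmap S WO WO WO WO = tmap S W.T W.T W.T W.T"
  "tmap S (regular S) WO (regular S) WO = tmap S (regular S) W.T (regular S) W.T"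
  by (simp_all add: tmap_def fun_eq_iff)

section \<open>Comultiplications and counits\<close>

lemma CC_balanced_tens [simp]:
  assumes "u' \<in> carrier D" "u \<in> carrier M" "a \<in> carrier A" "c \<in> carrier C.T"
  shows "CC.tt (C.tt u' (u \<triangleleft>\<^bsub>M\<^esub> a)) c = CC.tt (C.tt u' u) (a \<triangleright>\<^bsub>C.T\<^esub> c)"
  using CC.tens_balanced[of "C.tt u' u" a c] assms by simp

text \<open>Balancedness over \<open>B\<close> does not hold term by term: \<open>b\<close> has to
  pass from the left of the inserted dual basis element to its right, which is
  \<open>basis_shift\<close> at \<open>\<phi> b\<close>.\<close>

lemma balanced_comult_C:
  "balanced B D M CC.T (\<lambda>u' u. \<Oplus>\<^bsub>CC.T\<^esub>i\<in>J. CC.tt (C.tt u' (e i)) (C.tt (e' i) u))"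
proof (rule balancedI)
  fix u' b u assume u: "u' \<in> carrier D" "u \<in> carrier M" and b: "b \<in> carrier B"
  have "balanced A M D CC.T (\<lambda>m d. CC.tt (C.tt u' m) (C.tt d u))"
    by (rule balancedI) (use u in simp_all)
  from basis_shift[OF CC.T.abelian_group_axioms this phi_closed[OF b]]
  have shift: "(\<Oplus>\<^bsub>CC.T\<^esub>i\<in>J. CC.tt (C.tt u' (\<phi> b (e i))) (C.tt (e' i) u)) =
    (\<Oplus>\<^bsub>CC.T\<^esub>i\<in>J. CC.tt (C.tt u' (e i)) (C.tt (e' i \<star> \<phi> b) u))" .
  have "(\<Oplus>\<^bsub>CC.T\<^esub>i\<in>J. CC.tt (C.tt (u' \<triangleleft>\<^bsub>D\<^esub> b) (e i)) (C.tt (e' i) u)) =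
    (\<Oplus>\<^bsub>CC.T\<^esub>i\<in>J. CC.tt (C.tt u' (\<phi> b (e i))) (C.tt (e' i) u))"
    using u b by (intro finsum_eqI CC.T.abelian_group_axioms) auto
  also note shift
  also have "(\<Oplus>\<^bsub>CC.T\<^esub>i\<in>J. CC.tt (C.tt u' (e i)) (C.tt (e' i \<star> \<phi> b) u)) =
    (\<Oplus>\<^bsub>CC.T\<^esub>i\<in>J. CC.tt (C.tt u' (e i)) (C.tt (e' i) (b \<triangleright>\<^bsub>M\<^esub> u)))"
    using u b by (intro finsum_eqI CC.T.abelian_group_axioms) auto
  finally show "(\<Oplus>\<^bsub>CC.T\<^esub>i\<in>J. CC.tt (C.tt (u' \<triangleleft>\<^bsub>D\<^esub> b) (e i)) (C.tt (e' i) u)) =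
    (\<Oplus>\<^bsub>CC.T\<^esub>i\<in>J. CC.tt (C.tt u' (e i)) (C.tt (e' i) (b \<triangleright>\<^bsub>M\<^esub> u)))" .
qed (rule finsum_closedI finsum_addI; (rule CC.T.abelian_group_axioms)?; simp)+

lemma comult_C_simps [simp]:
  shows "c \<in> carrier C.T \<Longrightarrow> comult CO c \<in> carrier CC.T"
    and "\<lbrakk>c \<in> carrier C.T; d \<in> carrier C.T\<rbrakk> \<Longrightarrow> comult CO (c \<oplus>\<^bsub>C.T\<^esub> d) = comult CO c \<oplus>\<^bsub>CC.T\<^esub> comult CO d"
    and "\<lbrakk>u' \<in> carrier D; u \<in> carrier M\<rbrakk> \<Longrightarrow>
      comult CO (C.tt u' u) = (\<Oplus>\<^bsub>CC.T\<^esub>i\<in>J. CC.tt (C.tt u' (e i)) (C.tt (e' i) u))"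
proof -
  have eq: "comult CO = tlift C.T CC.T (\<lambda>u' u. \<Oplus>\<^bsub>CC.T\<^esub>i\<in>J. CC.tt (C.tt u' (e i)) (C.tt (e' i) u))"
    by (simp add: comatrix_def Let_def)
  note lift = CC.T.abelian_group_axioms balanced_comult_C
  show "c \<in> carrier C.T \<Longrightarrow> comult CO c \<in> carrier CC.T"
    and "\<lbrakk>c \<in> carrier C.T; d \<in> carrier C.T\<rbrakk> \<Longrightarrow> comult CO (c \<oplus>\<^bsub>C.T\<^esub> d) = comult CO c \<oplus>\<^bsub>CC.T\<^esub> comult CO d"
    and "\<lbrakk>u' \<in> carrier D; u \<in> carrier M\<rbrakk> \<Longrightarrow>
      comult CO (C.tt u' u) = (\<Oplus>\<^bsub>CC.T\<^esub>i\<in>J. CC.tt (C.tt u' (e i)) (C.tt (e' i) u))"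
    unfolding eq by (rule C.tlift_closed[OF lift] C.tlift_add[OF lift] C.tlift_tens[OF lift]; assumption)+
qed

lemma counit_C_simps [simp]:
  shows "c \<in> carrier C.T \<Longrightarrow> counit CO c \<in> carrier A"
    and "\<lbrakk>c \<in> carrier C.T; d \<in> carrier C.T\<rbrakk> \<Longrightarrow> counit CO (c \<oplus>\<^bsub>C.T\<^esub> d) = counit CO c \<oplus>\<^bsub>A\<^esub> counit CO d"
    and "\<lbrakk>u' \<in> carrier D; u \<in> carrier M\<rbrakk> \<Longrightarrow> counit CO (C.tt u' u) = u' u"
proof -
  have eq: "counit CO = tlift C.T A (\<lambda>u' u. u' u)" by (simp add: comatrix_def Let_def)
  have "balanced B D M A (\<lambda>u' u. u' u)" by (rule balancedI) simp_all
  note lift = M.S.abelian_group_axioms this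
  show "c \<in> carrier C.T \<Longrightarrow> counit CO c \<in> carrier A"
    and "\<lbrakk>c \<in> carrier C.T; d \<in> carrier C.T\<rbrakk> \<Longrightarrow> counit CO (c \<oplus>\<^bsub>C.T\<^esub> d) = counit CO c \<oplus>\<^bsub>A\<^esub> counit CO d"
    and "\<lbrakk>u' \<in> carrier D; u \<in> carrier M\<rbrakk> \<Longrightarrow> counit CO (C.tt u' u) = u' u"
    unfolding eq by (rule C.tlift_closed[OF lift] C.tlift_add[OF lift] C.tlift_tens[OF lift]; assumption)+
qed

text \<open>A right factor of the first component crosses \<open>\<otimes>\<^sub>S\<close>. For
  \<open>t = \<phi> b\<close> it then becomes
  \<open>\<phi> b \<otimes> s' = 1 \<otimes> \<phi> b s'\<close>, and this makes the Sweedler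
  comultiplication well defined over \<open>B\<close>.\<close>

lemma WW_shift:
  assumes "s \<in> carrier S" "t \<in> carrier S" "z \<in> carrier W.T"
  shows "WW.tt (W.tt s t) z = WW.tt (W.tt s \<one>\<^bsub>S\<^esub>) (t \<triangleright>\<^bsub>W.T\<^esub> z)"
  using WW.tens_balanced[of "W.tt s \<one>\<^bsub>S\<^esub>" t z] assms by simp

lemma W_one_phi: "\<lbrakk>b \<in> carrier B; s \<in> carrier S\<rbrakk> \<Longrightarrow> W.tt (\<phi> b) s = W.tt \<one>\<^bsub>S\<^esub> (\<phi> b \<otimes>\<^bsub>S\<^esub> s)"
  using W_balanced[of "\<one>\<^bsub>S\<^esub>" b s] by simp

lemma comult_W_simps [simp]:
  shows "c \<in> carrier W.T \<Longrightarrow> comult WO c \<in> carrier WW.T"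
    and "\<lbrakk>c \<in> carrier W.T; d \<in> carrier W.T\<rbrakk> \<Longrightarrow> comult WO (c \<oplus>\<^bsub>W.T\<^esub> d) = comult WO c \<oplus>\<^bsub>WW.T\<^esub> comult WO d"
    and "\<lbrakk>s \<in> carrier S; s' \<in> carrier S\<rbrakk> \<Longrightarrow>
      comult WO (W.tt s s') = WW.tt (W.tt s \<one>\<^bsub>S\<^esub>) (W.tt \<one>\<^bsub>S\<^esub> s')"
proof -
  have eq: "comult WO = tlift W.T WW.T (\<lambda>s s'. WW.tt (W.tt s \<one>\<^bsub>S\<^esub>) (W.tt \<one>\<^bsub>S\<^esub> s'))"
    by (simp add: sweedler_def Let_def)
  have "balanced B (SB S \<phi>) (BS S \<phi>) WW.T (\<lambda>s s'. WW.tt (W.tt s \<one>\<^bsub>S\<^esub>) (W.tt \<one>\<^bsub>S\<^esub> s'))"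
    by (rule balancedI) (simp_all add: WW_shift[of _ "\<phi> _"] W_one_phi)
  note lift = WW.T.abelian_group_axioms this
  show "c \<in> carrier W.T \<Longrightarrow> comult WO c \<in> carrier WW.T"
    and "\<lbrakk>c \<in> carrier W.T; d \<in> carrier W.T\<rbrakk> \<Longrightarrow> comult WO (c \<oplus>\<^bsub>W.T\<^esub> d) = comult WO c \<oplus>\<^bsub>WW.T\<^esub> comult WO d"
    and "\<lbrakk>s \<in> carrier S; s' \<in> carrier S\<rbrakk> \<Longrightarrow>
      comult WO (W.tt s s') = WW.tt (W.tt s \<one>\<^bsub>S\<^esub>) (W.tt \<one>\<^bsub>S\<^esub> s')"
    unfolding eq
    using W.tlift_tens[OF lift, of s s']
    by (simp_all add: W.tlift_closed[OF lift] W.tlift_add[OF lift])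
qed

lemma counit_W_simps [simp]:
  shows "c \<in> carrier W.T \<Longrightarrow> counit WO c \<in> carrier S"
    and "\<lbrakk>c \<in> carrier W.T; d \<in> carrier W.T\<rbrakk> \<Longrightarrow> counit WO (c \<oplus>\<^bsub>W.T\<^esub> d) = counit WO c \<oplus>\<^bsub>S\<^esub> counit WO d"
    and "\<lbrakk>s \<in> carrier S; s' \<in> carrier S\<rbrakk> \<Longrightarrow> counit WO (W.tt s s') = s \<otimes>\<^bsub>S\<^esub> s'"
proof -
  have eq: "counit WO = tlift W.T S (\<lambda>s s'. s \<otimes>\<^bsub>S\<^esub> s')" by (simp add: sweedler_def Let_def)
  have "balanced B (SB S \<phi>) (BS S \<phi>) S (\<lambda>s s'. s \<otimes>\<^bsub>S\<^esub> s')"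
    by (rule balancedI) (simp_all add: S.l_distr S.r_distr S.m_assoc)
  note lift = S.abelian_group_axioms this
  show "c \<in> carrier W.T \<Longrightarrow> counit WO c \<in> carrier S"
    and "\<lbrakk>c \<in> carrier W.T; d \<in> carrier W.T\<rbrakk> \<Longrightarrow> counit WO (c \<oplus>\<^bsub>W.T\<^esub> d) = counit WO c \<oplus>\<^bsub>S\<^esub> counit WO d"
    and "\<lbrakk>s \<in> carrier S; s' \<in> carrier S\<rbrakk> \<Longrightarrow> counit WO (W.tt s s') = s \<otimes>\<^bsub>S\<^esub> s'"
    unfolding eq
    using W.tlift_tens[OF lift, of s s']
    by (simp_all add: W.tlift_closed[OF lift] W.tlift_add[OF lift])
qed

lemma linear_CO:
  "left_linear A CO CO g \<longleftrightarrow> left_linear A C.T C.T g"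
  "right_linear A CO CO g \<longleftrightarrow> right_linear A C.T C.T g"
  by (simp_all add: left_linear_def right_linear_def additive_map_def)

lemma linear_WO:
  "left_linear S WO WO g \<longleftrightarrow> left_linear S W.T W.T g"
  "right_linear S WO WO g \<longleftrightarrow> right_linear S W.T W.T g"
  by (simp_all add: left_linear_def right_linear_def additive_map_def)

lemma endos_CO_iff:
  "g \<in> coring_endos A CO \<longleftrightarrow>
    g \<in> extensional (carrier C.T) \<and> left_linear A C.T C.T g \<and> right_linear A C.T C.T g \<and>
    (\<forall>c\<in>carrier C.T. comult CO (g c) = tmap A C.T C.T C.T C.T g g (comult CO c) \<and>
      counit CO (g c) = counit CO c)"
  by (auto simp: coring_endos_def bimod_hom_iff linear_CO)

lemma endos_WO_iff:
  "g \<in> coring_endos S WO \<longleftrightarrow>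
    g \<in> extensional (carrier W.T) \<and> left_linear S W.T W.T g \<and> right_linear S W.T W.T g \<and>
    (\<forall>c\<in>carrier W.T. comult WO (g c) = tmap S W.T W.T W.T W.T g g (comult WO c) \<and>
      counit WO (g c) = counit WO c)"
  by (auto simp: coring_endos_def bimod_hom_iff linear_WO)

lemma endos_COD:
  assumes "g \<in> coring_endos A CO"
  shows "g \<in> extensional (carrier C.T)" and "left_linear A C.T C.T g" and "right_linear A C.T C.T g"
    and "\<And>c. c \<in> carrier C.T \<Longrightarrow> comult CO (g c) = tmap A C.T C.T C.T C.T g g (comult CO c)"
    and "\<And>c. c \<in> carrier C.T \<Longrightarrow> counit CO (g c) = counit CO c"
  using assms unfolding endos_CO_iff by blast+

lemma monoid_CO: "Group.monoid (coring_End A CO)"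
  by (rule coring_End_monoid) (simp_all, rule bimodule_cong[OF C.bimodule_tensor], simp_all)

lemma monoid_WO: "Group.monoid (coring_End S WO)"
  by (rule coring_End_monoid) (simp_all, rule bimodule_cong[OF W.bimodule_tensor], simp_all)

text \<open>The product of two dyads contracts the middle pair by evaluation, and that evaluation is
  the counit of the comatrix coring.\<close>

lemma counit_Psi:
  assumes "c \<in> carrier C.T" "u \<in> carrier M" "v \<in> carrier D"
  shows "counit WO (Psi u c v) = dyad (u \<triangleleft>\<^bsub>M\<^esub> counit CO c) v"
  using assms(1) by (induction rule: C.induct) (use assms(2,3) in simp_all)

section \<open>Comparing \<open>C \<otimes>\<^sub>A C\<close> with
  \<open>W \<otimes>\<^sub>S W\<close>\<close>

lemma Psi_phi:
  assumes "c \<in> carrier C.T" "u \<in> carrier M" "v' \<in> carrier D" "b \<in> carrier B"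
  shows "Psi u c (v' \<triangleleft>\<^bsub>D\<^esub> b) = Psi u c v' \<triangleleft>\<^bsub>W.T\<^esub> \<phi> b"
  using Psi_right[of c u v' "\<phi> b"] assms by simp

text \<open>Here \<open>W \<otimes>\<^sub>S W\<close> is read as
  \<open>W \<otimes>\<^sub>B S\<close>, the second factor being \<open>1 \<otimes> s\<close>.
  Accordingly \<open>d = v' \<otimes> w\<close> is torn apart: \<open>v'\<close> closes
  \<open>Psi u c\<close> on the right and \<open>w\<close> opens the dyad that plays the role of
  \<open>s\<close>.\<close>

abbreviation (input) "theta u c d w' \<equiv> tlift C.T WW.T (\<lambda>v' w. WW.tt (Psi u c v') (W.tt \<one>\<^bsub>S\<^esub> (dyad w w'))) d"

lemma balanced_theta:
  assumes "u \<in> carrier M" "c \<in> carrier C.T" "w' \<in> carrier D"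
  shows "balanced B D M WW.T (\<lambda>v' w. WW.tt (Psi u c v') (W.tt \<one>\<^bsub>S\<^esub> (dyad w w')))"
  by (rule balancedI) (use assms in \<open>simp_all add: Psi_phi W_one_phi\<close>)

lemmas theta_simps [simp] = C.tlift_closed[OF WW.T.abelian_group_axioms balanced_theta]
  C.tlift_add[OF WW.T.abelian_group_axioms balanced_theta]
  C.tlift_tens[OF WW.T.abelian_group_axioms balanced_theta]

definition Theta where "Theta u z w' = tlift CC.T WW.T (\<lambda>c d. theta u c d w') z"

lemma balanced_Theta:
  assumes "u \<in> carrier M" "w' \<in> carrier D"
  shows "balanced A C.T C.T WW.T (\<lambda>c d. theta u c d w')"
proof (rule balancedI)
  fix c c' d assume "c \<in> carrier C.T" "c' \<in> carrier C.T" "d \<in> carrier C.T"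
  from this(3,1,2) show "theta u (c \<oplus>\<^bsub>C.T\<^esub> c') d w' = theta u c d w' \<oplus>\<^bsub>WW.T\<^esub> theta u c' d w'"
    by (induction rule: C.induct) (use assms in \<open>simp_all add: WW.T.a_ac\<close>)
next
  fix c a d assume "c \<in> carrier C.T" "a \<in> carrier A" "d \<in> carrier C.T"
  from this(3,1,2) show "theta u (c \<triangleleft>\<^bsub>C.T\<^esub> a) d w' = theta u c (a \<triangleright>\<^bsub>C.T\<^esub> d) w'"
    by (induction rule: C.induct) (use assms in simp_all)
qed (use assms in simp_all)

lemma Theta_simps [simp]:
  assumes u: "u \<in> carrier M" and w: "w' \<in> carrier D"
  shows "z \<in> carrier CC.T \<Longrightarrow> Theta u z w' \<in> carrier WW.T"
    and "\<lbrakk>z \<in> carrier CC.T; z' \<in> carrier CC.T\<rbrakk> \<Longrightarrow> Theta u (z \<oplus>\<^bsub>CC.T\<^esub> z') w' = Theta u z w' \<oplus>\<^bsub>WW.T\<^esub> Theta u z' w'"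
    and "\<lbrakk>c \<in> carrier C.T; d \<in> carrier C.T\<rbrakk> \<Longrightarrow> Theta u (CC.tt c d) w' = theta u c d w'"
  unfolding Theta_def
  by (rule CC.tlift_closed CC.tlift_add CC.tlift_tens;
      (rule WW.T.abelian_group_axioms balanced_Theta[OF u w])?; assumption)+

lemma theta_shift:
  assumes "u \<in> carrier M" "w' \<in> carrier D" "c \<in> carrier C.T" "d \<in> carrier C.T" "a \<in> carrier A"
  shows "theta u (c \<triangleleft>\<^bsub>C.T\<^esub> a) d w' = theta u c (a \<triangleright>\<^bsub>C.T\<^esub> d) w'"
  using balanced_Theta[OF assms(1,2)] assms by (simp add: balanced_def)

text \<open>For \<open>d = y' \<otimes> w\<close> the scalar \<open>v' x\<close> combines with
  \<open>y'\<close> to \<open>v' \<star> dyad x y'\<close>, and this dyad crosses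
  \<open>\<otimes>\<^sub>S\<close> to complete the second \<open>Psi\<close>. Thus tensors of two
  values of \<open>Psi\<close> are reached by \<open>theta\<close>.\<close>

lemma theta_Psi:
  assumes "u \<in> carrier M" "w' \<in> carrier D" "c \<in> carrier C.T" "v' \<in> carrier D" "x \<in> carrier M"
    and "d \<in> carrier C.T"
  shows "theta u (c \<triangleleft>\<^bsub>C.T\<^esub> v' x) d w' = WW.tt (Psi u c v') (Psi x d w')"
  using assms(6)
proof (induction rule: C.induct)
  case (tens y' w)
  have "Psi u c (v' x \<triangleright>\<^bsub>D\<^esub> y') = Psi u c v' \<triangleleft>\<^bsub>W.T\<^esub> dyad x y'"
    using Psi_right[of c u v' "dyad x y'"] assms tens by simp
  then show ?case using assms tens by simp
qed (use assms in simp_all)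

text \<open>\<open>Theta\<close> turns every inserted pair \<open>e i\<close>, \<open>e' i\<close>
  into the dyad formed from it, and these dyads sum to the unit that the Sweedler comultiplication
  inserts.\<close>

lemma Theta_comult:
  assumes c: "c \<in> carrier C.T" and u: "u \<in> carrier M" "w' \<in> carrier D"
  shows "Theta u (comult CO c) w' = comult WO (Psi u c w')"
  using c
proof (induction rule: C.induct)
  case (tens u' w)
  let ?F = "\<lambda>t. WW.tt (W.tt (dyad u u') t) (W.tt \<one>\<^bsub>S\<^esub> (dyad w w'))"
  have "Theta u (comult CO (C.tt u' w)) w' =
    (\<Oplus>\<^bsub>WW.T\<^esub>i\<in>J. Theta u (CC.tt (C.tt u' (e i)) (C.tt (e' i) w)) w')"
    using tens u
    by (simp, intro additive_map_finsum[where f = "\<lambda>z. Theta u z w'"] CC.T.abelian_group_axioms WW.T.abelian_group_axioms)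
      (auto intro: additive_mapI)
  also have "\<dots> = (\<Oplus>\<^bsub>WW.T\<^esub>i\<in>J. ?F (dyad (e i) (e' i)))"
    using tens u by (intro finsum_eqI WW.T.abelian_group_axioms) auto
  also have "\<dots> = ?F (\<Oplus>\<^bsub>S\<^esub>i\<in>J. dyad (e i) (e' i))"
    using tens u
    by (intro additive_map_finsum[symmetric, where f = ?F] S.abelian_group_axioms WW.T.abelian_group_axioms)
      (auto intro!: additive_mapI)
  finally show ?case using tens u by (simp add: one_expand)
qed (use u in simp_all)

text \<open>This brings tensors with an arbitrary left factor, such as \<open>1\<close>, into the
  span of \<open>Psi\<close>, where \<open>hat\<close> can be evaluated.\<close>

lemma W_expand:
  assumes "s \<in> carrier S" "w \<in> carrier M" "w' \<in> carrier D"
  shows "W.tt s (dyad w w') = (\<Oplus>\<^bsub>W.T\<^esub>i\<in>J. Psi (s (e i)) (C.tt (e' i) w) w')"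
proof -
  have "W.tt (\<Oplus>\<^bsub>S\<^esub>i\<in>J. dyad (s (e i)) (e' i)) (dyad w w') =
    (\<Oplus>\<^bsub>W.T\<^esub>i\<in>J. W.tt (dyad (s (e i)) (e' i)) (dyad w w'))"
    using assms
    by (intro additive_map_finsum[where f = "\<lambda>t. W.tt t (dyad w w')"] S.abelian_group_axioms W.T.abelian_group_axioms)
      (auto intro: additive_mapI)
  also have "\<dots> = (\<Oplus>\<^bsub>W.T\<^esub>i\<in>J. Psi (s (e i)) (C.tt (e' i) w) w')"
    using assms by (intro finsum_eqI W.T.abelian_group_axioms) auto
  finally show ?thesis using assms by (simp add: S_expand)
qed

lemma W_one_expand:
  assumes "w \<in> carrier M" "w' \<in> carrier D"
  shows "W.tt \<one>\<^bsub>S\<^esub> (dyad w w') = (\<Oplus>\<^bsub>W.T\<^esub>i\<in>J. Psi (e i) (C.tt (e' i) w) w')"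
proof -
  have "(\<Oplus>\<^bsub>W.T\<^esub>i\<in>J. Psi (\<one>\<^bsub>S\<^esub> (e i)) (C.tt (e' i) w) w') = (\<Oplus>\<^bsub>W.T\<^esub>i\<in>J. Psi (e i) (C.tt (e' i) w) w')"
    using assms by (intro finsum_eqI W.T.abelian_group_axioms) auto
  then show ?thesis using assms by (simp only: W_expand S.one_closed)
qed

section \<open>Compatibility of \<open>hat\<close> with the coring structure\<close>

context
  fixes g
  assumes gl: "left_linear A C.T C.T g" and gr: "right_linear A C.T C.T g"
begin

lemmas g_simps [simp] = left_linearD[OF gl] right_linearD(3)[OF gr]
lemmas hat_simps [simp] = hat_closed[OF gl gr] hat_add[OF gl gr] hat_Psi[OF gl gr]

lemma hat_left_linear: "left_linear S W.T W.T (hat A B M g)"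
proof (rule left_linearI)
  fix s z assume s: "s \<in> carrier S" and z: "z \<in> carrier W.T"
  from z show "hat A B M g (s \<triangleright>\<^bsub>W.T\<^esub> z) = s \<triangleright>\<^bsub>W.T\<^esub> hat A B M g z"
    by (induction rule: W_induct) (use s in \<open>simp_all flip: Psi_left\<close>)
qed simp_all

lemma hat_right_linear: "right_linear S W.T W.T (hat A B M g)"
proof (rule right_linearI)
  fix s z assume s: "s \<in> carrier S" and z: "z \<in> carrier W.T"
  from z show "hat A B M g (z \<triangleleft>\<^bsub>W.T\<^esub> s) = hat A B M g z \<triangleleft>\<^bsub>W.T\<^esub> s"
    by (induction rule: W_induct) (use s in \<open>simp_all flip: Psi_right\<close>)
qed simp_all

interpretation gg: tensor_map A A A C.T C.T A A C.T C.T g g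
  by unfold_locales (rule gl gr)+

interpretation hh: tensor_map S S S W.T W.T S S W.T W.T "hat A B M g" "hat A B M g"
  by unfold_locales (rule hat_left_linear hat_right_linear)+

text \<open>The second factor of a value of \<open>theta\<close> is
  \<open>1 \<otimes> dyad w w'\<close>, at which \<open>hat\<close> is not given directly. Expanding
  \<open>1\<close> over the dual basis produces values of \<open>Psi\<close>;
  \<open>theta_Psi\<close> folds these back into \<open>theta\<close> at the cost of scalars
  \<open>v' (e i)\<close>, which pass to the right factor and through \<open>g\<close>, and
  \<open>D_expand\<close> reassembles \<open>v'\<close>.\<close>

lemma Theta_tmap:
  assumes z: "z \<in> carrier CC.T" and u: "u \<in> carrier M" "w' \<in> carrier D"
  shows "Theta u (gg.F z) w' = hh.F (Theta u z w')"
  using z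
proof (induction rule: CC.induct)
  case (tens c d)
  from tens(2) show ?case
  proof (induction rule: C.induct)
    case (tens v' w)
    note t = tens \<open>c \<in> carrier C.T\<close> u
    let ?F = "\<lambda>t. theta u (g c) (g (C.tt t w)) w'"
    have "hh.F (WW.tt (Psi u c v') (W.tt \<one>\<^bsub>S\<^esub> (dyad w w'))) =
      WW.tt (Psi u (g c) v') (hat A B M g (\<Oplus>\<^bsub>W.T\<^esub>i\<in>J. Psi (e i) (C.tt (e' i) w) w'))"
      using t by (simp flip: W_one_expand)
    also have "hat A B M g (\<Oplus>\<^bsub>W.T\<^esub>i\<in>J. Psi (e i) (C.tt (e' i) w) w') =
      (\<Oplus>\<^bsub>W.T\<^esub>i\<in>J. hat A B M g (Psi (e i) (C.tt (e' i) w) w'))"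
      using t by (intro additive_map_finsum W.T.abelian_group_axioms) (auto intro: additive_mapI)
    also have "WW.tt (Psi u (g c) v') \<dots> =
      (\<Oplus>\<^bsub>WW.T\<^esub>i\<in>J. WW.tt (Psi u (g c) v') (hat A B M g (Psi (e i) (C.tt (e' i) w) w')))"
      using t by (intro WW.tens_finsum_right) auto
    also have "\<dots> = (\<Oplus>\<^bsub>WW.T\<^esub>i\<in>J. ?F (v' (e i) \<triangleright>\<^bsub>D\<^esub> e' i))"
    proof (rule finsum_eqI[OF WW.T.abelian_group_axioms])
      fix i assume i: "i \<in> J"
      show "?F (v' (e i) \<triangleright>\<^bsub>D\<^esub> e' i) \<in> carrier WW.T" using i t by simp
      have "WW.tt (Psi u (g c) v') (Psi (e i) (g (C.tt (e' i) w)) w') =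
        theta u (g c \<triangleleft>\<^bsub>C.T\<^esub> v' (e i)) (g (C.tt (e' i) w)) w'"
        using i t by (intro theta_Psi[symmetric]) auto
      also have "\<dots> = theta u (g c) (v' (e i) \<triangleright>\<^bsub>C.T\<^esub> g (C.tt (e' i) w)) w'"
        using i t by (intro theta_shift) auto
      also have "v' (e i) \<triangleright>\<^bsub>C.T\<^esub> g (C.tt (e' i) w) = g (C.tt (v' (e i) \<triangleright>\<^bsub>D\<^esub> e' i) w)"
        using i t by (simp flip: left_linearD(3)[OF gl])
      finally show "WW.tt (Psi u (g c) v') (hat A B M g (Psi (e i) (C.tt (e' i) w) w')) = ?F (v' (e i) \<triangleright>\<^bsub>D\<^esub> e' i)"
        using i t by (subst hat_Psi[OF gl gr]) auto
    qed
    also have "\<dots> = ?F (\<Oplus>\<^bsub>D\<^esub>i\<in>J. v' (e i) \<triangleright>\<^bsub>D\<^esub> e' i)"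
      using t by (intro additive_map_finsum[symmetric, where f = ?F] D.M.abelian_group_axioms WW.T.abelian_group_axioms)
        (auto intro!: additive_mapI)
    finally show ?case using t by (simp add: D_expand)
  qed (use tens u in simp_all)
qed (use u in simp_all)

end

text \<open>On \<open>Psi u c v\<close>, applying \<open>Theta\<close> to the comultiplication
  equation for \<open>g\<close> at \<open>c\<close> yields the equation for
  \<open>hat A B M g\<close>. The counit depends on \<open>c\<close> only through
  \<open>counit CO c\<close>, which \<open>g\<close> preserves.\<close>

lemma hat_coring_endo:
  assumes g: "g \<in> coring_endos A CO"
  shows "hat A B M g \<in> coring_endos S WO"
proof -
  note gl = endos_COD(2)[OF g] and gr = endos_COD(3)[OF g]
    and comult = endos_COD(4)[OF g] and counit = endos_COD(5)[OF g]
  note lin = hat_left_linear[OF gl gr] hat_right_linear[OF gl gr]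
  interpret hh: tensor_map S S S W.T W.T S S W.T W.T "hat A B M g" "hat A B M g"
    by unfold_locales (rule lin)+
  note [simp] = g_simps[OF gl gr] hat_simps[OF gl gr]
  have "comult WO (hat A B M g z) = hh.F (comult WO z) \<and> counit WO (hat A B M g z) = counit WO z"
    if "z \<in> carrier W.T" for z
    using that
  proof (induction rule: W_induct)
    case (Psi u c v)
    then show ?case
      by (simp add: counit_Psi counit comult Theta_tmap[OF gl gr] flip: Theta_comult)
  qed simp_all
  then show ?thesis
    by (simp add: endos_WO_iff lin hat_extensional)
qed

section \<open>The injective homomorphism of endomorphism monoids\<close>

lemma hat_hom: "hat A B M \<in> monoid_homs (coring_End A CO) (coring_End S WO)"
proof -
  have comp: "hat A B M (compose (carrier C.T) g h) = compose (carrier W.T) (hat A B M g) (hat A B M h)"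
    if g: "g \<in> coring_endos A CO" and h: "h \<in> coring_endos A CO" for g h
  proof (rule extensionalityI[OF hat_extensional])
    show "compose (carrier W.T) (hat A B M g) (hat A B M h) \<in> extensional (carrier W.T)"
      by simp
    have gl: "left_linear A C.T C.T g" and gr: "right_linear A C.T C.T g" using endos_COD[OF g] by blast+
    have hl: "left_linear A C.T C.T h" and hr: "right_linear A C.T C.T h" using endos_COD[OF h] by blast+
    let ?k = "compose (carrier C.T) g h"
    have "?k \<in> coring_endos A CO"
      using monoid.m_closed[OF monoid_CO, of g h] g h by (simp add: coring_End_def)
    then have kl: "left_linear A C.T C.T ?k" and kr: "right_linear A C.T C.T ?k" by (blast dest: endos_COD(2,3))+
    note [simp] = g_simps[OF gl gr] hat_simps[OF gl gr] g_simps[OF hl hr] hat_simps[OF hl hr] hat_simps[OF kl kr]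
    fix z assume "z \<in> carrier W.T"
    then show "hat A B M ?k z = compose (carrier W.T) (hat A B M g) (hat A B M h) z"
      by (induction rule: W_induct) (simp_all add: compose_eq)
  qed
  have one: "hat A B M (\<lambda>c\<in>carrier CO. c) = (\<lambda>c\<in>carrier WO. c)"
  proof (rule extensionalityI[OF hat_extensional])
    let ?k = "\<lambda>c\<in>carrier CO. c"
    have "?k \<in> coring_endos A CO"
      using monoid.one_closed[OF monoid_CO] by (simp add: coring_End_def)
    then have kl: "left_linear A C.T C.T ?k" and kr: "right_linear A C.T C.T ?k" by (blast dest: endos_COD(2,3))+
    fix z assume "z \<in> carrier W.T"
    then have "hat A B M ?k z = z"
      by (induction rule: W_induct) (simp_all only: hat_facts[OF kl kr], simp)
    then show "hat A B M ?k z = (\<lambda>c\<in>carrier WO. c) z" using \<open>z \<in> carrier W.T\<close> by simp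
  qed simp
  show ?thesis
    unfolding monoid_homs_def
  proof (intro CollectI conjI monoid_CO monoid_WO homI)
    show "hat A B M \<one>\<^bsub>coring_End A CO\<^esub> = \<one>\<^bsub>coring_End S WO\<^esub>"
      using one by (simp add: coring_End_def)
  qed (use comp hat_coring_endo in \<open>simp_all add: coring_End_def\<close>)
qed

lemma hat_inj: "inj_on (hat A B M) (coring_endos A CO)"
proof (rule inj_onI)
  fix g h assume gh: "g \<in> coring_endos A CO" "h \<in> coring_endos A CO" and eq: "hat A B M g = hat A B M h"
  have gl: "left_linear A C.T C.T g" and gr: "right_linear A C.T C.T g" using gh by (blast dest: endos_COD(2,3))+
  have hl: "left_linear A C.T C.T h" and hr: "right_linear A C.T C.T h" using gh by (blast dest: endos_COD(2,3))+
  have "g c = h c" if "c \<in> carrier C.T" for c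
    using that
  proof (induction rule: C.induct)
    case (tens w x)
    then show ?case
      using hat_Phi[OF gl gr, of "W.tt \<one>\<^bsub>S\<^esub> \<one>\<^bsub>S\<^esub>" w x] hat_Phi[OF hl hr, of "W.tt \<one>\<^bsub>S\<^esub> \<one>\<^bsub>S\<^esub>" w x] eq
      by simp
  qed (simp add: left_linearD(2)[OF gl] left_linearD(2)[OF hl])
  then show "g = h"
    using gh by (intro extensionalityI[of g "carrier C.T" h] endos_COD(1))
qed

section \<open>Invertible sub-bimodules\<close>

context
  fixes I assumes I: "I \<in> inv_left B S \<phi>"
begin

lemma I_closed [simp]:
  shows "x \<in> I \<Longrightarrow> x \<in> carrier S"
    and "\<lbrakk>b \<in> carrier B; x \<in> I\<rbrakk> \<Longrightarrow> \<phi> b \<otimes>\<^bsub>S\<^esub> x \<in> I"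
    and "\<lbrakk>b \<in> carrier B; x \<in> I\<rbrakk> \<Longrightarrow> x \<otimes>\<^bsub>S\<^esub> \<phi> b \<in> I"
  using I by (auto simp: inv_left_def)

lemma I_bimodule: "bimodule B B (sub_bimod \<phi> S I)"
  using I by (intro bimodule_sub_bimod M.R.ring_axioms S.ring_axioms phi_hom) (auto simp: inv_left_def)

interpretation TI: tensor_pair S B B "SB S \<phi>" "sub_bimod \<phi> S I"
  by (rule tensor_pair.intro; rule SB_bimodule I_bimodule)

lemma I_add [simp]: "\<lbrakk>x \<in> I; y \<in> I\<rbrakk> \<Longrightarrow> x \<oplus>\<^bsub>S\<^esub> y \<in> I"
  using TI.N.M.a_closed[of x y] by simp

lemma TI_simps [simp]:
  assumes "s \<in> carrier S" "x \<in> I"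
  shows "TI.tt s x \<in> carrier TI.T"
    and "t \<in> carrier S \<Longrightarrow> TI.tt (s \<oplus>\<^bsub>S\<^esub> t) x = TI.tt s x \<oplus>\<^bsub>TI.T\<^esub> TI.tt t x"
    and "y \<in> I \<Longrightarrow> TI.tt s (x \<oplus>\<^bsub>S\<^esub> y) = TI.tt s x \<oplus>\<^bsub>TI.T\<^esub> TI.tt s y"
    and "t \<in> carrier S \<Longrightarrow> t \<triangleright>\<^bsub>TI.T\<^esub> TI.tt s x = TI.tt (t \<otimes>\<^bsub>S\<^esub> s) x"
    and "b \<in> carrier B \<Longrightarrow> TI.tt s x \<triangleleft>\<^bsub>TI.T\<^esub> b = TI.tt s (x \<otimes>\<^bsub>S\<^esub> \<phi> b)"
    and "b \<in> carrier B \<Longrightarrow> TI.tt (s \<otimes>\<^bsub>S\<^esub> \<phi> b) x = TI.tt s (\<phi> b \<otimes>\<^bsub>S\<^esub> x)"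
  using assms TI.tens_closed[of s x] TI.tens_add_left[of s t x] TI.tens_add_right[of s x y]
    TI.lact_tens[of t s x] TI.ract_tens[of b s x] TI.tens_balanced[of s b x]
  by simp_all

section \<open>The preimage of the unit under multiplication\<close>

abbreviation "mu \<equiv> mult_map B S \<phi> I"

lemma mu_iso: "mu \<in> bimod_iso S B TI.T (SB S \<phi>)"
  using I by (simp add: inv_left_def)

lemma mu_inj: "inj_on mu (carrier TI.T)"
  and mu_surj: "mu ` carrier TI.T = carrier S"
  using mu_iso by (simp_all add: bimod_iso_def bij_betw_def)

lemma mu_linear: "left_linear S TI.T (SB S \<phi>) mu" "right_linear B TI.T (SB S \<phi>) mu"
  using mu_iso by (simp_all add: bimod_iso_def bimod_hom_iff)

lemma mu_simps [simp]:
  shows "z \<in> carrier TI.T \<Longrightarrow> mu z \<in> carrier S"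
    and "\<lbrakk>z \<in> carrier TI.T; z' \<in> carrier TI.T\<rbrakk> \<Longrightarrow> mu (z \<oplus>\<^bsub>TI.T\<^esub> z') = mu z \<oplus>\<^bsub>S\<^esub> mu z'"
    and "\<lbrakk>s \<in> carrier S; z \<in> carrier TI.T\<rbrakk> \<Longrightarrow> mu (s \<triangleright>\<^bsub>TI.T\<^esub> z) = s \<otimes>\<^bsub>S\<^esub> mu z"
    and "\<lbrakk>z \<in> carrier TI.T; b \<in> carrier B\<rbrakk> \<Longrightarrow> mu (z \<triangleleft>\<^bsub>TI.T\<^esub> b) = mu z \<otimes>\<^bsub>S\<^esub> \<phi> b"
  using left_linearD(1)[OF mu_linear(1), of z] left_linearD(2)[OF mu_linear(1), of z z']
    left_linearD(3)[OF mu_linear(1), of s z] right_linearD(3)[OF mu_linear(2), of z b]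
  by simp_all

lemma mu_tens [simp]:
  assumes "s \<in> carrier S" "x \<in> I"
  shows "mu (TI.tt s x) = s \<otimes>\<^bsub>S\<^esub> x"
proof -
  have "balanced B (SB S \<phi>) (sub_bimod \<phi> S I) S (\<lambda>s x. s \<otimes>\<^bsub>S\<^esub> x)"
    by (rule balancedI) (simp_all add: S.l_distr S.r_distr S.m_assoc)
  then show ?thesis
    using TI.tlift_tens[OF S.abelian_group_axioms, of _ s x] assms by (simp add: mult_map_def)
qed

definition unit_preimage where "unit_preimage = inv_into (carrier TI.T) mu \<one>\<^bsub>S\<^esub>"

lemma unit_preimage_closed [simp]: "unit_preimage \<in> carrier TI.T"
  and mu_unit_preimage [simp]: "mu unit_preimage = \<one>\<^bsub>S\<^esub>"
  unfolding unit_preimage_def using mu_surj S.one_closed by (simp_all add: inv_into_into f_inv_into_f)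

text \<open>Both sides multiply to \<open>\<phi> b\<close>, and multiplication is injective. This
  commutation makes \<open>Gamma\<close> and \<open>Gamma_bar\<close> well defined over
  \<open>B\<close>.\<close>

lemma unit_preimage_central: "b \<in> carrier B \<Longrightarrow> \<phi> b \<triangleright>\<^bsub>TI.T\<^esub> unit_preimage = unit_preimage \<triangleleft>\<^bsub>TI.T\<^esub> b"
  by (rule inj_onD[OF mu_inj]) simp_all

text \<open>Both sides multiply to \<open>x\<close>. A copy of \<open>unit_preimage\<close> can thus
  absorb an element of \<open>I\<close>, which is the source of the comultiplicativity of
  \<open>Gamma\<close>.\<close>

lemma unit_preimage_lact: "x \<in> I \<Longrightarrow> x \<triangleright>\<^bsub>TI.T\<^esub> unit_preimage = TI.tt \<one>\<^bsub>S\<^esub> x"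
  by (rule inj_onD[OF mu_inj]) simp_all

section \<open>The comatrix coring endomorphism attached to \<open>I\<close>\<close>

lemma sum_unit_eq: "sum_unit B S \<phi> I P f = tlift TI.T P f unit_preimage"
  by (simp add: sum_unit_def unit_preimage_def Let_def)

text \<open>The element \<open>z\<close> is a variable rather than \<open>unit_preimage\<close>, so
  that identities can be proved by induction over elementary tensors in \<open>z\<close>.\<close>

definition Gamma_sum where "Gamma_sum u' u z = tlift TI.T C.T (\<lambda>v x. C.tt (u' \<star> v) (x u)) z"

lemma balanced_Gamma_term:
  assumes "u' \<in> carrier D" "u \<in> carrier M"
  shows "balanced B (SB S \<phi>) (sub_bimod \<phi> S I) C.T (\<lambda>v x. C.tt (u' \<star> v) (x u))"
  by (rule balancedI) (use assms in simp_all)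

lemma Gamma_sum_simps [simp]:
  assumes u: "u' \<in> carrier D" "u \<in> carrier M"
  shows "z \<in> carrier TI.T \<Longrightarrow> Gamma_sum u' u z \<in> carrier C.T"
    and "\<lbrakk>z \<in> carrier TI.T; z' \<in> carrier TI.T\<rbrakk> \<Longrightarrow> Gamma_sum u' u (z \<oplus>\<^bsub>TI.T\<^esub> z') = Gamma_sum u' u z \<oplus>\<^bsub>C.T\<^esub> Gamma_sum u' u z'"
    and "\<lbrakk>s \<in> carrier S; x \<in> I\<rbrakk> \<Longrightarrow> Gamma_sum u' u (TI.tt s x) = C.tt (u' \<star> s) (x u)"
  unfolding Gamma_sum_def
  using TI.tlift_tens[OF C.T.abelian_group_axioms balanced_Gamma_term[OF u], of s x]
  by (simp_all add: TI.tlift_closed[OF C.T.abelian_group_axioms balanced_Gamma_term[OF u]]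
    TI.tlift_add[OF C.T.abelian_group_axioms balanced_Gamma_term[OF u]])

lemma Gamma_sum_linear [simp]:
  assumes z: "z \<in> carrier TI.T" and u: "u' \<in> carrier D" "u \<in> carrier M"
  shows "v' \<in> carrier D \<Longrightarrow> Gamma_sum (u' \<oplus>\<^bsub>D\<^esub> v') u z = Gamma_sum u' u z \<oplus>\<^bsub>C.T\<^esub> Gamma_sum v' u z"
    and "v \<in> carrier M \<Longrightarrow> Gamma_sum u' (u \<oplus>\<^bsub>M\<^esub> v) z = Gamma_sum u' u z \<oplus>\<^bsub>C.T\<^esub> Gamma_sum u' v z"
    and "a \<in> carrier A \<Longrightarrow> Gamma_sum (a \<triangleright>\<^bsub>D\<^esub> u') u z = a \<triangleright>\<^bsub>C.T\<^esub> Gamma_sum u' u z"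
    and "a \<in> carrier A \<Longrightarrow> Gamma_sum u' (u \<triangleleft>\<^bsub>M\<^esub> a) z = Gamma_sum u' u z \<triangleleft>\<^bsub>C.T\<^esub> a"
  using z by (induction rule: TI.induct) (use u in \<open>simp_all add: C.T.a_ac\<close>)

lemma Gamma_sum_comp:
  assumes z: "z \<in> carrier TI.T" and u: "u' \<in> carrier D" "u \<in> carrier M" and s: "s \<in> carrier S"
  shows "Gamma_sum (u' \<star> s) u z = Gamma_sum u' u (s \<triangleright>\<^bsub>TI.T\<^esub> z)"
  using z by (induction rule: TI.induct) (use u s in simp_all)

lemma Gamma_sum_lact:
  assumes z: "z \<in> carrier TI.T" and u: "u' \<in> carrier D" "u \<in> carrier M" and b: "b \<in> carrier B"
  shows "Gamma_sum u' (b \<triangleright>\<^bsub>M\<^esub> u) z = Gamma_sum u' u (z \<triangleleft>\<^bsub>TI.T\<^esub> b)"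
  using z by (induction rule: TI.induct) (use u b in simp_all)

text \<open>At \<open>z = unit_preimage\<close> the right-hand side is \<open>u' u\<close>, so the
  counit is preserved.\<close>

lemma Gamma_sum_counit:
  assumes z: "z \<in> carrier TI.T" and u: "u' \<in> carrier D" "u \<in> carrier M"
  shows "counit CO (Gamma_sum u' u z) = u' (mu z u)"
  using z by (induction rule: TI.induct) (use u in simp_all)

text \<open>The statement is asymmetric on purpose: it is additive in \<open>z\<close>, which it
  would not be if \<open>z\<close> stood in both factors. For \<open>z = s \<otimes> x\<close>,
  \<open>basis_shift\<close> moves \<open>x\<close> from \<open>e i\<close> over to
  \<open>e' i\<close>, where \<open>unit_preimage\<close> absorbs it and leaves
  \<open>1 \<otimes> x\<close>.\<close>

lemma Gamma_sum_comult:
  assumes z: "z \<in> carrier TI.T" and u: "u' \<in> carrier D" "u \<in> carrier M"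
  shows "comult CO (Gamma_sum u' u z) = (\<Oplus>\<^bsub>CC.T\<^esub>i\<in>J. CC.tt (Gamma_sum u' (e i) z) (Gamma_sum (e' i) u unit_preimage))"
  using z
proof (induction rule: TI.induct)
  case (tens s x)
  then have s: "s \<in> carrier S" and x: "x \<in> I" by simp_all
  have "balanced A M D CC.T (\<lambda>m d. CC.tt (C.tt (u' \<star> s) m) (Gamma_sum d u unit_preimage))"
    by (rule balancedI) (use u s in simp_all)
  from basis_shift[OF CC.T.abelian_group_axioms this I_closed(1)[OF x]]
  have shift: "(\<Oplus>\<^bsub>CC.T\<^esub>i\<in>J. CC.tt (C.tt (u' \<star> s) (x (e i))) (Gamma_sum (e' i) u unit_preimage)) =
    (\<Oplus>\<^bsub>CC.T\<^esub>i\<in>J. CC.tt (C.tt (u' \<star> s) (e i)) (Gamma_sum (e' i \<star> x) u unit_preimage))" .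
  have "(\<Oplus>\<^bsub>CC.T\<^esub>i\<in>J. CC.tt (Gamma_sum u' (e i) (TI.tt s x)) (Gamma_sum (e' i) u unit_preimage)) =
    (\<Oplus>\<^bsub>CC.T\<^esub>i\<in>J. CC.tt (C.tt (u' \<star> s) (x (e i))) (Gamma_sum (e' i) u unit_preimage))"
    using u s x by (intro finsum_eqI CC.T.abelian_group_axioms) auto
  also note shift
  also have "(\<Oplus>\<^bsub>CC.T\<^esub>i\<in>J. CC.tt (C.tt (u' \<star> s) (e i)) (Gamma_sum (e' i \<star> x) u unit_preimage)) =
    (\<Oplus>\<^bsub>CC.T\<^esub>i\<in>J. CC.tt (C.tt (u' \<star> s) (e i)) (C.tt (e' i) (x u)))"
    using u s x by (intro finsum_eqI CC.T.abelian_group_axioms) (auto simp: Gamma_sum_comp unit_preimage_lact)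
  finally show ?case using u s x by simp
next
  case (add z z')
  then show ?case
    using u by (simp, intro finsum_addI[symmetric] CC.T.abelian_group_axioms) simp_all
qed

lemma balanced_Gamma_sum: "balanced B D M C.T (\<lambda>u' u. Gamma_sum u' u unit_preimage)"
proof (rule balancedI)
  fix u' b u assume *: "u' \<in> carrier D" "b \<in> carrier B" "u \<in> carrier M"
  then show "Gamma_sum (u' \<triangleleft>\<^bsub>D\<^esub> b) u unit_preimage = Gamma_sum u' (b \<triangleright>\<^bsub>M\<^esub> u) unit_preimage"
    using Gamma_sum_comp[of unit_preimage u' u "\<phi> b"] by (simp add: unit_preimage_central Gamma_sum_lact)
qed simp_all

abbreviation "Gamma_I \<equiv> Gamma A B M I"

lemma Gamma_I_eq: "Gamma_I = tlift C.T C.T (\<lambda>u' u. Gamma_sum u' u unit_preimage)"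
  by (simp add: Gamma_def sum_unit_eq Gamma_sum_def dcomp_def Let_def)

lemma Gamma_I_simps [simp]:
  shows "c \<in> carrier C.T \<Longrightarrow> Gamma_I c \<in> carrier C.T"
    and "\<lbrakk>c \<in> carrier C.T; d \<in> carrier C.T\<rbrakk> \<Longrightarrow> Gamma_I (c \<oplus>\<^bsub>C.T\<^esub> d) = Gamma_I c \<oplus>\<^bsub>C.T\<^esub> Gamma_I d"
    and "\<lbrakk>u' \<in> carrier D; u \<in> carrier M\<rbrakk> \<Longrightarrow> Gamma_I (C.tt u' u) = Gamma_sum u' u unit_preimage"
  unfolding Gamma_I_eq
  by (rule C.tlift_closed C.tlift_add C.tlift_tens;
      (rule C.T.abelian_group_axioms balanced_Gamma_sum)?; assumption)+

lemma Gamma_I_left_linear: "left_linear A C.T C.T Gamma_I"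
proof (rule left_linearI)
  fix a c assume a: "a \<in> carrier A" and c: "c \<in> carrier C.T"
  from c show "Gamma_I (a \<triangleright>\<^bsub>C.T\<^esub> c) = a \<triangleright>\<^bsub>C.T\<^esub> Gamma_I c"
    by (induction rule: C.induct) (use a in simp_all)
qed simp_all

lemma Gamma_I_right_linear: "right_linear A C.T C.T Gamma_I"
proof (rule right_linearI)
  fix c a assume a: "a \<in> carrier A" and c: "c \<in> carrier C.T"
  from c show "Gamma_I (c \<triangleleft>\<^bsub>C.T\<^esub> a) = Gamma_I c \<triangleleft>\<^bsub>C.T\<^esub> a"
    by (induction rule: C.induct) (use a in simp_all)
qed simp_all

lemma Gamma_I_endo: "Gamma_I \<in> coring_endos A CO"
proof -
  interpret G: tensor_map A A A C.T C.T A A C.T C.T Gamma_I Gamma_I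
    by unfold_locales (rule Gamma_I_left_linear Gamma_I_right_linear)+
  have "comult CO (Gamma_I c) = G.F (comult CO c) \<and> counit CO (Gamma_I c) = counit CO c"
    if "c \<in> carrier C.T" for c
    using that
  proof (induction rule: C.induct)
    case (tens u' u)
    have "G.F (\<Oplus>\<^bsub>CC.T\<^esub>i\<in>J. CC.tt (C.tt u' (e i)) (C.tt (e' i) u)) =
      (\<Oplus>\<^bsub>CC.T\<^esub>i\<in>J. G.F (CC.tt (C.tt u' (e i)) (C.tt (e' i) u)))"
      using tens by (intro additive_map_finsum CC.T.abelian_group_axioms G.tmap_additive) auto
    also have "\<dots> = (\<Oplus>\<^bsub>CC.T\<^esub>i\<in>J. CC.tt (Gamma_sum u' (e i) unit_preimage) (Gamma_sum (e' i) u unit_preimage))"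
      using tens by (intro finsum_eqI CC.T.abelian_group_axioms) auto
    finally show ?case using tens by (simp add: Gamma_sum_comult Gamma_sum_counit)
  qed simp_all
  moreover have "Gamma_I \<in> extensional (carrier C.T)" by (simp add: Gamma_I_eq tlift_def)
  ultimately show ?thesis
    by (simp add: endos_CO_iff Gamma_I_left_linear Gamma_I_right_linear)
qed

section \<open>The Sweedler coring endomorphism attached to \<open>I\<close>\<close>

definition Gamma_bar_sum where "Gamma_bar_sum s s' z = tlift TI.T W.T (\<lambda>v x. W.tt (s \<otimes>\<^bsub>S\<^esub> v) (x \<otimes>\<^bsub>S\<^esub> s')) z"

lemma balanced_Gamma_bar_term:
  assumes "s \<in> carrier S" "s' \<in> carrier S"
  shows "balanced B (SB S \<phi>) (sub_bimod \<phi> S I) W.T (\<lambda>v x. W.tt (s \<otimes>\<^bsub>S\<^esub> v) (x \<otimes>\<^bsub>S\<^esub> s'))"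
  by (rule balancedI) (use assms in \<open>simp_all add: S.l_distr S.r_distr flip: S.m_assoc\<close>)

lemma Gamma_bar_sum_simps [simp]:
  assumes s: "s \<in> carrier S" "s' \<in> carrier S"
  shows "z \<in> carrier TI.T \<Longrightarrow> Gamma_bar_sum s s' z \<in> carrier W.T"
    and "\<lbrakk>z \<in> carrier TI.T; z' \<in> carrier TI.T\<rbrakk> \<Longrightarrow> Gamma_bar_sum s s' (z \<oplus>\<^bsub>TI.T\<^esub> z') = Gamma_bar_sum s s' z \<oplus>\<^bsub>W.T\<^esub> Gamma_bar_sum s s' z'"
    and "\<lbrakk>v \<in> carrier S; x \<in> I\<rbrakk> \<Longrightarrow> Gamma_bar_sum s s' (TI.tt v x) = W.tt (s \<otimes>\<^bsub>S\<^esub> v) (x \<otimes>\<^bsub>S\<^esub> s')"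
  unfolding Gamma_bar_sum_def
  using TI.tlift_tens[OF W.T.abelian_group_axioms balanced_Gamma_bar_term[OF s], of v x]
  by (simp_all add: TI.tlift_closed[OF W.T.abelian_group_axioms balanced_Gamma_bar_term[OF s]]
    TI.tlift_add[OF W.T.abelian_group_axioms balanced_Gamma_bar_term[OF s]])

lemma Gamma_bar_sum_linear:
  assumes z: "z \<in> carrier TI.T" and s: "s \<in> carrier S" "s' \<in> carrier S"
  shows "t \<in> carrier S \<Longrightarrow> Gamma_bar_sum (s \<oplus>\<^bsub>S\<^esub> t) s' z = Gamma_bar_sum s s' z \<oplus>\<^bsub>W.T\<^esub> Gamma_bar_sum t s' z"
    and "t \<in> carrier S \<Longrightarrow> Gamma_bar_sum s (s' \<oplus>\<^bsub>S\<^esub> t) z = Gamma_bar_sum s s' z \<oplus>\<^bsub>W.T\<^esub> Gamma_bar_sum s t z"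
    and "b \<in> carrier B \<Longrightarrow> Gamma_bar_sum (s \<otimes>\<^bsub>S\<^esub> \<phi> b) s' z = Gamma_bar_sum s s' (\<phi> b \<triangleright>\<^bsub>TI.T\<^esub> z)"
    and "b \<in> carrier B \<Longrightarrow> Gamma_bar_sum s (\<phi> b \<otimes>\<^bsub>S\<^esub> s') z = Gamma_bar_sum s s' (z \<triangleleft>\<^bsub>TI.T\<^esub> b)"
  using z by (induction rule: TI.induct) (use s in \<open>simp_all add: S.l_distr S.r_distr S.m_assoc W.T.a_ac\<close>)

text \<open>A factor \<open>t\<close> to the right of \<open>dyad u u'\<close> acts on
  \<open>u'\<close>, and a factor \<open>x\<close> to the left of \<open>dyad v v'\<close> acts on
  \<open>v\<close>. Both constructions therefore insert \<open>z\<close> at the same place, between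
  \<open>u'\<close> and \<open>v\<close>.\<close>

lemma Gamma_bar_sum_dyad:
  assumes z: "z \<in> carrier TI.T" and u: "u \<in> carrier M" "u' \<in> carrier D" "v \<in> carrier M" "v' \<in> carrier D"
  shows "Gamma_bar_sum (dyad u u') (dyad v v') z = Psi u (Gamma_sum u' v z) v'"
  using z by (induction rule: TI.induct) (use u in simp_all)

lemma balanced_Gamma_bar_sum: "balanced B (SB S \<phi>) (BS S \<phi>) W.T (\<lambda>s s'. Gamma_bar_sum s s' unit_preimage)"
  by (rule balancedI) (simp_all add: Gamma_bar_sum_linear unit_preimage_central)

abbreviation "Gamma_bar_I \<equiv> Gamma_bar B S \<phi> I"

lemma Gamma_bar_I_eq: "Gamma_bar_I = tlift W.T W.T (\<lambda>s s'. Gamma_bar_sum s s' unit_preimage)"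
  by (simp add: Gamma_bar_def sum_unit_eq Gamma_bar_sum_def Let_def)

lemma Gamma_bar_I_simps [simp]:
  shows "z \<in> carrier W.T \<Longrightarrow> Gamma_bar_I z \<in> carrier W.T"
    and "\<lbrakk>z \<in> carrier W.T; z' \<in> carrier W.T\<rbrakk> \<Longrightarrow> Gamma_bar_I (z \<oplus>\<^bsub>W.T\<^esub> z') = Gamma_bar_I z \<oplus>\<^bsub>W.T\<^esub> Gamma_bar_I z'"
    and "\<lbrakk>s \<in> carrier S; s' \<in> carrier S\<rbrakk> \<Longrightarrow> Gamma_bar_I (W.tt s s') = Gamma_bar_sum s s' unit_preimage"
  unfolding Gamma_bar_I_eq
  using W.tlift_tens[OF W.T.abelian_group_axioms balanced_Gamma_bar_sum, of s s']
  by (simp_all add: W.tlift_closed[OF W.T.abelian_group_axioms balanced_Gamma_bar_sum]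
    W.tlift_add[OF W.T.abelian_group_axioms balanced_Gamma_bar_sum])

lemma Gamma_bar_I_Psi:
  assumes c: "c \<in> carrier C.T" and u: "u \<in> carrier M" "v \<in> carrier D"
  shows "Gamma_bar_I (Psi u c v) = Psi u (Gamma_I c) v"
  using c by (induction rule: C.induct) (use u in \<open>simp_all add: Gamma_bar_sum_dyad\<close>)

lemma hat_Gamma_I: "hat A B M Gamma_I = Gamma_bar_I"
proof (rule extensionalityI[OF hat_extensional])
  show "Gamma_bar_I \<in> extensional (carrier W.T)" by (simp add: Gamma_bar_I_eq tlift_def)
  note [simp] = hat_facts[OF Gamma_I_left_linear Gamma_I_right_linear]
  fix z assume "z \<in> carrier W.T"
  then show "hat A B M Gamma_I z = Gamma_bar_I z"
    by (induction rule: W_induct) (simp_all add: Gamma_bar_I_Psi)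
qed

text \<open>The property is inherited from \<open>Gamma_I\<close> through \<open>hat\<close>,
  without a second computation of comultiplications.\<close>

lemma Gamma_bar_I_endo: "Gamma_bar_I \<in> coring_endos S WO"
  using hat_coring_endo[OF Gamma_I_endo] by (simp add: hat_Gamma_I)

end

section \<open>Colinear maps\<close>

abbreviation "rho \<equiv> comatrix_coaction A B M J e e'"
abbreviation "sigma \<equiv> sweedler_coaction B S \<phi>"

lemma rho_eq: "x \<in> carrier M \<Longrightarrow> rho x = (\<Oplus>\<^bsub>MC.T\<^esub>i\<in>J. MC.tt (e i) (C.tt (e' i) x))"
  by (simp add: comatrix_coaction_def Let_def)

lemma sigma_eq: "s \<in> carrier S \<Longrightarrow> sigma s = SW.tt \<one>\<^bsub>S\<^esub> (W.tt \<one>\<^bsub>S\<^esub> s)"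
  by (simp add: sweedler_coaction_def)

section \<open>From coactions to elements of \<open>S \<otimes>\<^sub>B S\<close>\<close>

lemma MC_tmap:
  assumes f: "right_linear A M M f" and h: "left_linear A C.T C.T h" and y: "y \<in> J \<rightarrow> carrier C.T"
  shows "tmap A M C.T M C.T f h (\<Oplus>\<^bsub>MC.T\<^esub>i\<in>J. MC.tt (e i) (y i)) =
    (\<Oplus>\<^bsub>MC.T\<^esub>i\<in>J. MC.tt (f (e i)) (h (y i)))"
proof -
  interpret F: tensor_map B A A M C.T B A M C.T f h
    by unfold_locales (rule f h)+
  have y': "y i \<in> carrier C.T" if "i \<in> J" for i using y that by auto
  have "F.F (\<Oplus>\<^bsub>MC.T\<^esub>i\<in>J. MC.tt (e i) (y i)) = (\<Oplus>\<^bsub>MC.T\<^esub>i\<in>J. F.F (MC.tt (e i) (y i)))"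
    using y' by (intro additive_map_finsum MC.T.abelian_group_axioms F.tmap_additive) auto
  also have "\<dots> = (\<Oplus>\<^bsub>MC.T\<^esub>i\<in>J. MC.tt (f (e i)) (h (y i)))"
    using y' right_linearD(1)[OF f] left_linearD(1)[OF h]
    by (intro finsum_eqI MC.T.abelian_group_axioms) auto
  finally show ?thesis .
qed

text \<open>The vector \<open>v\<close> closes the open right end of
  \<open>M \<otimes>\<^sub>A C\<close>. In particular \<open>rho x\<close> is sent to
  \<open>1 \<otimes> dyad x v\<close>, by \<open>W_one_expand\<close>.\<close>

definition MC_Psi where "MC_Psi v z = tlift MC.T W.T (\<lambda>u c. Psi u c v) z"

lemma MC_Psi_simps [simp]:
  assumes v: "v \<in> carrier D"
  shows "z \<in> carrier MC.T \<Longrightarrow> MC_Psi v z \<in> carrier W.T"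
    and "\<lbrakk>z \<in> carrier MC.T; z' \<in> carrier MC.T\<rbrakk> \<Longrightarrow> MC_Psi v (z \<oplus>\<^bsub>MC.T\<^esub> z') = MC_Psi v z \<oplus>\<^bsub>W.T\<^esub> MC_Psi v z'"
    and "\<lbrakk>u \<in> carrier M; c \<in> carrier C.T\<rbrakk> \<Longrightarrow> MC_Psi v (MC.tt u c) = Psi u c v"
proof -
  have "balanced A M C.T W.T (\<lambda>u c. Psi u c v)"
    by (rule balancedI) (use v in simp_all)
  note lift = W.T.abelian_group_axioms this
  show "z \<in> carrier MC.T \<Longrightarrow> MC_Psi v z \<in> carrier W.T"
    and "\<lbrakk>z \<in> carrier MC.T; z' \<in> carrier MC.T\<rbrakk> \<Longrightarrow> MC_Psi v (z \<oplus>\<^bsub>MC.T\<^esub> z') = MC_Psi v z \<oplus>\<^bsub>W.T\<^esub> MC_Psi v z'"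
    and "\<lbrakk>u \<in> carrier M; c \<in> carrier C.T\<rbrakk> \<Longrightarrow> MC_Psi v (MC.tt u c) = Psi u c v"
    unfolding MC_Psi_def
    by (rule MC.tlift_closed[OF lift] MC.tlift_add[OF lift] MC.tlift_tens[OF lift]; assumption)+
qed

lemma MC_Psi_finsum:
  assumes "v \<in> carrier D" "\<And>i. i \<in> J \<Longrightarrow> m i \<in> carrier M" "\<And>i. i \<in> J \<Longrightarrow> c i \<in> carrier C.T"
  shows "MC_Psi v (\<Oplus>\<^bsub>MC.T\<^esub>i\<in>J. MC.tt (m i) (c i)) = (\<Oplus>\<^bsub>W.T\<^esub>i\<in>J. Psi (m i) (c i) v)"
proof -
  have "MC_Psi v (\<Oplus>\<^bsub>MC.T\<^esub>i\<in>J. MC.tt (m i) (c i)) = (\<Oplus>\<^bsub>W.T\<^esub>i\<in>J. MC_Psi v (MC.tt (m i) (c i)))"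
    using assms by (intro additive_map_finsum MC.T.abelian_group_axioms W.T.abelian_group_axioms)
      (auto intro: additive_mapI)
  also have "\<dots> = (\<Oplus>\<^bsub>W.T\<^esub>i\<in>J. Psi (m i) (c i) v)"
    using assms by (intro finsum_eqI W.T.abelian_group_axioms) auto
  finally show ?thesis .
qed

lemma SW_shift:
  assumes "s \<in> carrier S" "w \<in> carrier W.T"
  shows "SW.tt s w = SW.tt \<one>\<^bsub>S\<^esub> (s \<triangleright>\<^bsub>W.T\<^esub> w)"
proof -
  have "SW.tt (\<one>\<^bsub>S\<^esub> \<triangleleft>\<^bsub>regular S\<^esub> s) w = SW.tt \<one>\<^bsub>S\<^esub> (s \<triangleright>\<^bsub>W.T\<^esub> w)"
    by (rule SW.tens_balanced) (simp_all add: assms)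
  then show ?thesis by (simp only: ring_bimod_fields S.l_one assms)
qed

lemma SW_one_inj:
  assumes "w \<in> carrier W.T" "z \<in> carrier W.T" "SW.tt \<one>\<^bsub>S\<^esub> w = SW.tt \<one>\<^bsub>S\<^esub> z"
  shows "w = z"
proof -
  \<comment> \<open>The canonical map \<open>S \<otimes>\<^sub>S W \<rightarrow> W\<close>, which is
    a left inverse of \<open>w \<mapsto> 1 \<otimes> w\<close>.\<close>
  let ?l = "tlift SW.T W.T (\<lambda>s w. s \<triangleright>\<^bsub>W.T\<^esub> w)"
  have "balanced S (regular S) W.T W.T (\<lambda>s w. s \<triangleright>\<^bsub>W.T\<^esub> w)"
    by (rule balancedI) (simp_all add: W.B.lact_ring_add W.B.lact_mult)
  note lift = SW.tlift_tens[OF W.T.abelian_group_axioms this]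
  have l: "?l (SW.tt \<one>\<^bsub>S\<^esub> y) = y" if y: "y \<in> carrier W.T" for y
    by (rule trans[OF lift W.B.lact_one]) (simp_all add: y)
  have "w = ?l (SW.tt \<one>\<^bsub>S\<^esub> w)" by (rule l[OF assms(1), symmetric])
  also have "\<dots> = z" unfolding assms(3) by (rule l[OF assms(2)])
  finally show ?thesis .
qed

section \<open>The two sets of colinear maps\<close>

context
  fixes g assumes g: "g \<in> coring_endos A CO"
begin

lemmas g_left = endos_COD(2)[OF g]
lemmas g_right = endos_COD(3)[OF g]
lemmas [simp] = g_simps[OF g_left g_right] hat_simps[OF g_left g_right]

lemma colinear_CO_iff:
  "s \<in> colinear A CO M (twist A CO M g rho) M rho \<longleftrightarrow> s \<in> carrier S \<and>
    (\<forall>x\<in>carrier M. rho (s x) = (\<Oplus>\<^bsub>MC.T\<^esub>i\<in>J. MC.tt (s (e i)) (g (C.tt (e' i) x))))"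
proof -
  have id: "right_linear A M M (\<lambda>x. x)" "left_linear A C.T C.T (\<lambda>x. x)"
    by (rule right_linearI left_linearI; simp)+
  have "tmap A M CO M CO s (\<lambda>c. c) (twist A CO M g rho x) =
    (\<Oplus>\<^bsub>MC.T\<^esub>i\<in>J. MC.tt (s (e i)) (g (C.tt (e' i) x)))"
    if "s \<in> carrier S" "x \<in> carrier M" for x
  proof -
    have "twist A CO M g rho x = (\<Oplus>\<^bsub>MC.T\<^esub>i\<in>J. MC.tt (e i) (g (C.tt (e' i) x)))"
      using that by (simp add: twist_def rho_eq MC_tmap[OF id(1) g_left])
    then show ?thesis
      using that by (simp add: MC_tmap[OF _ id(2)] S_iff)
  qed
  moreover have "right_hom A M M = carrier S" by (simp add: end_ring_def)
  ultimately show ?thesis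
    unfolding colinear_def mem_Collect_eq by (intro conj_cong ball_cong) (simp_all only:)
qed

lemma colinear_CO_eq:
  "colinear A CO M (twist A CO M g rho) M rho =
    {s \<in> carrier S. hat A B M g (W.tt s \<one>\<^bsub>S\<^esub>) = W.tt \<one>\<^bsub>S\<^esub> s}"
proof (intro equalityI subsetI)
  fix s assume "s \<in> colinear A CO M (twist A CO M g rho) M rho"
  note s = this[unfolded colinear_CO_iff, THEN conjunct1]
    and eq = this[unfolded colinear_CO_iff, THEN conjunct2, rule_format]
  \<comment> \<open>Only \<open>t = 1\<close> is wanted, but \<open>1\<close> is merely a sum of
    dyads. For \<open>t = dyad x v\<close> the right-hand side is the image of
    \<open>rho (s x)\<close> under \<open>MC_Psi v\<close>, where colinearity of \<open>s\<close>
    applies; additivity in \<open>t\<close> does the rest.\<close>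
  have "hat A B M g (W.tt s t) = W.tt \<one>\<^bsub>S\<^esub> (s \<otimes>\<^bsub>S\<^esub> t)" if "t \<in> carrier S" for t
    using that
  proof (induction rule: S_induct)
    case (dyad x v)
    have "W.tt \<one>\<^bsub>S\<^esub> (dyad (s x) v) = MC_Psi v (rho (s x))"
      using dyad s by (simp add: rho_eq MC_Psi_finsum W_one_expand del: Psi_simps(3))
    also have "\<dots> = (\<Oplus>\<^bsub>W.T\<^esub>i\<in>J. Psi (s (e i)) (g (C.tt (e' i) x)) v)"
      using dyad s by (simp add: eq MC_Psi_finsum)
    also have "\<dots> = (\<Oplus>\<^bsub>W.T\<^esub>i\<in>J. hat A B M g (Psi (s (e i)) (C.tt (e' i) x) v))"
      using dyad s by (intro finsum_eqI W.T.abelian_group_axioms) (simp_all del: Psi_simps(3))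
    also have "\<dots> = hat A B M g (\<Oplus>\<^bsub>W.T\<^esub>i\<in>J. Psi (s (e i)) (C.tt (e' i) x) v)"
      using dyad s
      by (intro additive_map_finsum[symmetric] W.T.abelian_group_axioms) (auto intro: additive_mapI)
    finally show ?case using dyad s by (simp add: W_expand)
  qed (use s in \<open>simp_all add: S.r_distr\<close>)
  from this[of "\<one>\<^bsub>S\<^esub>"] show "s \<in> {s \<in> carrier S. hat A B M g (W.tt s \<one>\<^bsub>S\<^esub>) = W.tt \<one>\<^bsub>S\<^esub> s}"
    using s by simp
next
  fix s assume "s \<in> {s \<in> carrier S. hat A B M g (W.tt s \<one>\<^bsub>S\<^esub>) = W.tt \<one>\<^bsub>S\<^esub> s}"
  then have s: "s \<in> carrier S" and eq: "hat A B M g (W.tt s \<one>\<^bsub>S\<^esub>) = W.tt \<one>\<^bsub>S\<^esub> s" by auto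
  have "rho (s x) = (\<Oplus>\<^bsub>MC.T\<^esub>i\<in>J. MC.tt (s (e i)) (g (C.tt (e' i) x)))" if x: "x \<in> carrier M" for x
  proof -
    \<comment> \<open>The equation in \<open>S \<otimes>\<^sub>B S\<close> is pushed back to
      \<open>C\<close>: \<open>Phi d x\<close> sends \<open>1 \<otimes> s\<close> to
      \<open>d \<otimes> s x\<close> and \<open>s \<otimes> 1\<close> to
      \<open>(d \<star> s) \<otimes> x\<close>.\<close>
    have phi_eq: "C.tt d (s x) = g (C.tt (d \<star> s) x)" if "d \<in> carrier D" for d
      using hat_Phi[OF g_left g_right, of "W.tt s \<one>\<^bsub>S\<^esub>" d x] that s x by (simp add: eq)
    \<comment> \<open>With this map \<open>basis_shift\<close> moves \<open>s\<close> from
      \<open>e i\<close> to \<open>e' i\<close>, which produces the argument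
      \<open>e' i \<star> s\<close> that \<open>phi_eq\<close> expects.\<close>
    have "balanced A M D MC.T (\<lambda>m d. MC.tt m (g (C.tt d x)))"
      by (rule balancedI) (use x in \<open>simp_all flip: C.lact_tens\<close>)
    from basis_shift[OF MC.T.abelian_group_axioms this s]
    have "(\<Oplus>\<^bsub>MC.T\<^esub>i\<in>J. MC.tt (s (e i)) (g (C.tt (e' i) x))) =
      (\<Oplus>\<^bsub>MC.T\<^esub>i\<in>J. MC.tt (e i) (g (C.tt (e' i \<star> s) x)))" .
    also have "\<dots> = (\<Oplus>\<^bsub>MC.T\<^esub>i\<in>J. MC.tt (e i) (C.tt (e' i) (s x)))"
      using s x by (intro finsum_eqI MC.T.abelian_group_axioms) (simp_all add: phi_eq)
    finally show ?thesis using s x by (simp add: rho_eq)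
  qed
  then show "s \<in> colinear A CO M (twist A CO M g rho) M rho"
    using s by (simp add: colinear_CO_iff)
qed

lemma colinear_WO_iff:
  "f \<in> colinear S WO (regular S) (twist S WO (regular S) (hat A B M g) sigma) (regular S) sigma \<longleftrightarrow>
    f \<in> right_hom S (regular S) (regular S) \<and>
    (\<forall>s\<in>carrier S. sigma (f s) = SW.tt (f \<one>\<^bsub>S\<^esub>) (hat A B M g (W.tt \<one>\<^bsub>S\<^esub> s)))"
proof -
  have id: "right_linear S (regular S) (regular S) (\<lambda>x. x)" "left_linear S W.T W.T (\<lambda>x. x)"
    by (rule right_linearI left_linearI; simp)+
  interpret h: tensor_map S S S "regular S" W.T S S "regular S" W.T "\<lambda>x. x" "hat A B M g"
    by unfold_locales (rule id hat_left_linear[OF g_left g_right])+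
  have "tmap S (regular S) WO (regular S) WO f (\<lambda>c. c) (twist S WO (regular S) (hat A B M g) sigma s) =
    SW.tt (f \<one>\<^bsub>S\<^esub>) (hat A B M g (W.tt \<one>\<^bsub>S\<^esub> s))"
    if f: "f \<in> right_hom S (regular S) (regular S)" and s: "s \<in> carrier S" for s
  proof -
    have fl: "right_linear S (regular S) (regular S) f" using f by (simp add: right_hom_iff)
    interpret f: tensor_map S S S "regular S" W.T S S "regular S" W.T f "\<lambda>x. x"
      by unfold_locales (rule id fl)+
    have "twist S WO (regular S) (hat A B M g) sigma s = SW.tt \<one>\<^bsub>S\<^esub> (hat A B M g (W.tt \<one>\<^bsub>S\<^esub> s))"
      using s h.tmap_tens[of "\<one>\<^bsub>S\<^esub>" "W.tt \<one>\<^bsub>S\<^esub> s"] by (simp add: twist_def sigma_eq)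
    then show ?thesis
      using s f.tmap_tens[of "\<one>\<^bsub>S\<^esub>" "hat A B M g (W.tt \<one>\<^bsub>S\<^esub> s)"] by simp
  qed
  then show ?thesis
    unfolding colinear_def mem_Collect_eq by (intro conj_cong ball_cong) (simp_all only: ring_bimod_fields)
qed

text \<open>Colinearity evaluated at \<open>1\<close> gives the equation once \<open>a\<close> has
  crossed \<open>\<otimes>\<^sub>S\<close> and the leading \<open>1 \<otimes>\<close> has been
  cancelled. Conversely, linearity of \<open>hat\<close> over \<open>S\<close> on both sides spreads
  the equation from \<open>1\<close> to every \<open>s\<close>, for left multiplication by
  \<open>a\<close>.\<close>

lemma colinear_WO_eq:
  "(\<lambda>f. f \<one>\<^bsub>S\<^esub>) ` colinear S WO (regular S) (twist S WO (regular S) (hat A B M g) sigma) (regular S) sigma =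
    {s \<in> carrier S. hat A B M g (W.tt s \<one>\<^bsub>S\<^esub>) = W.tt \<one>\<^bsub>S\<^esub> s}"
proof (intro equalityI subsetI)
  fix a assume "a \<in> (\<lambda>f. f \<one>\<^bsub>S\<^esub>) ` colinear S WO (regular S) (twist S WO (regular S) (hat A B M g) sigma) (regular S) sigma"
  then obtain f where a: "a = f \<one>\<^bsub>S\<^esub>"
    and col: "f \<in> colinear S WO (regular S) (twist S WO (regular S) (hat A B M g) sigma) (regular S) sigma"
    by (rule imageE)
  note f = col[unfolded colinear_WO_iff, THEN conjunct1]
    and eq = col[unfolded colinear_WO_iff, THEN conjunct2, rule_format]
  have ac: "a \<in> carrier S"
    using f right_linearD(1)[of S "regular S" "regular S" f "\<one>\<^bsub>S\<^esub>"] by (simp add: a right_hom_iff)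
  have "SW.tt \<one>\<^bsub>S\<^esub> (W.tt \<one>\<^bsub>S\<^esub> a) = SW.tt a (hat A B M g (W.tt \<one>\<^bsub>S\<^esub> \<one>\<^bsub>S\<^esub>))"
    using eq[of "\<one>\<^bsub>S\<^esub>"] ac by (simp add: sigma_eq flip: a)
  also have "\<dots> = SW.tt \<one>\<^bsub>S\<^esub> (hat A B M g (W.tt a \<one>\<^bsub>S\<^esub>))"
    using ac left_linearD(3)[OF hat_left_linear[OF g_left g_right], of a "W.tt \<one>\<^bsub>S\<^esub> \<one>\<^bsub>S\<^esub>"]
    by (simp add: SW_shift[of a])
  finally have "W.tt \<one>\<^bsub>S\<^esub> a = hat A B M g (W.tt a \<one>\<^bsub>S\<^esub>)"
    by (rule SW_one_inj[rotated 2]) (use ac in simp_all)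
  then show "a \<in> {s \<in> carrier S. hat A B M g (W.tt s \<one>\<^bsub>S\<^esub>) = W.tt \<one>\<^bsub>S\<^esub> s}"
    using ac by simp
next
  fix a assume "a \<in> {s \<in> carrier S. hat A B M g (W.tt s \<one>\<^bsub>S\<^esub>) = W.tt \<one>\<^bsub>S\<^esub> s}"
  then have a: "a \<in> carrier S" and eq: "hat A B M g (W.tt a \<one>\<^bsub>S\<^esub>) = W.tt \<one>\<^bsub>S\<^esub> a" by auto
  define f where "f = (\<lambda>s\<in>carrier S. a \<otimes>\<^bsub>S\<^esub> s)"
  have "f \<in> right_hom S (regular S) (regular S)"
    using a by (auto simp: f_def right_hom_def S.r_distr S.m_assoc)
  moreover have "sigma (f s) = SW.tt (f \<one>\<^bsub>S\<^esub>) (hat A B M g (W.tt \<one>\<^bsub>S\<^esub> s))" if s: "s \<in> carrier S" for s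
  proof -
    have "a \<triangleright>\<^bsub>W.T\<^esub> hat A B M g (W.tt \<one>\<^bsub>S\<^esub> s) = hat A B M g (W.tt a s)"
      using a s left_linearD(3)[OF hat_left_linear[OF g_left g_right], of a "W.tt \<one>\<^bsub>S\<^esub> s"] by simp
    also have "\<dots> = hat A B M g (W.tt a \<one>\<^bsub>S\<^esub>) \<triangleleft>\<^bsub>W.T\<^esub> s"
      using a s right_linearD(3)[OF hat_right_linear[OF g_left g_right], of "W.tt a \<one>\<^bsub>S\<^esub>" s] by simp
    also have "\<dots> = W.tt \<one>\<^bsub>S\<^esub> (a \<otimes>\<^bsub>S\<^esub> s)" using a s by (simp add: eq)
    finally show ?thesis using a s by (simp add: f_def sigma_eq SW_shift[of a])
  qed
  ultimately have "f \<in> colinear S WO (regular S) (twist S WO (regular S) (hat A B M g) sigma) (regular S) sigma"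
    unfolding colinear_WO_iff by (intro conjI ballI)
  then show "a \<in> (\<lambda>f. f \<one>\<^bsub>S\<^esub>) ` colinear S WO (regular S) (twist S WO (regular S) (hat A B M g) sigma) (regular S) sigma"
    by (rule rev_image_eqI) (use a in \<open>simp add: f_def\<close>)
qed

end

end

theorem proposition2p6:
  fixes K :: "'k ring" and A :: "'a ring" and B :: "'b ring"
    and \<Sigma> :: "('b, 'a, 'm) bimod"
    and \<eta>A :: "'k \<Rightarrow> 'a" and \<eta>B :: "'k \<Rightarrow> 'b"
    and J :: "'i set" and e :: "'i \<Rightarrow> 'm" and e' :: "'i \<Rightarrow> 'm \<Rightarrow> 'a"
  assumes "k_algebra K \<eta>A A" and "k_algebra K \<eta>B B"
    and "bimodule B A \<Sigma>" and "central_over K \<eta>B \<eta>A \<Sigma>"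
    and "left_faithful B \<Sigma>"
    and "finitely_generated A \<Sigma>" and "projective A \<Sigma>"
    and "dual_basis A \<Sigma> J e e'"
  shows
    "let S = end_ring A \<Sigma>; \<phi> = left_mult \<Sigma>; t = tens B (SB S \<phi>) (BS S \<phi>);
         C = comatrix A B \<Sigma> J e e'; \<rho> = comatrix_coaction A B \<Sigma> J e e';
         W = sweedler B S \<phi>; \<sigma> = sweedler_coaction B S \<phi>;
         EndA = coring_End A C; EndS = coring_End S W
     in (hat A B \<Sigma> \<in> monoid_homs EndA EndS \<and>
         inj_on (hat A B \<Sigma>) (carrier EndA) \<and>
         Gamma A B \<Sigma> \<in> inv_left B S \<phi> \<rightarrow> carrier EndA \<and>
         Gamma_bar B S \<phi> \<in> inv_left B S \<phi> \<rightarrow> carrier EndS \<and>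
         (\<forall>I \<in> inv_left B S \<phi>. hat A B \<Sigma> (Gamma A B \<Sigma> I) = Gamma_bar B S \<phi> I)) \<and>
        (\<forall>g \<in> carrier EndA.
          colinear A C \<Sigma> (twist A C \<Sigma> g \<rho>) \<Sigma> \<rho>
            = (\<lambda>f. f \<one>\<^bsub>S\<^esub>) ` colinear S W (regular S) (twist S W (regular S) (hat A B \<Sigma> g) \<sigma>)
                (regular S) \<sigma> \<and>
          (\<lambda>f. f \<one>\<^bsub>S\<^esub>) ` colinear S W (regular S) (twist S W (regular S) (hat A B \<Sigma> g) \<sigma>)
                (regular S) \<sigma>
            = {s \<in> carrier S. hat A B \<Sigma> g (t s \<one>\<^bsub>S\<^esub>) = t \<one>\<^bsub>S\<^esub> s})"
proof -
  interpret comatrix_setting A B \<Sigma> J e e'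
    using assms(3,8) by (intro comatrix_setting.intro comatrix_setting_axioms.intro)
  have carrier: "carrier (coring_End R C) = coring_endos R C" for R C
    by (simp add: coring_End_def)
  show ?thesis
    unfolding Let_def carrier
    by (intro conjI ballI funcsetI hat_hom hat_inj; (erule Gamma_I_endo Gamma_bar_I_endo hat_Gamma_I)?)
      (simp_all only: colinear_CO_eq colinear_WO_eq)
qed

end
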